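(* Let $M$ be a non-product Kähler surface of Calabi type, with Killing vector field $K=\partial/\partial t$, given by $$g=z\,g_\Sigma+\frac{z}{V(z)}dz^2+\frac{V(z)}{z}(dt+\alpha)^2,\qquad \omega=z\,\omega_\Sigma+dz\wedge(dt+\alpha),\qquad( * )$$ where $g_\Sigma$ is a metric on a $2$-manifold $\Sigma$ with area form $\omega_\Sigma$, $\alpha$ is a $1$-form on $\Sigma$ with $d\alpha=\omega_\Sigma$, and $V$ is a function of one variable. Then the scalar curvature of $M$ is a momentum map for a multiple of $K$ if and only if $g_\Sigma$ has constant curvature $k$ and $V$ is of the form $$V(z)=A_1z^4+A_2z^3+kz^2+A_3z+A_4\qquad( ** )$$ with $A_1,\dots,A_4$ constants. Any Kähler surface given by $( * )$, with $g_\Sigma$ of constant curvature $k$ and $V$ of the form $( ** )$, is extremal, with Ricci form $\mu\,\omega_I+\frac32s\,\omega$, where $$\mu=-A_1z+\frac{A_3}{2z^2},\qquad s=-2A_1z-A_2;$$ also the conformal scalar curvature of $(g,I)$ is $$\kappa=-\frac{A_3}{z^2}-\frac{2A_4}{z^3}.$$ Hence: (i) $g$ has constant scalar curvature if and only if $A_1=0$; (ii) $g$ is scalar-flat (i.e., anti-selfdual) if and only if $A_1=A_2=0$; (iii) $(g,J)$ is Kähler–Einstein if and only if $A_1=A_3=0$; (iv) $g$ is weakly selfdual if and only if $A_3=0$; (v) $g$ is selfdual if and only if $A_3=A_4=0$; (vi) $(g,J)$ is bi-extremal if and only if $g$ is weakly selfdual; (vii) the Bach tensor of $g$ vanishes if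 and only if $4A_1A_4-A_2A_3=0$.
   Context: A Kähler surface $(M,g,J,\omega)$ is an oriented Riemannian $4$-manifold with a $g$-orthogonal complex structure $J$ inducing the given orientation and satisfying $\nabla J=0$; $\omega(\cdot,\cdot)=g(J\cdot,\cdot)$. It is of Calabi type if it admits a non-vanishing hamiltonian Killing vector field $K$ such that $(g,I)$ is conformally Kähler, where $I$ equals $J$ on the span of $K,JK$ and $-J$ on its orthogonal complement. Every such surface which is not a local Kähler product is locally of the form $( * )$, where $z>0$, $V(z)>0$ and $z$ is a momentum map of $K$ ($K=J\,\mathrm{grad}_gz$). $\omega_I=-z\,\omega_\Sigma+dz\wedge(dt+\alpha)$ is the fundamental form of $(g,I)$. $s=\frac16\mathrm{Scal}$ is the normalized scalar curvature; the Ricci form is $\rho=\mathrm{Ric}(J\cdot,\cdot)$ with trace-free part $\rho_0$; $h=\frac12\mathrm{Ric}_0+\frac1{24}\mathrm{Scal}\,g$, $\tilde\rho=h(J\cdot,\cdot)$, and $p$ is its pfaffian, defined by $\tilde\rho\wedge\tilde\rho=\frac14p\,\omega\wedge\omega$. A holomorphic potential is a function $f$ with $J\,\mathrm{grad}_gf$ Killing; the metric is extremal if $s$ is a holomorphic potential and bi-extremal if both $s$ and $p$ are. The conformal scalar curvature $\kappa$ of $(g,I)$ is $\kappa=\bar s\lambda^{-2}$, where $\bar g=\lambda^{-2}g$ is Kähler with respect to $I$ (here $\lambda=z$) and $\bar s$ is one sixth of its scalar curvature. Selfdual means $W^-=0$, anti-selfdual means $W^+=0$, weakly selfdual means $\delta^gW^-=0$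 ($W^-$ viewed as a $2$-form with values in $\Lambda^-M$). The Bach tensor is $B_{X,Y}=\sum_i\bigl(-(\nabla_{e_i}C)_{e_i,X}(Y)+(W_{e_i,X}h(e_i),Y)\bigr)$ for an orthonormal frame $e_i$, with $C_{X,Y}(Z)=-(\nabla_Xh)(Y,Z)+(\nabla_Yh)(X,Z)$. "Curvature $k$" of $g_\Sigma$ means Gauss curvature. *)

theory Defs
  imports "HOL-Analysis.Analysis"
begin

section \<open>Partial derivatives and smoothness\<close>

definition pd :: "'n::finite \<Rightarrow> (real^'n \<Rightarrow> 'b::real_normed_vector) \<Rightarrow> real^'n \<Rightarrow> 'b" where
  "pd i f x = frechet_derivative f (at x) (axis i 1)"

text \<open>Meant for open sets only: all iterated partial derivatives exist and are differentiable.\<close>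

definition smooth_on :: "(real^'n::finite) set \<Rightarrow> (real^'n \<Rightarrow> 'b::real_normed_vector) \<Rightarrow> bool" where
  "smooth_on S f \<longleftrightarrow> (\<forall>is. \<forall>x\<in>S. foldr pd is f differentiable (at x))"


section \<open>Manifolds given by an indexed atlas\<close>

record ('i, 'p, 'n::finite) atlas =
  idx :: "'i set"
  cdom :: "'i \<Rightarrow> 'p set"
  crd :: "'i \<Rightarrow> 'p \<Rightarrow> real^'n"

definition coords :: "('i, 'p, 'n::finite) atlas \<Rightarrow> 'i \<Rightarrow> (real^'n) set" where
  "coords M i = crd M i ` cdom M i"

definition overlap :: "('i, 'p, 'n::finite) atlas \<Rightarrow> 'i \<Rightarrow> 'i \<Rightarrow> (real^'n) set" where
  "overlap M i j = crd M i ` (cdom M i \<inter> cdom M j)"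

definition points :: "('i, 'p, 'n::finite) atlas \<Rightarrow> 'p set" where
  "points M = (\<Union>i\<in>idx M. cdom M i)"

definition chart_inv :: "('i, 'p, 'n::finite) atlas \<Rightarrow> 'i \<Rightarrow> real^'n \<Rightarrow> 'p" where
  "chart_inv M i = inv_into (cdom M i) (crd M i)"

definition transition :: "('i, 'p, 'n::finite) atlas \<Rightarrow> 'i \<Rightarrow> 'i \<Rightarrow> real^'n \<Rightarrow> real^'n" where
  "transition M i j = crd M j \<circ> chart_inv M i"

definition jac :: "('i, 'p, 'n::finite) atlas \<Rightarrow> 'i \<Rightarrow> 'i \<Rightarrow> real^'n \<Rightarrow> real^'n^'n" where
  "jac M i j x = matrix (frechet_derivative (transition M i j) (at x))"

definition smooth_atlas :: "('i, 'p::topological_space, 'n::finite) atlas \<Rightarrow> bool" where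
  "smooth_atlas M \<longleftrightarrow>
     (\<forall>i\<in>idx M. open (cdom M i) \<and> open (coords M i) \<and>
        homeomorphism (cdom M i) (coords M i) (crd M i) (chart_inv M i)) \<and>
     (\<forall>i\<in>idx M. \<forall>j\<in>idx M. smooth_on (overlap M i j) (transition M i j))"

definition oriented_atlas :: "('i, 'p::topological_space, 'n::finite) atlas \<Rightarrow> bool" where
  "oriented_atlas M \<longleftrightarrow> smooth_atlas M \<and>
     (\<forall>i\<in>idx M. \<forall>j\<in>idx M. \<forall>x\<in>overlap M i j. det (jac M i j x) > 0)"

text \<open>
  A tensor field is a family, indexed by the charts, of component functions on the chart images,
  subject to the usual transformation law on overlaps. Values off the chart images are irrelevant.
\<close>

type_synonym ('i, 'n, 'b) field = "'i \<Rightarrow> real^'n \<Rightarrow> 'b"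

definition everywhere :: "('i, 'p, 'n::finite) atlas \<Rightarrow> ('i, 'n, bool) field \<Rightarrow> bool" where
  "everywhere M P \<longleftrightarrow> (\<forall>i\<in>idx M. \<forall>x\<in>coords M i. P i x)"

definition smooth_function ::
    "('i, 'p, 'n::finite) atlas \<Rightarrow> ('i, 'n, real) field \<Rightarrow> bool" where
  "smooth_function M f \<longleftrightarrow> (\<forall>i\<in>idx M. smooth_on (coords M i) (f i)) \<and>
     (\<forall>i\<in>idx M. \<forall>j\<in>idx M. \<forall>x\<in>overlap M i j. f i x = f j (transition M i j x))"

definition one_form ::
    "('i, 'p, 'n::finite) atlas \<Rightarrow> ('i, 'n, real^'n) field \<Rightarrow> bool" where
  "one_form M a \<longleftrightarrow> (\<forall>i\<in>idx M. smooth_on (coords M i) (a i)) \<and>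
     (\<forall>i\<in>idx M. \<forall>j\<in>idx M. \<forall>x\<in>overlap M i j.
        a i x = transpose (jac M i j x) *v a j (transition M i j x))"

definition vector_field ::
    "('i, 'p, 'n::finite) atlas \<Rightarrow> ('i, 'n, real^'n) field \<Rightarrow> bool" where
  "vector_field M X \<longleftrightarrow> (\<forall>i\<in>idx M. smooth_on (coords M i) (X i)) \<and>
     (\<forall>i\<in>idx M. \<forall>j\<in>idx M. \<forall>x\<in>overlap M i j.
        X j (transition M i j x) = jac M i j x *v X i x)"

definition riemannian_metric ::
    "('i, 'p, 'n::finite) atlas \<Rightarrow> ('i, 'n, real^'n^'n) field \<Rightarrow> bool" where
  "riemannian_metric M g \<longleftrightarrow> (\<forall>i\<in>idx M. smooth_on (coords M i) (g i)) \<and>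
     everywhere M (\<lambda>i x. transpose (g i x) = g i x \<and> (\<forall>v. v \<noteq> 0 \<longrightarrow> v \<bullet> (g i x *v v) > 0)) \<and>
     (\<forall>i\<in>idx M. \<forall>j\<in>idx M. \<forall>x\<in>overlap M i j.
        g i x = transpose (jac M i j x) ** g j (transition M i j x) ** jac M i j x)"

text \<open>An endomorphism field acts by \<open>v \<mapsto> E i x *v v\<close>.\<close>

definition endomorphism_field ::
    "('i, 'p, 'n::finite) atlas \<Rightarrow> ('i, 'n, real^'n^'n) field \<Rightarrow> bool" where
  "endomorphism_field M E \<longleftrightarrow> (\<forall>i\<in>idx M. smooth_on (coords M i) (E i)) \<and>
     (\<forall>i\<in>idx M. \<forall>j\<in>idx M. \<forall>x\<in>overlap M i j.
        jac M i j x ** E i x = E j (transition M i j x) ** jac M i j x)"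


section \<open>Exterior algebra in coordinates\<close>

definition outer :: "real^'n \<Rightarrow> real^'n \<Rightarrow> real^'n^'n" where
  "outer u v = (\<chi> i j. u $ i * v $ j)"

definition wedge :: "real^'n \<Rightarrow> real^'n \<Rightarrow> real^'n^'n" where
  "wedge u v = outer u v - outer v u"

text \<open>The coefficient of \<open>a \<and> b\<close> with respect to the coordinate \<open>4\<close>-form.\<close>

definition wedge4 :: "real^4^4 \<Rightarrow> real^4^4 \<Rightarrow> real" where
  "wedge4 a b = a$1$2 * b$3$4 - a$1$3 * b$2$4 + a$1$4 * b$2$3
              + a$2$3 * b$1$4 - a$2$4 * b$1$3 + a$3$4 * b$1$2"

definition ext_d :: "(real^'n::finite \<Rightarrow> real^'n) \<Rightarrow> real^'n \<Rightarrow> real^'n^'n" where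
  "ext_d a x = (\<chi> j k. pd j (\<lambda>y. a y $ k) x - pd k (\<lambda>y. a y $ j) x)"

definition area_form :: "real^2^2 \<Rightarrow> real^2^2" where
  "area_form g = sqrt (det g) *\<^sub>R wedge (axis 1 1) (axis 2 1)"

text \<open>The bilinear form \<open>b (E \<cdot>, \<cdot>)\<close>.\<close>

definition twist :: "real^'n^'n \<Rightarrow> real^'n^'n \<Rightarrow> real^'n^'n" where
  "twist b E = transpose E ** b"


section \<open>Curvature of a metric in coordinates\<close>

definition christoffel ::
    "(real^'n::finite \<Rightarrow> real^'n^'n) \<Rightarrow> real^'n \<Rightarrow> 'n \<Rightarrow> 'n \<Rightarrow> 'n \<Rightarrow> real" where
  "christoffel g x k i j = (\<Sum>l\<in>UNIV. matrix_inv (g x) $ k $ l *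
     (pd i (\<lambda>y. g y $ j $ l) x + pd j (\<lambda>y. g y $ i $ l) x - pd l (\<lambda>y. g y $ i $ j) x)) / 2"

text \<open>In the covariant derivatives below, the first index \<open>m\<close> is the direction of differentiation.\<close>

definition nabla_endo :: "(real^'n::finite \<Rightarrow> real^'n^'n) \<Rightarrow> (real^'n \<Rightarrow> real^'n^'n) \<Rightarrow>
    real^'n \<Rightarrow> 'n \<Rightarrow> 'n \<Rightarrow> 'n \<Rightarrow> real" where
  "nabla_endo g E x m a b = pd m (\<lambda>y. E y $ a $ b) x
     + (\<Sum>r\<in>UNIV. christoffel g x a m r * E x $ r $ b)
     - (\<Sum>r\<in>UNIV. christoffel g x r m b * E x $ a $ r)"

definition nabla2 :: "(real^'n::finite \<Rightarrow> real^'n^'n) \<Rightarrow> (real^'n \<Rightarrow> 'n \<Rightarrow> 'n \<Rightarrow> real) \<Rightarrow>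
    real^'n \<Rightarrow> 'n \<Rightarrow> 'n \<Rightarrow> 'n \<Rightarrow> real" where
  "nabla2 g T x m a b = pd m (\<lambda>y. T y a b) x
     - (\<Sum>r\<in>UNIV. christoffel g x r m a * T x r b)
     - (\<Sum>r\<in>UNIV. christoffel g x r m b * T x a r)"

definition nabla3 :: "(real^'n::finite \<Rightarrow> real^'n^'n) \<Rightarrow> (real^'n \<Rightarrow> 'n \<Rightarrow> 'n \<Rightarrow> 'n \<Rightarrow> real) \<Rightarrow>
    real^'n \<Rightarrow> 'n \<Rightarrow> 'n \<Rightarrow> 'n \<Rightarrow> 'n \<Rightarrow> real" where
  "nabla3 g T x m a b c = pd m (\<lambda>y. T y a b c) x
     - (\<Sum>r\<in>UNIV. christoffel g x r m a * T x r b c)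
     - (\<Sum>r\<in>UNIV. christoffel g x r m b * T x a r c)
     - (\<Sum>r\<in>UNIV. christoffel g x r m c * T x a b r)"

definition nabla4 :: "(real^'n::finite \<Rightarrow> real^'n^'n) \<Rightarrow>
    (real^'n \<Rightarrow> 'n \<Rightarrow> 'n \<Rightarrow> 'n \<Rightarrow> 'n \<Rightarrow> real) \<Rightarrow>
    real^'n \<Rightarrow> 'n \<Rightarrow> 'n \<Rightarrow> 'n \<Rightarrow> 'n \<Rightarrow> 'n \<Rightarrow> real" where
  "nabla4 g T x m a b c d = pd m (\<lambda>y. T y a b c d) x
     - (\<Sum>r\<in>UNIV. christoffel g x r m a * T x r b c d)
     - (\<Sum>r\<in>UNIV. christoffel g x r m b * T x a r c d)
     - (\<Sum>r\<in>UNIV. christoffel g x r m c * T x a b r d)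
     - (\<Sum>r\<in>UNIV. christoffel g x r m d * T x a b c r)"

text \<open>
  Sign convention: \<open>R\<^sub>X\<^sub>,\<^sub>Y = \<nabla>\<^sub>[\<^sub>X\<^sub>,\<^sub>Y\<^sub>] - [\<nabla>\<^sub>X, \<nabla>\<^sub>Y]\<close>, so that \<open>(R\<^sub>X\<^sub>,\<^sub>Y X, Y)\<close> is positive on round spheres.
  This is the convention for which the two terms of the Bach tensor below have the correct
  relative sign. The number \<open>riem g x a b c d\<close> is the \<open>d\<close>-th component of
  \<open>R\<^sub>a\<^sub>,\<^sub>b e\<^sub>c\<close>, and \<open>rm g x a b c d\<close> is \<open>(R\<^sub>a\<^sub>,\<^sub>b e\<^sub>c, e\<^sub>d)\<close>.
\<close>

definition riem ::
    "(real^'n::finite \<Rightarrow> real^'n^'n) \<Rightarrow> real^'n \<Rightarrow> 'n \<Rightarrow> 'n \<Rightarrow> 'n \<Rightarrow> 'n \<Rightarrow> real" where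
  "riem g x a b c d =
     pd b (\<lambda>y. christoffel g y d a c) x - pd a (\<lambda>y. christoffel g y d b c) x
     + (\<Sum>m\<in>UNIV. christoffel g x d b m * christoffel g x m a c)
     - (\<Sum>m\<in>UNIV. christoffel g x d a m * christoffel g x m b c)"

definition rm ::
    "(real^'n::finite \<Rightarrow> real^'n^'n) \<Rightarrow> real^'n \<Rightarrow> 'n \<Rightarrow> 'n \<Rightarrow> 'n \<Rightarrow> 'n \<Rightarrow> real" where
  "rm g x a b c d = (\<Sum>e\<in>UNIV. g x $ d $ e * riem g x a b c e)"

definition gauss_curvature :: "(real^2 \<Rightarrow> real^2^2) \<Rightarrow> real^2 \<Rightarrow> real" where
  "gauss_curvature g x = rm g x 1 2 1 2 / det (g x)"

definition ricci :: "(real^'n::finite \<Rightarrow> real^'n^'n) \<Rightarrow> real^'n \<Rightarrow> real^'n^'n" where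
  "ricci g x = (\<chi> b c. \<Sum>a\<in>UNIV. riem g x b a c a)"

definition scal :: "(real^'n::finite \<Rightarrow> real^'n^'n) \<Rightarrow> real^'n \<Rightarrow> real" where
  "scal g x = (\<Sum>b\<in>UNIV. \<Sum>c\<in>UNIV. matrix_inv (g x) $ b $ c * ricci g x $ b $ c)"

definition norm_scal :: "(real^4 \<Rightarrow> real^4^4) \<Rightarrow> real^4 \<Rightarrow> real" where
  "norm_scal g x = scal g x / 6"

definition ricci0 :: "(real^4 \<Rightarrow> real^4^4) \<Rightarrow> real^4 \<Rightarrow> real^4^4" where
  "ricci0 g x = ricci g x - (scal g x / 4) *\<^sub>R g x"

definition norm_ricci :: "(real^4 \<Rightarrow> real^4^4) \<Rightarrow> real^4 \<Rightarrow> real^4^4" where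
  "norm_ricci g x = (1/2) *\<^sub>R ricci0 g x + (scal g x / 24) *\<^sub>R g x"

definition weyl :: "(real^4 \<Rightarrow> real^4^4) \<Rightarrow> real^4 \<Rightarrow> 4 \<Rightarrow> 4 \<Rightarrow> 4 \<Rightarrow> 4 \<Rightarrow> real" where
  "weyl g x a b c d = rm g x a b c d -
     (let h = norm_ricci g x in
        h$a$c * g x$b$d + h$b$d * g x$a$c - h$a$d * g x$b$c - h$b$c * g x$a$d)"

text \<open>
  Volume form with respect to the orientation of the chart; the determinant is the Levi-Civita
  symbol.
\<close>

definition vol :: "(real^4 \<Rightarrow> real^4^4) \<Rightarrow> real^4 \<Rightarrow> 4 \<Rightarrow> 4 \<Rightarrow> 4 \<Rightarrow> 4 \<Rightarrow> real" where
  "vol g x a b c d = sqrt (det (g x)) *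
     det (vector [axis a 1, axis b 1, axis c 1, axis d 1] :: real^4^4)"

definition star_weyl :: "(real^4 \<Rightarrow> real^4^4) \<Rightarrow> real^4 \<Rightarrow> 4 \<Rightarrow> 4 \<Rightarrow> 4 \<Rightarrow> 4 \<Rightarrow> real" where
  "star_weyl g x a b c d = (\<Sum>p\<in>UNIV. \<Sum>q\<in>UNIV. \<Sum>e\<in>UNIV. \<Sum>f\<in>UNIV.
     vol g x a b p q * matrix_inv (g x) $ p $ e * matrix_inv (g x) $ q $ f * weyl g x e f c d) / 2"

definition weyl_plus :: "(real^4 \<Rightarrow> real^4^4) \<Rightarrow> real^4 \<Rightarrow> 4 \<Rightarrow> 4 \<Rightarrow> 4 \<Rightarrow> 4 \<Rightarrow> real" where
  "weyl_plus g x a b c d = (weyl g x a b c d + star_weyl g x a b c d) / 2"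

definition weyl_minus :: "(real^4 \<Rightarrow> real^4^4) \<Rightarrow> real^4 \<Rightarrow> 4 \<Rightarrow> 4 \<Rightarrow> 4 \<Rightarrow> 4 \<Rightarrow> real" where
  "weyl_minus g x a b c d = (weyl g x a b c d - star_weyl g x a b c d) / 2"

definition div_weyl_minus :: "(real^4 \<Rightarrow> real^4^4) \<Rightarrow> real^4 \<Rightarrow> 4 \<Rightarrow> 4 \<Rightarrow> 4 \<Rightarrow> real" where
  "div_weyl_minus g x b c d = - (\<Sum>m\<in>UNIV. \<Sum>a\<in>UNIV.
     matrix_inv (g x) $ m $ a * nabla4 g (weyl_minus g) x m a b c d)"

definition cotton :: "(real^4 \<Rightarrow> real^4^4) \<Rightarrow> real^4 \<Rightarrow> 4 \<Rightarrow> 4 \<Rightarrow> 4 \<Rightarrow> real" where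
  "cotton g x a b c =
     - nabla2 g (\<lambda>y i j. norm_ricci g y $ i $ j) x a b c
     + nabla2 g (\<lambda>y i j. norm_ricci g y $ i $ j) x b a c"

definition bach :: "(real^4 \<Rightarrow> real^4^4) \<Rightarrow> real^4 \<Rightarrow> 4 \<Rightarrow> 4 \<Rightarrow> real" where
  "bach g x b c =
     (\<Sum>i\<in>UNIV. \<Sum>j\<in>UNIV. matrix_inv (g x) $ i $ j * (- nabla3 g (cotton g) x i j b c)) +
     (\<Sum>i\<in>UNIV. \<Sum>j\<in>UNIV. \<Sum>k\<in>UNIV. \<Sum>l\<in>UNIV. matrix_inv (g x) $ i $ j * matrix_inv (g x) $ k $ l *
        norm_ricci g x $ j $ l * weyl g x i b k c)"

definition gradient :: "(real^'n::finite \<Rightarrow> real^'n^'n) \<Rightarrow> (real^'n \<Rightarrow> real) \<Rightarrow> real^'n \<Rightarrow> real^'n" where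
  "gradient g f x = matrix_inv (g x) *v (\<chi> k. pd k f x)"

definition lie_metric :: "(real^'n::finite \<Rightarrow> real^'n^'n) \<Rightarrow> (real^'n \<Rightarrow> real^'n) \<Rightarrow>
    real^'n \<Rightarrow> 'n \<Rightarrow> 'n \<Rightarrow> real" where
  "lie_metric g X x a b = (\<Sum>m\<in>UNIV. X x $ m * pd m (\<lambda>y. g y $ a $ b) x
     + g x $ m $ b * pd a (\<lambda>y. X y $ m) x + g x $ a $ m * pd b (\<lambda>y. X y $ m) x)"


section \<open>Kaehler surfaces\<close>

definition momentum_map :: "('i, 'p, 4) atlas \<Rightarrow> ('i, 4, real^4^4) field \<Rightarrow>
    ('i, 4, real^4^4) field \<Rightarrow> ('i, 4, real) field \<Rightarrow> ('i, 4, real^4) field \<Rightarrow> bool" where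
  "momentum_map M g J f X \<longleftrightarrow> everywhere M (\<lambda>i x. X i x = J i x *v gradient (g i) (f i) x)"

definition killing ::
    "('i, 'p, 4) atlas \<Rightarrow> ('i, 4, real^4^4) field \<Rightarrow> ('i, 4, real^4) field \<Rightarrow> bool" where
  "killing M g X \<longleftrightarrow> everywhere M (\<lambda>i x. \<forall>a b. lie_metric (g i) (X i) x a b = 0)"

text \<open>
  The compatibility of \<open>J\<close> with an orientation is not part of this predicate, because it is also
  applied to structures inducing the opposite orientation; \<open>\<nabla>J = 0\<close> implies integrability.
\<close>

definition kaehler :: "('i, 'p::topological_space, 4) atlas \<Rightarrow> ('i, 4, real^4^4) field \<Rightarrow>
    ('i, 4, real^4^4) field \<Rightarrow> bool" where
  "kaehler M g J \<longleftrightarrow> smooth_atlas M \<and> riemannian_metric M g \<and> endomorphism_field M J \<and>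
     everywhere M (\<lambda>i x. J i x ** J i x = - mat 1 \<and> transpose (J i x) ** g i x ** J i x = g i x \<and>
       (\<forall>m a b. nabla_endo (g i) (J i) x m a b = 0))"

text \<open>
  The orientation is that of the charts; \<open>J\<close> induces it iff \<open>\<omega> \<and> \<omega>\<close> is positive, where
  \<open>\<omega> = g (J \<cdot>, \<cdot>)\<close>.
\<close>

definition kaehler_surface :: "('i, 'p::topological_space, 4) atlas \<Rightarrow>
    ('i, 4, real^4^4) field \<Rightarrow> ('i, 4, real^4^4) field \<Rightarrow> bool" where
  "kaehler_surface M g J \<longleftrightarrow> oriented_atlas M \<and> kaehler M g J \<and>
     everywhere M (\<lambda>i x. wedge4 (twist (g i x) (J i x)) (twist (g i x) (J i x)) > 0)"

definition calabi_opposite :: "('i, 'p, 4) atlas \<Rightarrow> ('i, 4, real^4^4) field \<Rightarrow>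
    ('i, 4, real^4^4) field \<Rightarrow> ('i, 4, real^4) field \<Rightarrow> ('i, 4, real^4^4) field \<Rightarrow> bool" where
  "calabi_opposite M g J K I \<longleftrightarrow> everywhere M (\<lambda>i x.
     (\<forall>v\<in>span {K i x, J i x *v K i x}. I i x *v v = J i x *v v) \<and>
     (\<forall>v. (\<forall>u\<in>span {K i x, J i x *v K i x}. v \<bullet> (g i x *v u) = 0) \<longrightarrow>
        I i x *v v = - (J i x *v v)))"

definition conformal_metric ::
    "('i, 4, real^4^4) field \<Rightarrow> ('i, 4, real) field \<Rightarrow> ('i, 4, real^4^4) field" where
  "conformal_metric g lam i x = (1 / (lam i x)\<^sup>2) *\<^sub>R g i x"

definition calabi_type :: "('i, 'p::topological_space, 4) atlas \<Rightarrow>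
    ('i, 4, real^4^4) field \<Rightarrow> ('i, 4, real^4^4) field \<Rightarrow> ('i, 4, real^4) field \<Rightarrow>
    ('i, 4, real^4^4) field \<Rightarrow> ('i, 4, real) field \<Rightarrow> bool" where
  "calabi_type M g J K I lam \<longleftrightarrow> kaehler_surface M g J \<and>
     vector_field M K \<and> everywhere M (\<lambda>i x. K i x \<noteq> 0) \<and> killing M g K \<and>
     (\<exists>f. smooth_function M f \<and> momentum_map M g J f K) \<and>
     calabi_opposite M g J K I \<and>
     smooth_function M lam \<and> everywhere M (\<lambda>i x. lam i x > 0) \<and>
     kaehler M (conformal_metric g lam) I"

definition conformal_scalar_curvature ::
    "('i, 4, real^4^4) field \<Rightarrow> ('i, 4, real) field \<Rightarrow> ('i, 4, real) field" where
  "conformal_scalar_curvature g lam i x = norm_scal (conformal_metric g lam i) x / (lam i x)\<^sup>2"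

definition ricci_form ::
    "('i, 4, real^4^4) field \<Rightarrow> ('i, 4, real^4^4) field \<Rightarrow> ('i, 4, real^4^4) field" where
  "ricci_form g J i x = twist (ricci (g i) x) (J i x)"

text \<open>The pfaffian \<open>p\<close> of \<open>\<rho>' = h (J \<cdot>, \<cdot>)\<close>, solved from \<open>\<rho>' \<and> \<rho>' = (p / 4) \<omega> \<and> \<omega>\<close>.\<close>

definition pfaffian ::
    "('i, 4, real^4^4) field \<Rightarrow> ('i, 4, real^4^4) field \<Rightarrow> ('i, 4, real) field" where
  "pfaffian g J i x =
     (let r = twist (norm_ricci (g i) x) (J i x); w = twist (g i x) (J i x)
      in 4 * wedge4 r r / wedge4 w w)"

definition holomorphic_potential :: "('i, 'p, 4) atlas \<Rightarrow> ('i, 4, real^4^4) field \<Rightarrow>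
    ('i, 4, real^4^4) field \<Rightarrow> ('i, 4, real) field \<Rightarrow> bool" where
  "holomorphic_potential M g J f \<longleftrightarrow> killing M g (\<lambda>i x. J i x *v gradient (g i) (f i) x)"

definition extremal :: "('i, 'p, 4) atlas \<Rightarrow> ('i, 4, real^4^4) field \<Rightarrow>
    ('i, 4, real^4^4) field \<Rightarrow> bool" where
  "extremal M g J \<longleftrightarrow> holomorphic_potential M g J (\<lambda>i. norm_scal (g i))"

definition bi_extremal :: "('i, 'p, 4) atlas \<Rightarrow> ('i, 4, real^4^4) field \<Rightarrow>
    ('i, 4, real^4^4) field \<Rightarrow> bool" where
  "bi_extremal M g J \<longleftrightarrow> extremal M g J \<and> holomorphic_potential M g J (pfaffian g J)"

definition constant_scalar_curvature :: "('i, 'p, 4) atlas \<Rightarrow> ('i, 4, real^4^4) field \<Rightarrow> bool" where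
  "constant_scalar_curvature M g \<longleftrightarrow> (\<exists>c. everywhere M (\<lambda>i x. scal (g i) x = c))"

definition scalar_flat :: "('i, 'p, 4) atlas \<Rightarrow> ('i, 4, real^4^4) field \<Rightarrow> bool" where
  "scalar_flat M g \<longleftrightarrow> everywhere M (\<lambda>i x. scal (g i) x = 0)"

definition selfdual :: "('i, 'p, 4) atlas \<Rightarrow> ('i, 4, real^4^4) field \<Rightarrow> bool" where
  "selfdual M g \<longleftrightarrow> everywhere M (\<lambda>i x. \<forall>a b c d. weyl_minus (g i) x a b c d = 0)"

definition anti_selfdual :: "('i, 'p, 4) atlas \<Rightarrow> ('i, 4, real^4^4) field \<Rightarrow> bool" where
  "anti_selfdual M g \<longleftrightarrow> everywhere M (\<lambda>i x. \<forall>a b c d. weyl_plus (g i) x a b c d = 0)"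

definition weakly_selfdual :: "('i, 'p, 4) atlas \<Rightarrow> ('i, 4, real^4^4) field \<Rightarrow> bool" where
  "weakly_selfdual M g \<longleftrightarrow> everywhere M (\<lambda>i x. \<forall>b c d. div_weyl_minus (g i) x b c d = 0)"

definition kaehler_einstein :: "('i, 'p::topological_space, 4) atlas \<Rightarrow>
    ('i, 4, real^4^4) field \<Rightarrow> ('i, 4, real^4^4) field \<Rightarrow> bool" where
  "kaehler_einstein M g J \<longleftrightarrow> kaehler_surface M g J \<and>
     (\<exists>c. everywhere M (\<lambda>i x. ricci (g i) x = c *\<^sub>R g i x))"

definition bach_flat :: "('i, 'p, 4) atlas \<Rightarrow> ('i, 4, real^4^4) field \<Rightarrow> bool" where
  "bach_flat M g \<longleftrightarrow> everywhere M (\<lambda>i x. \<forall>b c. bach (g i) x b c = 0)"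


section \<open>The Calabi construction\<close>

text \<open>
  The total space is an open subset \<open>W\<close> of \<open>\<Sigma> \<times> \<real> \<times> \<real>\<close>, with points \<open>(p, z, t)\<close>; a chart of \<open>\<Sigma>\<close>
  with coordinates \<open>(x, y)\<close> induces the chart \<open>(x, y, z, t)\<close> of \<open>W\<close>. Hence \<open>z\<close> and \<open>t\<close> are the third
  and fourth coordinates in every chart, and both atlases have the same index set.
\<close>

definition calabi_manifold ::
    "('i, 's, 2) atlas \<Rightarrow> ('s \<times> real \<times> real) set \<Rightarrow> ('i, 's \<times> real \<times> real, 4) atlas" where
  "calabi_manifold S W = \<lparr> idx = idx S, cdom = (\<lambda>i. {(p, z, t). p \<in> cdom S i \<and> (p, z, t) \<in> W}),
     crd = (\<lambda>i (p, z, t). vector [crd S i p $ 1, crd S i p $ 2, z, t]) \<rparr>"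

definition base :: "real^4 \<Rightarrow> real^2" where
  "base x = vector [x $ 1, x $ 2]"

text \<open>
  Pullbacks along the projection to \<open>\<Sigma>\<close>, whose differential has the constant matrix
  \<open>matrix base\<close>.
\<close>

definition pull1 :: "real^2 \<Rightarrow> real^4" where
  "pull1 a = transpose (matrix base) *v a"

definition pull2 :: "real^2^2 \<Rightarrow> real^4^4" where
  "pull2 b = transpose (matrix base) ** b ** matrix base"

definition connection_form :: "('i, 2, real^2) field \<Rightarrow> ('i, 4, real^4) field" where
  "connection_form al i x = axis 4 1 + pull1 (al i (base x))"

definition calabi_metric :: "('i, 2, real^2^2) field \<Rightarrow> ('i, 2, real^2) field \<Rightarrow> (real \<Rightarrow> real) \<Rightarrow>
    ('i, 4, real^4^4) field" where
  "calabi_metric gS al V i x =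
     (let z = x $ 3; dz = axis 3 1; \<theta> = connection_form al i x in
        z *\<^sub>R pull2 (gS i (base x)) + (z / V z) *\<^sub>R outer dz dz + (V z / z) *\<^sub>R outer \<theta> \<theta>)"

definition calabi_form :: "('i, 2, real^2^2) field \<Rightarrow> ('i, 2, real^2) field \<Rightarrow>
    ('i, 4, real^4^4) field" where
  "calabi_form gS al i x =
     (let z = x $ 3; dz = axis 3 1; \<theta> = connection_form al i x in
        z *\<^sub>R pull2 (area_form (gS i (base x))) + wedge dz \<theta>)"

text \<open>
  For \<open>g = calabi_metric gS al V\<close> and \<open>d al\<close> the area form of \<open>gS\<close>, the requirements
  \<open>kaehler_surface\<close> and \<open>calabi_type\<close> below are automatic, with \<open>J\<close> determined by
  \<open>g (J \<cdot>, \<cdot>) = calabi_form gS al\<close>, with \<open>K\<close> having momentum map \<open>z\<close>, and with conformal factor \<open>z\<close>.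
\<close>

definition calabi_surface :: "('i, 's::{t2_space, second_countable_topology}, 2) atlas \<Rightarrow>
    ('i, 2, real^2^2) field \<Rightarrow> ('i, 2, real^2) field \<Rightarrow> (real \<Rightarrow> real) \<Rightarrow>
    ('s \<times> real \<times> real) set \<Rightarrow> ('i, 4, real^4^4) field \<Rightarrow> ('i, 4, real^4^4) field \<Rightarrow>
    ('i, 4, real^4) field \<Rightarrow> ('i, 4, real^4^4) field \<Rightarrow> bool" where
  "calabi_surface S gS al V W g J K I \<longleftrightarrow>
     oriented_atlas S \<and> riemannian_metric S gS \<and> one_form S al \<and>
     everywhere S (\<lambda>i x. ext_d (al i) x = area_form (gS i x)) \<and>
     open W \<and> connected W \<and> W \<noteq> {} \<and> fst ` W = points S \<and>
     (\<forall>(p, z, t)\<in>W. z > 0 \<and> V z > 0 \<and> (\<forall>n. ((deriv ^^ n) V) differentiable (at z))) \<and>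
     g = calabi_metric gS al V \<and>
     K = (\<lambda>i x. axis 4 1) \<and>
     everywhere (calabi_manifold S W) (\<lambda>i x. twist (g i x) (J i x) = calabi_form gS al i x) \<and>
     calabi_type (calabi_manifold S W) g J K I (\<lambda>i x. x $ 3)"

definition constant_gauss_curvature ::
    "('i, 's, 2) atlas \<Rightarrow> ('i, 2, real^2^2) field \<Rightarrow> real \<Rightarrow> bool" where
  "constant_gauss_curvature S gS k \<longleftrightarrow> everywhere S (\<lambda>i x. gauss_curvature (gS i) x = k)"

definition calabi_quartic :: "(real \<Rightarrow> real) \<Rightarrow> ('s \<times> real \<times> real) set \<Rightarrow>
    real \<Rightarrow> real \<Rightarrow> real \<Rightarrow> real \<Rightarrow> real \<Rightarrow> bool" where
  "calabi_quartic V W k A1 A2 A3 A4 \<longleftrightarrow>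
     (\<forall>(p, z, t)\<in>W. V z = A1 * z^4 + A2 * z^3 + k * z^2 + A3 * z + A4)"

end

theory Submission
  imports Defs
begin

text \<open>
  All quantities in question can be computed in one orthonormal coframe. Let \<open>u, v\<close> be an orthonormal
  coframe of the surface and put \<open>e\<^sub>1 = r u\<close>, \<open>e\<^sub>2 = r v\<close>, \<open>e\<^sub>3 = dz / n\<close> and \<open>e\<^sub>4 = l (dt + \<alpha>)\<close> with
  functions \<open>r, n, l\<close> of \<open>z\<close>. Since \<open>d \<alpha> = u \<and> v\<close>, the exterior derivatives of the coframe are
  expressed by the coframe and the connection form of the surface, and Cartan's structure equations (\<open>christoffel_coframe\<close>, \<open>riem_coframe\<close>)
  yield a curvature tensor of a fixed algebraic shape with five scalar coefficients
  (\<open>curvature_forms\<close>). The given metric has \<open>r = sqrt z\<close> and \<open>n = l = m\<close> with \<open>m\<^sup>2 = V z / z\<close>; the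
  metric divided by \<open>z\<^sup>2\<close> is another instance, which gives the conformal scalar curvature.

  The scalar curvature turns out to be \<open>(2 k - V'') / z\<close> with \<open>k\<close> the Gauss curvature
  (\<open>scal_kaehler\<close>). It is a momentum map for a multiple of the Killing field iff its differential is
  a constant multiple of \<open>dz\<close>. This is an equation between a function on the surface and a function of \<open>z\<close>,
  so both are constant; integrating it three times yields constancy of \<open>k\<close> and the quartic
  (\<open>momentum_map_imp_quartic\<close>).

  For a quartic \<open>V\<close>, the planes spanned by \<open>e\<^sub>1, e\<^sub>2\<close> and by \<open>e\<^sub>3, e\<^sub>4\<close> are eigenspaces of the
  normalized Ricci tensor with eigenvalues \<open>p\<close> and \<open>q\<close>, and each half of the Weyl tensor is a scalar
  multiple of a fixed tensor: \<open>W\<^sup>+ = s T\<^sup>+\<close> and \<open>W\<^sup>- = w T\<^sup>-\<close> with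
  \<open>s = - A1 z - A2 / 2\<close> and \<open>w = - A3 / (2 z\<^sup>2) - A4 / z\<^sup>3\<close> (\<open>calabi_weyl\<close>, \<open>W_eq\<close>). The difference
  \<open>\<mu> = q - p\<close> is the coefficient in the Ricci form. Tensors whose frame components depend on \<open>z\<close>
  alone are differentiated covariantly by finite algebra (\<open>nabla2_momentum\<close>). The
  divergence of \<open>W\<^sup>-\<close> becomes a multiple of the derivative of \<open>z\<^sup>3 w\<close>, that is of \<open>A3\<close>
  (\<open>div_weyl_minus_quartic\<close>), and the Bach tensor becomes \<open>4 A1 A4 - A2 A3\<close> times a tensor without
  zeros (\<open>bach_quartic\<close>).

  Finally, a function of \<open>z\<close> is a holomorphic potential iff it is affine
  (\<open>holomorphic_potential_iff\<close>). The scalar curvature \<open>12 s\<close> is affine, so the metric is extremal; the pfaffian is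
  \<open>4 p q\<close>, whose second derivative vanishes iff \<open>A3 = 0\<close>. Each remaining equivalence says when
  an explicit function of \<open>z\<close> vanishes on an interval, which two of its points decide
  (\<open>affine_zero\<close>).
\<close>

section \<open>Partial derivatives of scalar functions\<close>

lemma pd_eq: "(f has_derivative f') (at x) \<Longrightarrow> pd i f x = f' (axis i 1)"
  unfolding pd_def using frechet_derivative_at by metis

text \<open>A differential is linear, hence determined by its values on the coordinate axes.\<close>

lemma has_derivative_pd:
  fixes f :: "real^'n::finite \<Rightarrow> real"
  assumes "f differentiable (at x)"
  shows "(f has_derivative (\<lambda>h. \<Sum>i\<in>UNIV. h$i * pd i f x)) (at x)"
proof -
  let ?f' = "frechet_derivative f (at x)"
  have d: "(f has_derivative ?f') (at x)"
    using assms frechet_derivative_works by blast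
  have lin: "linear ?f'" using d has_derivative_linear by blast
  have "?f' h = (\<Sum>i\<in>UNIV. h$i * pd i f x)" for h
  proof -
    have "?f' h = ?f' (\<Sum>i\<in>UNIV. h$i *\<^sub>R axis i 1)"
      by (simp add: basis_expansion flip: scalar_mult_eq_scaleR)
    also have "\<dots> = (\<Sum>i\<in>UNIV. h$i * pd i f x)"
      by (simp add: linear_sum[OF lin] linear_cmul[OF lin] pd_def)
    finally show ?thesis .
  qed
  then show ?thesis using d by (metis (no_types, lifting) ext)
qed

lemma differentiable_cong_open:
  assumes "open S" "x \<in> S" "\<And>y. y \<in> S \<Longrightarrow> f y = g y" "f differentiable (at x)"
  shows "g differentiable (at x)"
  using assms has_derivative_transform_within_open unfolding differentiable_def by blast

lemma pd_cong:
  assumes "open S" "x \<in> S" "\<And>y. y \<in> S \<Longrightarrow> f y = g y"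
  shows "pd i f x = pd i g x"
proof -
  have "(f has_derivative D) (at x) \<longleftrightarrow> (g has_derivative D) (at x)" for D
    using assms has_derivative_transform_within_open[of f D x UNIV S g]
      has_derivative_transform_within_open[of g D x UNIV S f] by auto
  then show ?thesis by (simp add: pd_def frechet_derivative_def)
qed

lemma pd_const [simp]: "pd i (\<lambda>y. c) x = 0"
  by (subst pd_eq[OF has_derivative_const]) simp

lemma pd_coordinate [simp]: "pd i (\<lambda>y. y $ a) x = (if i = a then 1 else 0)"
  by (subst pd_eq[OF bounded_linear.has_derivative[OF bounded_linear_vec_nth has_derivative_ident]])
     (auto simp: axis_def)

lemma pd_component:
  assumes "f differentiable (at x)"
  shows "pd i (\<lambda>y. f y $ a) x = pd i f x $ a"
  using bounded_linear.has_derivative[OF bounded_linear_vec_nth assms[unfolded frechet_derivative_works], of a]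
  by (subst pd_eq) (auto simp: pd_def)

lemma differentiable_component:
  "f differentiable (at x) \<Longrightarrow> (\<lambda>y. f y $ a) differentiable (at x)"
  using bounded_linear.has_derivative[OF bounded_linear_vec_nth]
  unfolding differentiable_def by blast

context
  fixes f g :: "real^'n::finite \<Rightarrow> real" and x
  assumes f: "f differentiable (at x)" and g: "g differentiable (at x)"
begin

private lemma f': "(f has_derivative frechet_derivative f (at x)) (at x)"
  and g': "(g has_derivative frechet_derivative g (at x)) (at x)"
  using f g frechet_derivative_works by auto

lemma pd_add: "pd i (\<lambda>y. f y + g y) x = pd i f x + pd i g x"
  by (subst pd_eq[OF has_derivative_add[OF f' g']]) (simp add: pd_def)

lemma pd_diff: "pd i (\<lambda>y. f y - g y) x = pd i f x - pd i g x"
  by (subst pd_eq[OF has_derivative_diff[OF f' g']]) (simp add: pd_def)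

lemma pd_mult: "pd i (\<lambda>y. f y * g y) x = pd i f x * g x + f x * pd i g x"
  by (subst pd_eq[OF has_derivative_mult[OF f' g']]) (simp add: pd_def)

end

lemma pd_minus:
  fixes f :: "real^'n::finite \<Rightarrow> real"
  assumes "f differentiable (at x)"
  shows "pd i (\<lambda>y. - f y) x = - pd i f x"
  by (subst pd_eq[OF has_derivative_minus[OF assms[unfolded frechet_derivative_works]]]) (simp add: pd_def)

lemma pd_sum:
  fixes f :: "'b \<Rightarrow> real^'n::finite \<Rightarrow> real"
  assumes "finite A" "\<And>b. b \<in> A \<Longrightarrow> f b differentiable (at x)"
  shows "pd i (\<lambda>y. \<Sum>b\<in>A. f b y) x = (\<Sum>b\<in>A. pd i (f b) x)"
  using assms
proof (induction A rule: finite_induct)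
  case (insert b A)
  then have "(\<lambda>y. \<Sum>b\<in>A. f b y) differentiable (at x)" by simp
  with insert show ?case by (simp add: pd_add)
qed simp

lemma pd_chain:
  fixes f :: "real^'n::finite \<Rightarrow> real"
  assumes "(h has_real_derivative h') (at (f x))" "f differentiable (at x)"
  shows "pd i (\<lambda>y. h (f y)) x = h' * pd i f x"
  using has_derivative_compose[OF assms(2)[unfolded frechet_derivative_works], of h "(*) h'"]
    assms(1)[unfolded has_field_derivative_def]
  by (subst pd_eq) (auto simp: pd_def)

lemma differentiable_chain:
  fixes f :: "real^'n::finite \<Rightarrow> real"
  assumes "(h has_real_derivative h') (at (f x))" "f differentiable (at x)"
  shows "(\<lambda>y. h (f y)) differentiable (at x)"
  using assms has_derivative_compose unfolding has_field_derivative_def differentiable_def by blast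

text \<open>Young's form of the symmetry of second derivatives: the second difference along the two axes,
  divided by the square of the step, tends to either mixed derivative.\<close>

lemma second_difference_limit:
  fixes f :: "real^'n::finite \<Rightarrow> real"
  assumes S: "open S" "x \<in> S" and f: "\<And>y. y \<in> S \<Longrightarrow> f differentiable (at y)"
    and f': "pd i f differentiable (at x)"
  shows "((\<lambda>h. (f (x + h *\<^sub>R axis i 1 + h *\<^sub>R axis j 1) - f (x + h *\<^sub>R axis i 1)
     - f (x + h *\<^sub>R axis j 1) + f x) / h\<^sup>2) \<longlongrightarrow> pd j (pd i f) x) (at_right 0)"
proof -
  define p where "p = pd i f"
  define L where "L = frechet_derivative p (at x)"
  have p: "(p has_derivative L) (at x)"
    using f' frechet_derivative_works unfolding p_def L_def by blast
  have linL: "linear L" using p has_derivative_linear by blast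
  obtain r where r: "r > 0" "ball x r \<subseteq> S" using S open_contains_ball by blast
  define ei where "ei = (axis i 1 :: real^'n)"
  define ej where "ej = (axis j 1 :: real^'n)"
  have nei: "norm ei = 1" "norm ej = 1" unfolding ei_def ej_def by (auto simp: norm_axis_1)
  have Lj: "L ej = pd j (pd i f) x" unfolding L_def ej_def pd_def p_def by simp
  show ?thesis unfolding tendsto_iff
  proof (intro allI impI)
    fix e :: real assume e: "e > 0"
    from p[unfolded has_derivative_at_alt] e
    obtain d where d: "d > 0" "\<And>y. norm (y - x) < d \<Longrightarrow> norm (p y - p x - L (y - x)) \<le> (e/8) * norm (y - x)"
      by (metis zero_less_divide_iff zero_less_numeral)
    let ?q = "\<lambda>h. (f (x + h *\<^sub>R ei + h *\<^sub>R ej) - f (x + h *\<^sub>R ei) - f (x + h *\<^sub>R ej) + f x) / h\<^sup>2"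
    have main: "dist (?q h) (L ej) < e" if h: "0 < h" "h < min (r/2) (d/2)" for h
    proof -
      define u where "u s = f (x + s *\<^sub>R ei + h *\<^sub>R ej) - f (x + s *\<^sub>R ei)" for s
      have small: "norm (s *\<^sub>R ei + h *\<^sub>R ej) \<le> 2 * h" "norm (s *\<^sub>R ei) \<le> h" if "0 \<le> s" "s \<le> h" for s
        using that h norm_triangle_ineq[of "s *\<^sub>R ei" "h *\<^sub>R ej"] by (auto simp: nei)
      have inS: "x + s *\<^sub>R ei + h *\<^sub>R ej \<in> S" "x + s *\<^sub>R ei \<in> S" if "0 \<le> s" "s \<le> h" for s
      proof -
        have "x + s *\<^sub>R ei + h *\<^sub>R ej \<in> ball x r" "x + s *\<^sub>R ei \<in> ball x r"
          using small[OF that] h by (auto simp: dist_norm norm_minus_commute algebra_simps add.assoc)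
        then show "x + s *\<^sub>R ei + h *\<^sub>R ej \<in> S" "x + s *\<^sub>R ei \<in> S" using r by auto
      qed
      have du: "(u has_real_derivative (p (x + s *\<^sub>R ei + h *\<^sub>R ej) - p (x + s *\<^sub>R ei))) (at s)"
        if s: "0 \<le> s" "s \<le> h" for s
      proof -
        have 1: "((\<lambda>t. f (x + t *\<^sub>R ei + w)) has_real_derivative p (x + s *\<^sub>R ei + w)) (at s)"
          if "x + s *\<^sub>R ei + w \<in> S" for w
        proof -
          have g: "(f has_derivative frechet_derivative f (at (x + s *\<^sub>R ei + w))) (at (x + s *\<^sub>R ei + w))"
            using f[OF that] frechet_derivative_works by blast
          have "((\<lambda>t. x + t *\<^sub>R ei + w) has_derivative (\<lambda>t. t *\<^sub>R ei)) (at s)"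
            by (auto intro!: derivative_eq_intros)
          from has_derivative_compose[OF this g]
          have "((\<lambda>t. f (x + t *\<^sub>R ei + w)) has_derivative
             (\<lambda>t. frechet_derivative f (at (x + s *\<^sub>R ei + w)) (t *\<^sub>R ei))) (at s)" .
          moreover have "(\<lambda>t. frechet_derivative f (at (x + s *\<^sub>R ei + w)) (t *\<^sub>R ei)) = (*) (p (x + s *\<^sub>R ei + w))"
            using linear_cmul[OF has_derivative_linear[OF g]] by (auto simp: p_def pd_def ei_def)
          ultimately show ?thesis unfolding has_field_derivative_def by simp
        qed
        show ?thesis unfolding u_def
          using DERIV_diff[OF 1[of "h *\<^sub>R ej"] 1[of 0]] inS[OF s] by simp
      qed
      obtain s where s: "0 < s" "s < h" "u h - u 0 = h * (p (x + s *\<^sub>R ei + h *\<^sub>R ej) - p (x + s *\<^sub>R ei))"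
        using MVT2[of 0 h u "\<lambda>s. p (x + s *\<^sub>R ei + h *\<^sub>R ej) - p (x + s *\<^sub>R ei)"] h du by auto
      have "f (x + h *\<^sub>R ei + h *\<^sub>R ej) - f (x + h *\<^sub>R ei) - f (x + h *\<^sub>R ej) + f x =
         h * (p (x + s *\<^sub>R ei + h *\<^sub>R ej) - p (x + s *\<^sub>R ei))"
        using s(3) by (simp add: u_def)
      then have q: "?q h = (p (x + s *\<^sub>R ei + h *\<^sub>R ej) - p (x + s *\<^sub>R ei)) / h"
        using h by (simp add: power2_eq_square)
      have b1: "norm (p (x + s *\<^sub>R ei + h *\<^sub>R ej) - p x - L (s *\<^sub>R ei + h *\<^sub>R ej)) \<le> (e/8) * (2*h)"
      proof -
        have "norm (s *\<^sub>R ei + h *\<^sub>R ej) < d" using small(1)[of s] s h by auto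
        with d(2)[of "x + s *\<^sub>R ei + h *\<^sub>R ej"]
        have "norm (p (x + s *\<^sub>R ei + h *\<^sub>R ej) - p x - L (s *\<^sub>R ei + h *\<^sub>R ej)) \<le> (e/8) * norm (s *\<^sub>R ei + h *\<^sub>R ej)"
          by (simp add: add.assoc)
        also have "\<dots> \<le> (e/8) * (2*h)" using small(1)[of s] s e by (intro mult_left_mono) auto
        finally show ?thesis .
      qed
      have b2: "norm (p (x + s *\<^sub>R ei) - p x - L (s *\<^sub>R ei)) \<le> (e/8) * h"
      proof -
        have "norm (s *\<^sub>R ei) < d" using small(2)[of s] s h by auto
        with d(2)[of "x + s *\<^sub>R ei"]
        have "norm (p (x + s *\<^sub>R ei) - p x - L (s *\<^sub>R ei)) \<le> (e/8) * norm (s *\<^sub>R ei)" by simp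
        also have "\<dots> \<le> (e/8) * h" using small(2)[of s] s e by (intro mult_left_mono) auto
        finally show ?thesis .
      qed
      have "\<bar>p (x + s *\<^sub>R ei + h *\<^sub>R ej) - p (x + s *\<^sub>R ei) - h * L ej\<bar> \<le> (e/8) * (3*h)"
      proof -
        have "p (x + s *\<^sub>R ei + h *\<^sub>R ej) - p (x + s *\<^sub>R ei) - h * L ej =
          (p (x + s *\<^sub>R ei + h *\<^sub>R ej) - p x - L (s *\<^sub>R ei + h *\<^sub>R ej))
          - (p (x + s *\<^sub>R ei) - p x - L (s *\<^sub>R ei))"
          by (simp add: linear_add[OF linL] linear_cmul[OF linL])
        then show ?thesis using b1 b2 unfolding real_norm_def by linarith
      qed
      also have "\<dots> < e * h" using e h by simp
      finally have "\<bar>?q h - L ej\<bar> * h < e * h"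
        unfolding q using h by (simp add: abs_mult_pos' field_simps abs_if split: if_splits)
      then show ?thesis using h by (simp add: dist_real_def)
    qed
    show "\<forall>\<^sub>F h in at_right 0. dist ((f (x + h *\<^sub>R axis i 1 + h *\<^sub>R axis j 1) - f (x + h *\<^sub>R axis i 1)
     - f (x + h *\<^sub>R axis j 1) + f x) / h\<^sup>2) (pd j (pd i f) x) < e"
      unfolding eventually_at_right_field
      using main r d Lj by (intro exI[of _ "min (r/2) (d/2)"]) (auto simp: ei_def ej_def)
  qed
qed

text \<open>The second difference is symmetric in the two axes, so both mixed derivatives are its limit.\<close>

lemma pd_commute:
  fixes f :: "real^'n::finite \<Rightarrow> real"
  assumes "open S" "x \<in> S" "\<And>y. y \<in> S \<Longrightarrow> f differentiable (at y)"
    and "\<And>i. pd i f differentiable (at x)"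
  shows "pd i (pd j f) x = pd j (pd i f) x"
proof (rule tendsto_unique[OF _ second_difference_limit[OF assms(1-3), where i=j and j=i]])
  show "((\<lambda>h. (f (x + h *\<^sub>R axis j 1 + h *\<^sub>R axis i 1) - f (x + h *\<^sub>R axis j 1)
     - f (x + h *\<^sub>R axis i 1) + f x) / h\<^sup>2) \<longlongrightarrow> pd j (pd i f) x) (at_right 0)"
    using second_difference_limit[OF assms(1-3), where i=i and j=j] assms(4)
    by (simp add: algebra_simps)
qed (use assms(4) in auto)

section \<open>Smooth scalar functions\<close>

text \<open>Smoothness quantifies over all words of partial derivatives. Truncating the length of the words
  gives a condition that can be proved by induction, one derivative being traded for one level.\<close>

definition diffs :: "nat \<Rightarrow> (real^'n::finite) set \<Rightarrow> (real^'n \<Rightarrow> real) \<Rightarrow> bool" where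
  "diffs n S f \<longleftrightarrow> (\<forall>is. length is \<le> n \<longrightarrow> (\<forall>x\<in>S. foldr pd is f differentiable (at x)))"

lemma smooth_on_iff_diffs: "smooth_on S f \<longleftrightarrow> (\<forall>n. diffs n S f)"
  unfolding smooth_on_def diffs_def by auto

lemma diffs_0: "diffs 0 S f \<longleftrightarrow> (\<forall>x\<in>S. f differentiable (at x))"
  by (auto simp: diffs_def)

lemma diffs_Suc:
  fixes f :: "real^'n::finite \<Rightarrow> real"
  shows "diffs (Suc n) S f \<longleftrightarrow> (\<forall>x\<in>S. f differentiable (at x)) \<and> (\<forall>i. diffs n S (pd i f))"
proof safe
  fix i assume "diffs (Suc n) S f"
  then have "foldr pd (is @ [i]) f differentiable (at x)" if "length is \<le> n" "x \<in> S" for "is" x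
    using that unfolding diffs_def by (metis Suc_le_mono length_append_singleton)
  then show "diffs n S (pd i f)" unfolding diffs_def by auto
next
  assume f: "\<forall>x\<in>S. f differentiable (at x)" and pf: "\<forall>i. diffs n S (pd i f)"
  show "diffs (Suc n) S f" unfolding diffs_def
  proof (intro allI impI ballI)
    fix "is" :: "'n list" and x assume l: "length is \<le> Suc n" and x: "x \<in> S"
    show "foldr pd is f differentiable (at x)"
    proof (cases "is" rule: rev_cases)
      case Nil then show ?thesis using f x by simp
    next
      case (snoc js i)
      with l have "length js \<le> n" by simp
      then have "foldr pd js (pd i f) differentiable (at x)"
        using pf x unfolding diffs_def by blast
      then show ?thesis using snoc by simp
    qed
  qed
qed (auto simp: diffs_def dest!: spec[of _ "[]"])

lemma diffs_le: "diffs n S f \<Longrightarrow> m \<le> n \<Longrightarrow> diffs m S f"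
  unfolding diffs_def by auto

lemma diffs_differentiable: "diffs n S f \<Longrightarrow> x \<in> S \<Longrightarrow> f differentiable (at x)"
  unfolding diffs_def by (auto dest!: spec[of _ "[]"])

lemma diffs_cong:
  assumes "open S" "\<And>x. x \<in> S \<Longrightarrow> f x = g x" "diffs n S f"
  shows "diffs n S g"
  using assms(2,3)
proof (induction n arbitrary: f g)
  case 0 then show ?case using assms(1) differentiable_cong_open unfolding diffs_0 by blast
next
  case (Suc n)
  have "pd i f x = pd i g x" if "x \<in> S" for i x using pd_cong[OF assms(1) that Suc.prems(1)] by auto
  then show ?case using Suc differentiable_cong_open[OF assms(1)] unfolding diffs_Suc by metis
qed

lemma diffs_const: "diffs n S (\<lambda>x. c)"
proof (induction n arbitrary: c)
  case (Suc n)
  have "pd i (\<lambda>x. c) = (\<lambda>x. 0 :: real)" for i :: 'a by (rule ext) simp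
  with Suc show ?case unfolding diffs_Suc by simp
qed (simp add: diffs_0)

context
  fixes S :: "(real^'n::finite) set"
  assumes S: "open S"
begin

lemma diffs_add: "diffs n S f \<Longrightarrow> diffs n S g \<Longrightarrow> diffs n S (\<lambda>x. f x + g x)"
proof (induction n arbitrary: f g)
  case (Suc n)
  have "diffs n S (pd i (\<lambda>x. f x + g x))" for i
    by (rule diffs_cong[OF S _ Suc.IH[of "pd i f" "pd i g"]])
      (use Suc.prems in \<open>auto simp: diffs_Suc pd_add\<close>)
  then show ?case using Suc.prems unfolding diffs_Suc by auto
qed (simp add: diffs_0)

lemma diffs_mult: "diffs n S f \<Longrightarrow> diffs n S g \<Longrightarrow> diffs n S (\<lambda>x. f x * g x)"
proof (induction n arbitrary: f g)
  case (Suc n)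
  have "diffs n S f" "diffs n S g" using Suc.prems diffs_le le_Suc_eq by blast+
  then have "diffs n S (\<lambda>x. pd i f x * g x + f x * pd i g x)" for i
    using Suc.prems by (intro diffs_add Suc.IH) (auto simp: diffs_Suc)
  then have "diffs n S (pd i (\<lambda>x. f x * g x))" for i
    by (rule diffs_cong[OF S, rotated]) (use Suc.prems in \<open>auto simp: diffs_Suc pd_mult\<close>)
  then show ?case using Suc.prems unfolding diffs_Suc by auto
qed (simp add: diffs_0)

text \<open>The derivative of \<open>1 / sqrt f\<close> is a polynomial in \<open>1 / sqrt f\<close> and \<open>pd i f\<close>, so
  the induction closes on this function. Quotients and square roots of positive functions are
  products of \<open>1 / sqrt f\<close> with smooth functions, which is why they need no induction of their own.\<close>

lemma diffs_rsqrt: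
  assumes "\<And>x. x \<in> S \<Longrightarrow> f x > 0"
  shows "diffs n S f \<Longrightarrow> diffs n S (\<lambda>x. 1 / sqrt (f x))"
proof (induction n)
  have d: "((\<lambda>t. 1 / sqrt t) has_real_derivative (- (1/2) * (1 / sqrt t) ^ 3)) (at t)" if "t > 0" for t
    using that by (auto intro!: derivative_eq_intros simp: power3_eq_cube field_simps)
  {
    case 0
    then show ?case using differentiable_chain[OF d] assms unfolding diffs_0 by blast
  next
    case (Suc n)
    have "diffs n S f" using Suc.prems diffs_le le_Suc_eq by blast
    note w = Suc.IH[OF this]
    have "diffs n S (pd i (\<lambda>x. 1 / sqrt (f x)))" for i
    proof (rule diffs_cong[OF S])
      show "diffs n S (\<lambda>x. ((- (1/2)) * ((1 / sqrt (f x)) * ((1 / sqrt (f x)) * (1 / sqrt (f x))))) * pd i f x)"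
        using Suc.prems w by (intro diffs_mult diffs_const) (auto simp: diffs_Suc)
      fix x assume x: "x \<in> S"
      have "f differentiable (at x)" using Suc.prems x diffs_differentiable by blast
      from pd_chain[OF d[OF assms[OF x]] this]
      show "(- (1/2)) * ((1 / sqrt (f x)) * ((1 / sqrt (f x)) * (1 / sqrt (f x)))) * pd i f x =
         pd i (\<lambda>x. 1 / sqrt (f x)) x" by (simp add: power3_eq_cube)
    qed
    then show ?case using Suc.prems differentiable_chain[OF d] assms unfolding diffs_Suc by blast
  }
qed

lemma smooth_const: "smooth_on S (\<lambda>x. c :: real)"
  by (simp add: smooth_on_iff_diffs diffs_const)

lemma smooth_add: "smooth_on S f \<Longrightarrow> smooth_on S g \<Longrightarrow> smooth_on S (\<lambda>x. f x + g x :: real)"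
  by (simp add: smooth_on_iff_diffs diffs_add)

lemma smooth_mult: "smooth_on S f \<Longrightarrow> smooth_on S g \<Longrightarrow> smooth_on S (\<lambda>x. f x * g x :: real)"
  by (simp add: smooth_on_iff_diffs diffs_mult)

lemma smooth_diff:
  assumes "smooth_on S f" "smooth_on S g" shows "smooth_on S (\<lambda>x. f x - g x :: real)"
  using smooth_add[OF assms(1) smooth_mult[OF smooth_const[of "-1"] assms(2)]] by simp

lemma smooth_cong: "smooth_on S f \<Longrightarrow> (\<And>x. x \<in> S \<Longrightarrow> f x = g x) \<Longrightarrow> smooth_on S (g :: _ \<Rightarrow> real)"
  unfolding smooth_on_iff_diffs using diffs_cong[OF S] by blast

lemma smooth_rsqrt:
  "smooth_on S f \<Longrightarrow> (\<And>x. x \<in> S \<Longrightarrow> f x > 0) \<Longrightarrow> smooth_on S (\<lambda>x. 1 / sqrt (f x))"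
  by (simp add: smooth_on_iff_diffs diffs_rsqrt)

lemma smooth_divide:
  assumes f: "smooth_on S f" and g: "smooth_on S g" "\<And>x. x \<in> S \<Longrightarrow> g x > 0"
  shows "smooth_on S (\<lambda>x. f x / g x :: real)"
proof (rule smooth_cong)
  show "smooth_on S (\<lambda>x. f x * ((1 / sqrt (g x)) * (1 / sqrt (g x))))"
    by (intro smooth_mult smooth_rsqrt assms)
  show "f x * ((1 / sqrt (g x)) * (1 / sqrt (g x))) = f x / g x" if "x \<in> S" for x
    using g(2)[OF that] by (simp add: field_simps)
qed

lemma smooth_sqrt:
  assumes g: "smooth_on S g" "\<And>x. x \<in> S \<Longrightarrow> g x > 0"
  shows "smooth_on S (\<lambda>x. sqrt (g x))"
proof (rule smooth_cong)
  show "smooth_on S (\<lambda>x. g x * (1 / sqrt (g x)))"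
    by (intro smooth_mult smooth_rsqrt assms)
  show "g x * (1 / sqrt (g x)) = sqrt (g x)" if "x \<in> S" for x
    using g(2)[OF that] by (simp add: real_div_sqrt)
qed

lemma smooth_pd: "smooth_on S f \<Longrightarrow> smooth_on S (pd i f :: _ \<Rightarrow> real)"
  unfolding smooth_on_iff_diffs using diffs_Suc by blast

text \<open>A word of partial derivatives commutes with taking a component.\<close>

lemma smooth_component:
  fixes f :: "real^'n \<Rightarrow> 'b::real_normed_vector^'m"
  assumes "smooth_on S f"
  shows "smooth_on S (\<lambda>x. f x $ a)"
proof -
  have "\<forall>x\<in>S. foldr pd is (\<lambda>x. f x $ a) x = foldr pd is f x $ a \<and>
     foldr pd is (\<lambda>x. f x $ a) differentiable (at x)" for "is"
  proof (induction "is")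
    case Nil
    have "f differentiable (at x)" if "x \<in> S" for x
      using assms that unfolding smooth_on_def by (auto dest!: spec[of _ "[]"])
    then show ?case by (auto intro: differentiable_component)
  next
    case (Cons i "is")
    have df: "foldr pd js f differentiable (at x)" if "x \<in> S" for js x
      using assms that unfolding smooth_on_def by blast
    have 1: "foldr pd (i # is) (\<lambda>x. f x $ a) x = foldr pd (i # is) f x $ a" if "x \<in> S" for x
    proof -
      have "pd i (foldr pd is (\<lambda>x. f x $ a)) x = pd i (\<lambda>x. foldr pd is f x $ a) x"
        using Cons that by (intro pd_cong[OF S]) auto
      then show ?thesis using pd_component[OF df[OF that]] by simp
    qed
    moreover have "foldr pd (i # is) (\<lambda>x. f x $ a) differentiable (at x)" if "x \<in> S" for x
      by (rule differentiable_cong_open[OF S that _ differentiable_component[OF df[OF that, of "i # is"]]])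
         (use 1 in simp)
    ultimately show ?case by blast
  qed
  then show ?thesis unfolding smooth_on_def by blast
qed

lemma smooth_differentiable: "smooth_on S f \<Longrightarrow> x \<in> S \<Longrightarrow> f differentiable (at x)"
  unfolding smooth_on_def by (auto dest!: spec[of _ "[]"])

end

section \<open>Tensors given by their components in a coframe\<close>

text \<open>If \<open>T\<close> holds the components of a covariant tensor in the coframe whose forms are the rows of
  \<open>\<theta>\<close>, then \<open>coord1 \<theta> T\<close>, \<dots>, \<open>coord4 \<theta> T\<close> are its coordinate components. The higher ranks iterate
  the first, slot by slot, so that identities for one slot carry over.\<close>

definition coord1 :: "real^'n::finite^'n \<Rightarrow> ('n \<Rightarrow> real) \<Rightarrow> 'n \<Rightarrow> real" where
  "coord1 \<theta> T i = (\<Sum>a\<in>UNIV. \<theta>$a$i * T a)"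

definition coord2 :: "real^'n::finite^'n \<Rightarrow> ('n \<Rightarrow> 'n \<Rightarrow> real) \<Rightarrow> 'n \<Rightarrow> 'n \<Rightarrow> real" where
  "coord2 \<theta> T i j = coord1 \<theta> (\<lambda>a. coord1 \<theta> (T a) j) i"

definition coord3 :: "real^'n::finite^'n \<Rightarrow> ('n \<Rightarrow> 'n \<Rightarrow> 'n \<Rightarrow> real) \<Rightarrow> 'n \<Rightarrow> 'n \<Rightarrow> 'n \<Rightarrow> real" where
  "coord3 \<theta> T i j k = coord1 \<theta> (\<lambda>a. coord2 \<theta> (T a) j k) i"

definition coord4 :: "real^'n::finite^'n \<Rightarrow> ('n \<Rightarrow> 'n \<Rightarrow> 'n \<Rightarrow> 'n \<Rightarrow> real) \<Rightarrow>
    'n \<Rightarrow> 'n \<Rightarrow> 'n \<Rightarrow> 'n \<Rightarrow> real" where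
  "coord4 \<theta> T i j k l = coord1 \<theta> (\<lambda>a. coord3 \<theta> (T a) j k l) i"

lemma coord1_add: "coord1 \<theta> (\<lambda>a. S a + T a) i = coord1 \<theta> S i + coord1 \<theta> T i"
  and coord1_diff: "coord1 \<theta> (\<lambda>a. S a - T a) i = coord1 \<theta> S i - coord1 \<theta> T i"
  and coord1_minus: "coord1 \<theta> (\<lambda>a. - T a) i = - coord1 \<theta> T i"
  and coord1_scale: "coord1 \<theta> (\<lambda>a. c * T a) i = c * coord1 \<theta> T i"
  and coord1_scale_right: "coord1 \<theta> (\<lambda>a. T a * c) i = coord1 \<theta> T i * c"
  and coord1_divide: "coord1 \<theta> (\<lambda>a. T a / c) i = coord1 \<theta> T i / c"
  by (simp_all add: coord1_def sum.distrib sum_subtractf sum_negf sum_distrib_left sum_distrib_right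
      sum_divide_distrib algebra_simps)

lemma coord1_sum: "coord1 \<theta> (\<lambda>a. \<Sum>k\<in>A. T k a) i = (\<Sum>k\<in>A. coord1 \<theta> (T k) i)"
  unfolding coord1_def sum_distrib_left by (rule sum.swap)

lemma coord1_zero [simp]: "coord1 \<theta> (\<lambda>a. 0) i = 0"
  by (simp add: coord1_def)

lemma coord1_cong: "(\<And>a. S a = T a) \<Longrightarrow> coord1 \<theta> S i = coord1 \<theta> T i"
  by (simp add: coord1_def)

lemma coord1_swap:
  "coord1 \<theta> (\<lambda>a. coord1 \<theta> (\<lambda>b. T a b) j) i = coord1 \<theta> (\<lambda>b. coord1 \<theta> (\<lambda>a. T a b) i) j"
  unfolding coord1_def sum_distrib_left by (subst sum.swap) (simp add: mult.left_commute)

lemmas coord_linear = coord1_add coord1_diff coord1_minus coord1_scale coord1_scale_right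
  coord1_divide coord1_sum

lemma coord2_zero [simp]: "coord2 \<theta> (\<lambda>a b. 0) i j = 0"
  and coord3_zero [simp]: "coord3 \<theta> (\<lambda>a b c. 0) i j k = 0"
  and coord4_zero [simp]: "coord4 \<theta> (\<lambda>a b c d. 0) i j k l = 0"
  by (simp_all add: coord2_def coord3_def coord4_def)

text \<open>The coframe is invertible, so a tensor vanishes iff its frame components do. This turns each
  vanishing condition on a curvature tensor into finitely many scalar equations.\<close>

lemma coord1_eq_0_iff:
  assumes "B ** \<theta> = mat 1"
  shows "(\<forall>i. coord1 \<theta> T i = 0) \<longleftrightarrow> (\<forall>a. T a = 0)"
proof safe
  assume *: "\<forall>i. coord1 \<theta> T i = 0"
  have "\<theta> ** B = mat 1" using assms matrix_left_right_inverse by blast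
  then have d: "(\<Sum>i\<in>UNIV. \<theta>$b$i * B$i$a) = (if b = a then 1 else 0)" for a b
    by (simp add: matrix_matrix_mult_def mat_def vec_eq_iff)
  fix a
  have "T a = (\<Sum>b\<in>UNIV. (\<Sum>i\<in>UNIV. \<theta>$b$i * B$i$a) * T b)"
    unfolding d by (simp add: if_distrib[of "\<lambda>x. x * _"] cong: if_cong)
  also have "\<dots> = (\<Sum>i\<in>UNIV. B$i$a * coord1 \<theta> T i)"
    unfolding coord1_def sum_distrib_left sum_distrib_right
    by (subst sum.swap) (simp add: ac_simps)
  finally show "T a = 0" using * by simp
qed (simp add: coord1_def)

lemma coord2_eq_0_iff:
  assumes "B ** \<theta> = mat 1"
  shows "(\<forall>i j. coord2 \<theta> T i j = 0) \<longleftrightarrow> (\<forall>a b. T a b = 0)"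
proof -
  have "(\<forall>i j. coord2 \<theta> T i j = 0) \<longleftrightarrow> (\<forall>j. \<forall>i. coord1 \<theta> (\<lambda>a. coord1 \<theta> (T a) j) i = 0)"
    unfolding coord2_def by blast
  also have "\<dots> \<longleftrightarrow> (\<forall>a. \<forall>j. coord1 \<theta> (T a) j = 0)"
    by (subst coord1_eq_0_iff[OF assms]) blast
  finally show ?thesis unfolding coord1_eq_0_iff[OF assms] .
qed

lemma coord3_eq_0_iff:
  assumes "B ** \<theta> = mat 1"
  shows "(\<forall>i j k. coord3 \<theta> T i j k = 0) \<longleftrightarrow> (\<forall>a b c. T a b c = 0)"
proof -
  have "(\<forall>i j k. coord3 \<theta> T i j k = 0) \<longleftrightarrow> (\<forall>j k. \<forall>i. coord1 \<theta> (\<lambda>a. coord2 \<theta> (T a) j k) i = 0)"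
    unfolding coord3_def by blast
  also have "\<dots> \<longleftrightarrow> (\<forall>a. \<forall>j k. coord2 \<theta> (T a) j k = 0)"
    unfolding coord1_eq_0_iff[OF assms] by blast
  finally show ?thesis unfolding coord2_eq_0_iff[OF assms] .
qed

lemma coord4_eq_0_iff:
  assumes "B ** \<theta> = mat 1"
  shows "(\<forall>i j k l. coord4 \<theta> T i j k l = 0) \<longleftrightarrow> (\<forall>a b c d. T a b c d = 0)"
proof -
  have "(\<forall>i j k l. coord4 \<theta> T i j k l = 0) \<longleftrightarrow>
      (\<forall>j k l. \<forall>i. coord1 \<theta> (\<lambda>a. coord3 \<theta> (T a) j k l) i = 0)"
    unfolding coord4_def by blast
  also have "\<dots> \<longleftrightarrow> (\<forall>a. \<forall>j k l. coord3 \<theta> (T a) j k l = 0)"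
    unfolding coord1_eq_0_iff[OF assms] by blast
  finally show ?thesis unfolding coord3_eq_0_iff[OF assms] .
qed

lemma matrix_inv_unique:
  fixes A :: "real^'n::finite^'n"
  assumes "A ** C = mat 1"
  shows "matrix_inv A = C"
proof -
  have "C ** A = mat 1" using assms matrix_left_right_inverse by blast
  then have "\<exists>A'. A ** A' = mat 1 \<and> A' ** A = mat 1" using assms by blast
  then have "matrix_inv A ** A = mat 1" unfolding matrix_inv_def by (rule someI2_ex) simp
  then have "matrix_inv A ** (A ** C) = C" by (simp add: matrix_mul_assoc)
  then show ?thesis using assms by simp
qed

context
  fixes \<theta> B :: "real^'n::finite^'n" and g
  assumes inv: "B ** \<theta> = mat 1" and g: "g = transpose \<theta> ** \<theta>"
begin

lemma frame_inverse: "(\<Sum>i\<in>UNIV. \<theta>$b$i * B$i$a) = (if b = a then 1 else 0)"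
proof -
  have "\<theta> ** B = mat 1" using inv matrix_left_right_inverse by blast
  then show ?thesis by (simp add: matrix_matrix_mult_def mat_def vec_eq_iff)
qed

lemma inverse_metric: "matrix_inv g = B ** transpose B"
proof (rule matrix_inv_unique)
  have r: "\<theta> ** B = mat 1" using inv matrix_left_right_inverse by blast
  have "g ** (B ** transpose B) = transpose \<theta> ** ((\<theta> ** B) ** transpose B)"
    unfolding g by (simp add: matrix_mul_assoc)
  also have "\<dots> = transpose (B ** \<theta>)" by (simp add: r matrix_transpose_mul)
  finally show "g ** (B ** transpose B) = mat 1" by (simp add: inv)
qed

text \<open>Raising the index of a coframe element gives the dual frame vector.\<close>

lemma inverse_metric_coframe: "(\<Sum>j\<in>UNIV. matrix_inv g $i$j * \<theta>$a$j) = B$i$a"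
proof -
  have "(\<Sum>j\<in>UNIV. matrix_inv g $i$j * \<theta>$a$j) = (\<Sum>c\<in>UNIV. B$i$c * (\<Sum>j\<in>UNIV. \<theta>$a$j * B$j$c))"
    unfolding inverse_metric matrix_matrix_mult_def transpose_def sum_distrib_left
    by (simp add: sum_distrib_right) (subst sum.swap, simp add: ac_simps)
  also have "\<dots> = B$i$a"
    by (simp add: frame_inverse if_distrib[of "\<lambda>x. _ * x"] cong: if_cong)
  finally show ?thesis .
qed

lemma contract1:
  "(\<Sum>i\<in>UNIV. \<Sum>j\<in>UNIV. matrix_inv g $i$j * (coord1 \<theta> S i * coord1 \<theta> T j)) = (\<Sum>a\<in>UNIV. S a * T a)"
proof -
  have 1: "(\<Sum>j\<in>UNIV. matrix_inv g $i$j * coord1 \<theta> T j) = (\<Sum>a\<in>UNIV. B$i$a * T a)" for i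
    unfolding inverse_metric_coframe[symmetric] coord1_def sum_distrib_left sum_distrib_right
    by (subst sum.swap) (simp add: ac_simps)
  have "(\<Sum>i\<in>UNIV. \<Sum>j\<in>UNIV. matrix_inv g $i$j * (coord1 \<theta> S i * coord1 \<theta> T j)) =
    (\<Sum>i\<in>UNIV. coord1 \<theta> S i * (\<Sum>j\<in>UNIV. matrix_inv g $i$j * coord1 \<theta> T j))"
    by (simp add: sum_distrib_left ac_simps)
  also have "\<dots> = (\<Sum>i\<in>UNIV. \<Sum>a\<in>UNIV. \<Sum>b\<in>UNIV. (\<theta>$b$i * B$i$a) * (S b * T a))"
    unfolding 1 unfolding coord1_def by (simp add: sum_product sum_distrib_left ac_simps)
  also have "\<dots> = (\<Sum>a\<in>UNIV. \<Sum>b\<in>UNIV. (\<Sum>i\<in>UNIV. \<theta>$b$i * B$i$a) * (S b * T a))"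
    by (subst sum.swap, rule sum.cong[OF refl], subst sum.swap) (simp add: sum_distrib_right)
  also have "\<dots> = (\<Sum>a\<in>UNIV. S a * T a)"
    by (simp add: frame_inverse if_distrib[of "\<lambda>x. x * _"] cong: if_cong)
  finally show ?thesis .
qed

text \<open>In an orthonormal coframe the trace against the inverse metric is the plain sum over the
  diagonal.\<close>

lemma contract:
  "(\<Sum>i\<in>UNIV. \<Sum>j\<in>UNIV. matrix_inv g $i$j * coord2 \<theta> T i j) = (\<Sum>a\<in>UNIV. T a a)"
proof -
  have "coord2 \<theta> T i j = (\<Sum>c\<in>UNIV. coord1 \<theta> (\<lambda>a. if a = c then 1 else 0) i * coord1 \<theta> (T c) j)" for i j
  proof -
    have "coord2 \<theta> T i j = coord1 \<theta> (\<lambda>a. \<Sum>c\<in>UNIV. (if a = c then 1 else 0) * coord1 \<theta> (T c) j) i"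
      by (simp add: coord2_def if_distrib[of "\<lambda>x. x * _"] cong: if_cong)
    then show ?thesis by (simp only: coord_linear)
  qed
  then have "(\<Sum>i\<in>UNIV. \<Sum>j\<in>UNIV. matrix_inv g $i$j * coord2 \<theta> T i j) =
    (\<Sum>i\<in>UNIV. \<Sum>j\<in>UNIV. \<Sum>c\<in>UNIV. matrix_inv g $i$j * (coord1 \<theta> (\<lambda>a. if a = c then 1 else 0) i * coord1 \<theta> (T c) j))"
    by (simp add: sum_distrib_left)
  also have "\<dots> = (\<Sum>c\<in>UNIV. \<Sum>i\<in>UNIV. \<Sum>j\<in>UNIV. matrix_inv g $i$j * (coord1 \<theta> (\<lambda>a. if a = c then 1 else 0) i * coord1 \<theta> (T c) j))"
    by (subst (2) sum.swap, subst sum.swap, rule refl)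
  also have "\<dots> = (\<Sum>a\<in>UNIV. T a a)"
    unfolding contract1 by (simp add: if_distrib[of "\<lambda>x. x * _"] cong: if_cong)
  finally show ?thesis .
qed

end

section \<open>Cartan's structure equations\<close>

definition curvature_form :: "(real^'n::finite \<Rightarrow> real^'n^'n^'n) \<Rightarrow> real^'n \<Rightarrow> 'n \<Rightarrow> 'n \<Rightarrow> real^'n^'n" where
  "curvature_form \<omega> x a c = ext_d (\<lambda>y. \<omega> y $ a $ c) x + (\<Sum>h\<in>UNIV. wedge (\<omega> x $ a $ h) (\<omega> x $ h $ c))"

text \<open>The skew matrix \<open>\<omega>\<close> of one-forms satisfies the first structure equation
  \<open>d \<theta>\<^sup>a = - \<omega>\<^sup>a\<^sub>c \<and> \<theta>\<^sup>c\<close>, hence is the Levi-Civita connection in the coframe: skewness is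
  compatibility with the metric, the structure equation is the absence of torsion. The entry
  \<open>\<omega> x $ a $ c\<close> is the one-form \<open>\<omega>\<^sup>a\<^sub>c\<close>, and the columns of \<open>B\<close> are the dual frame.\<close>

locale cartan_coframe =
  fixes U :: "(real^'n::finite) set" and g :: "real^'n \<Rightarrow> real^'n^'n"
    and \<theta> B :: "real^'n \<Rightarrow> real^'n^'n" and \<omega> :: "real^'n \<Rightarrow> real^'n^'n^'n"
  assumes open_U: "open U"
    and frame: "x \<in> U \<Longrightarrow> B x ** \<theta> x = mat 1"
    and metric: "x \<in> U \<Longrightarrow> g x = transpose (\<theta> x) ** \<theta> x"
    and coframe_differentiable: "x \<in> U \<Longrightarrow> (\<lambda>y. \<theta> y $ a $ i) differentiable (at x)"
    and connection_skew: "x \<in> U \<Longrightarrow> \<omega> x $ c $ a = - \<omega> x $ a $ c"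
    and first_structure: "x \<in> U \<Longrightarrow> ext_d (\<lambda>y. \<theta> y $ a) x = - (\<Sum>c\<in>UNIV. wedge (\<omega> x $ a $ c) (\<theta> x $ c))"
begin

lemma metric_component: "x \<in> U \<Longrightarrow> g x $ j $ l = (\<Sum>a\<in>UNIV. \<theta> x $ a $ j * \<theta> x $ a $ l)"
  by (simp add: metric matrix_matrix_mult_def transpose_def)

text \<open>This identifies \<open>\<omega>\<close> with the connection of the Christoffel symbols, by the argument that proves
  uniqueness of the Levi-Civita connection. The right-hand side is symmetric in \<open>i\<close> and \<open>j\<close> by the
  first structure equation, and with skewness of \<open>\<omega>\<close> it expresses the derivatives of the metric;
  the alternating sum in the Christoffel symbol then leaves one term.\<close>

lemma christoffel_coframe:
  assumes x: "x \<in> U"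
  shows "(\<Sum>k\<in>UNIV. \<theta> x $ a $ k * christoffel g x k i j) =
    pd i (\<lambda>y. \<theta> y $ a $ j) x + (\<Sum>c\<in>UNIV. \<omega> x $ a $ c $ i * \<theta> x $ c $ j)"
proof -
  define N where "N a i j = pd i (\<lambda>y. \<theta> y $ a $ j) x + (\<Sum>c\<in>UNIV. \<omega> x $ a $ c $ i * \<theta> x $ c $ j)" for a i j
  define L where "L l i j = (\<Sum>a\<in>UNIV. \<theta> x $ a $ l * N a i j)" for l i j
  have N_sym: "N a i j = N a j i" for a i j
  proof -
    have "ext_d (\<lambda>y. \<theta> y $ a) x $ i $ j = - (\<Sum>c\<in>UNIV. wedge (\<omega> x $ a $ c) (\<theta> x $ c)) $ i $ j"
      using first_structure[OF x] by simp
    then show ?thesis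
      by (simp add: ext_d_def wedge_def outer_def N_def sum_subtractf algebra_simps)
  qed
  have dg: "pd i (\<lambda>y. g y $ j $ l) x = L l i j + L j i l" for i j l
  proof -
    have "pd i (\<lambda>y. g y $ j $ l) x = pd i (\<lambda>y. \<Sum>a\<in>UNIV. \<theta> y $ a $ j * \<theta> y $ a $ l) x"
      by (rule pd_cong[OF open_U x metric_component])
    also have "\<dots> = (\<Sum>a\<in>UNIV. \<theta> x $ a $ l * pd i (\<lambda>y. \<theta> y $ a $ j) x) + (\<Sum>a\<in>UNIV. \<theta> x $ a $ j * pd i (\<lambda>y. \<theta> y $ a $ l) x)"
      by (simp add: pd_sum pd_mult coframe_differentiable[OF x] sum.distrib ac_simps)
    also have "\<dots> = L l i j + L j i l
       - ((\<Sum>a\<in>UNIV. \<Sum>c\<in>UNIV. \<theta> x $ a $ l * (\<omega> x $ a $ c $ i * \<theta> x $ c $ j))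
          + (\<Sum>a\<in>UNIV. \<Sum>c\<in>UNIV. \<theta> x $ a $ j * (\<omega> x $ a $ c $ i * \<theta> x $ c $ l)))"
      by (simp add: L_def N_def sum.distrib algebra_simps sum_distrib_left)
    also have "(\<Sum>a\<in>UNIV. \<Sum>c\<in>UNIV. \<theta> x $ a $ j * (\<omega> x $ a $ c $ i * \<theta> x $ c $ l)) =
      - (\<Sum>a\<in>UNIV. \<Sum>c\<in>UNIV. \<theta> x $ a $ l * (\<omega> x $ a $ c $ i * \<theta> x $ c $ j))"
      apply (subst sum.swap)
      apply (simp flip: sum_negf)
      apply (rule sum.cong[OF refl], rule sum.cong[OF refl])
      subgoal for c a using connection_skew[OF x, of a c] by simp
      done
    finally show ?thesis by simp
  qed
  have chr: "christoffel g x k i j = (\<Sum>l\<in>UNIV. matrix_inv (g x) $ k $ l * L l i j)" for k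
  proof -
    have "L i j l = L i l j" "L j i l = L j l i" "L l i j = L l j i" for l
      unfolding L_def by (simp_all add: N_sym[of _ j l] N_sym[of _ i l] N_sym[of _ i j])
    then have *: "L l i j + L j i l + (L l j i + L i j l) - (L j l i + L i l j) = 2 * L l i j" for l
      by simp
    show ?thesis unfolding christoffel_def dg * by (simp add: sum_divide_distrib)
  qed
  have ginv: "matrix_inv (g x) = B x ** transpose (B x)"
    by (rule inverse_metric[OF frame[OF x] metric[OF x]])
  have "(\<Sum>k\<in>UNIV. \<theta> x $ a $ k * matrix_inv (g x) $ k $ l) = B x $ l $ a" for l
  proof -
    have "matrix_inv (g x) $ k $ l = matrix_inv (g x) $ l $ k" for k
      unfolding ginv by (simp add: matrix_matrix_mult_def transpose_def mult.commute)
    then show ?thesis using inverse_metric_coframe[OF frame[OF x] metric[OF x]] by (simp add: mult.commute)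
  qed
  then have "(\<Sum>k\<in>UNIV. \<theta> x $ a $ k * christoffel g x k i j) = (\<Sum>l\<in>UNIV. B x $ l $ a * L l i j)"
    unfolding chr sum_distrib_left
    by (subst sum.swap) (simp add: sum_distrib_right[symmetric] mult.assoc[symmetric])
  also have "\<dots> = (\<Sum>c\<in>UNIV. (\<Sum>l\<in>UNIV. \<theta> x $ c $ l * B x $ l $ a) * N c i j)"
    unfolding L_def sum_distrib_left sum_distrib_right by (subst sum.swap) (simp add: ac_simps)
  also have "\<dots> = N a i j"
    unfolding frame_inverse[OF frame[OF x] metric[OF x]]
    by (simp add: if_distrib[of "\<lambda>x. x * _"] cong: if_cong)
  finally show ?thesis by (simp add: N_def)
qed

lemma christoffel_eq:
  assumes x: "x \<in> U"
  shows "christoffel g x k i j = (\<Sum>a\<in>UNIV. B x $ k $ a * (pd i (\<lambda>y. \<theta> y $ a $ j) x + (\<Sum>c\<in>UNIV. \<omega> x $ a $ c $ i * \<theta> x $ c $ j)))"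
proof -
  have "(\<Sum>a\<in>UNIV. B x $ k $ a * \<theta> x $ a $ l) = (if k = l then 1 else 0)" for l
    using frame[OF x] by (simp add: matrix_matrix_mult_def mat_def vec_eq_iff)
  then have "christoffel g x k i j = (\<Sum>l\<in>UNIV. (\<Sum>a\<in>UNIV. B x $ k $ a * \<theta> x $ a $ l) * christoffel g x l i j)"
    by (simp add: if_distrib[of "\<lambda>x. x * _"] cong: if_cong)
  then show ?thesis unfolding christoffel_coframe[OF x, symmetric] sum_distrib_right sum_distrib_left
    by (subst (asm) sum.swap) (simp add: ac_simps)
qed

text \<open>The correction of one slot by Christoffel symbols becomes a correction by \<open>\<omega>\<close> of the frame
  components. The covariant derivatives of tensors of rank two, three and four below follow by
  applying this to one slot at a time.\<close>

lemma slot_derivative: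
  assumes x: "x \<in> U" and T: "\<And>a. (\<lambda>y. T y a) differentiable (at x)"
  shows "pd m (\<lambda>y. coord1 (\<theta> y) (T y) i) x - (\<Sum>r\<in>UNIV. christoffel g x r m i * coord1 (\<theta> x) (T x) r)
    = coord1 (\<theta> x) (\<lambda>a. pd m (\<lambda>y. T y a) x - (\<Sum>c\<in>UNIV. \<omega> x $ c $ a $ m * T x c)) i"
proof -
  have "(\<Sum>r\<in>UNIV. christoffel g x r m i * coord1 (\<theta> x) (T x) r) =
    (\<Sum>a\<in>UNIV. (\<Sum>r\<in>UNIV. \<theta> x $ a $ r * christoffel g x r m i) * T x a)"
    unfolding coord1_def sum_distrib_left sum_distrib_right by (subst sum.swap) (simp add: ac_simps)
  also have "\<dots> = (\<Sum>a\<in>UNIV. pd m (\<lambda>y. \<theta> y $ a $ i) x * T x a) + (\<Sum>a\<in>UNIV. \<Sum>c\<in>UNIV. \<omega> x $ a $ c $ m * \<theta> x $ c $ i * T x a)"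
    unfolding christoffel_coframe[OF x] by (simp add: sum.distrib sum_distrib_right distrib_right)
  also have "(\<Sum>a\<in>UNIV. \<Sum>c\<in>UNIV. \<omega> x $ a $ c $ m * \<theta> x $ c $ i * T x a) =
     coord1 (\<theta> x) (\<lambda>a. \<Sum>c\<in>UNIV. \<omega> x $ c $ a $ m * T x c) i"
    unfolding coord1_def sum_distrib_left by (subst sum.swap) (intro sum.cong refl, simp)
  finally have 1: "(\<Sum>r\<in>UNIV. christoffel g x r m i * coord1 (\<theta> x) (T x) r) =
    (\<Sum>a\<in>UNIV. pd m (\<lambda>y. \<theta> y $ a $ i) x * T x a) + coord1 (\<theta> x) (\<lambda>a. \<Sum>c\<in>UNIV. \<omega> x $ c $ a $ m * T x c) i" .
  have "pd m (\<lambda>y. coord1 (\<theta> y) (T y) i) x = (\<Sum>a\<in>UNIV. pd m (\<lambda>y. \<theta> y $ a $ i) x * T x a) + coord1 (\<theta> x) (\<lambda>a. pd m (\<lambda>y. T y a) x) i"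
    unfolding coord1_def by (simp add: pd_sum pd_mult coframe_differentiable[OF x] T sum.distrib)
  then show ?thesis unfolding 1 by (simp add: coord1_diff)
qed

lemma coord1_differentiable:
  assumes "x \<in> U" "\<And>a. (\<lambda>y. T y a) differentiable (at x)"
  shows "(\<lambda>y. coord1 (\<theta> y) (T y) i) differentiable (at x)"
  unfolding coord1_def using coframe_differentiable[OF assms(1)] assms(2) by simp

lemma coord2_differentiable:
  assumes "x \<in> U" "\<And>a b. (\<lambda>y. T y a b) differentiable (at x)"
  shows "(\<lambda>y. coord2 (\<theta> y) (T y) i j) differentiable (at x)"
  unfolding coord2_def by (intro coord1_differentiable assms)

lemma coord3_differentiable:
  assumes "x \<in> U" "\<And>a b c. (\<lambda>y. T y a b c) differentiable (at x)"
  shows "(\<lambda>y. coord3 (\<theta> y) (T y) i j k) differentiable (at x)"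
  unfolding coord3_def by (intro coord1_differentiable coord2_differentiable assms)

lemma nabla2_coord:
  assumes x: "x \<in> U" and T: "\<And>a b. (\<lambda>y. T y a b) differentiable (at x)"
  shows "nabla2 g (\<lambda>y. coord2 (\<theta> y) (T y)) x m i j = coord2 (\<theta> x) (\<lambda>a b. pd m (\<lambda>y. T y a b) x
     - (\<Sum>c\<in>UNIV. \<omega> x $ c $ a $ m * T x c b) - (\<Sum>c\<in>UNIV. \<omega> x $ c $ b $ m * T x a c)) i j"
proof -
  let ?U = "\<lambda>y a. coord1 (\<theta> y) (T y a) j"
  have s: "(\<Sum>r\<in>UNIV. christoffel g x r m j * coord2 (\<theta> x) (T x) i r) =
     coord1 (\<theta> x) (\<lambda>a. \<Sum>r\<in>UNIV. christoffel g x r m j * coord1 (\<theta> x) (T x a) r) i"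
    by (simp add: coord2_def coord_linear)
  have "nabla2 g (\<lambda>y. coord2 (\<theta> y) (T y)) x m i j =
     coord1 (\<theta> x) (\<lambda>a. pd m (\<lambda>y. ?U y a) x - (\<Sum>c\<in>UNIV. \<omega> x $ c $ a $ m * ?U x c)) i
     - (\<Sum>r\<in>UNIV. christoffel g x r m j * coord2 (\<theta> x) (T x) i r)"
    unfolding nabla2_def
    using slot_derivative[OF x, of ?U m i] coord1_differentiable[OF x T]
    by (simp add: coord2_def)
  also have "\<dots> = coord1 (\<theta> x) (\<lambda>a. (pd m (\<lambda>y. ?U y a) x - (\<Sum>r\<in>UNIV. christoffel g x r m j * coord1 (\<theta> x) (T x a) r))
     - (\<Sum>c\<in>UNIV. \<omega> x $ c $ a $ m * ?U x c)) i"
    unfolding s coord1_diff by simp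
  also have "\<dots> = coord2 (\<theta> x) (\<lambda>a b. pd m (\<lambda>y. T y a b) x
     - (\<Sum>c\<in>UNIV. \<omega> x $ c $ a $ m * T x c b) - (\<Sum>c\<in>UNIV. \<omega> x $ c $ b $ m * T x a c)) i j"
    unfolding slot_derivative[OF x T] unfolding coord2_def by (simp add: coord_linear)
  finally show ?thesis .
qed

lemma nabla3_coord:
  assumes x: "x \<in> U" and T: "\<And>a b c. (\<lambda>y. T y a b c) differentiable (at x)"
  shows "nabla3 g (\<lambda>y. coord3 (\<theta> y) (T y)) x m i j k = coord3 (\<theta> x) (\<lambda>a b c. pd m (\<lambda>y. T y a b c) x
     - (\<Sum>d\<in>UNIV. \<omega> x $ d $ a $ m * T x d b c) - (\<Sum>d\<in>UNIV. \<omega> x $ d $ b $ m * T x a d c)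
     - (\<Sum>d\<in>UNIV. \<omega> x $ d $ c $ m * T x a b d)) i j k"
proof -
  let ?U = "\<lambda>y a. coord2 (\<theta> y) (T y a) j k"
  have s: "(\<Sum>r\<in>UNIV. christoffel g x r m j * coord3 (\<theta> x) (T x) i r k) =
     coord1 (\<theta> x) (\<lambda>a. \<Sum>r\<in>UNIV. christoffel g x r m j * coord2 (\<theta> x) (T x a) r k) i"
    "(\<Sum>r\<in>UNIV. christoffel g x r m k * coord3 (\<theta> x) (T x) i j r) =
     coord1 (\<theta> x) (\<lambda>a. \<Sum>r\<in>UNIV. christoffel g x r m k * coord2 (\<theta> x) (T x a) j r) i"
    by (simp_all add: coord3_def coord_linear)
  have "nabla3 g (\<lambda>y. coord3 (\<theta> y) (T y)) x m i j k =
     coord1 (\<theta> x) (\<lambda>a. pd m (\<lambda>y. ?U y a) x - (\<Sum>c\<in>UNIV. \<omega> x $ c $ a $ m * ?U x c)) i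
     - (\<Sum>r\<in>UNIV. christoffel g x r m j * coord3 (\<theta> x) (T x) i r k)
     - (\<Sum>r\<in>UNIV. christoffel g x r m k * coord3 (\<theta> x) (T x) i j r)"
    unfolding nabla3_def
    using slot_derivative[OF x, of ?U m i] coord2_differentiable[OF x T]
    by (simp add: coord3_def)
  also have "\<dots> = coord1 (\<theta> x) (\<lambda>a. nabla2 g (\<lambda>y. coord2 (\<theta> y) (T y a)) x m j k
     - (\<Sum>c\<in>UNIV. \<omega> x $ c $ a $ m * ?U x c)) i"
    unfolding s coord1_diff nabla2_def by simp
  also have "\<dots> = coord3 (\<theta> x) (\<lambda>a b c. pd m (\<lambda>y. T y a b c) x
     - (\<Sum>d\<in>UNIV. \<omega> x $ d $ a $ m * T x d b c) - (\<Sum>d\<in>UNIV. \<omega> x $ d $ b $ m * T x a d c)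
     - (\<Sum>d\<in>UNIV. \<omega> x $ d $ c $ m * T x a b d)) i j k"
    unfolding nabla2_coord[OF x T] unfolding coord3_def coord2_def by (simp add: coord_linear)
  finally show ?thesis .
qed

lemma nabla4_coord:
  assumes x: "x \<in> U" and T: "\<And>a b c d. (\<lambda>y. T y a b c d) differentiable (at x)"
  shows "nabla4 g (\<lambda>y. coord4 (\<theta> y) (T y)) x m i j k l = coord4 (\<theta> x) (\<lambda>a b c d. pd m (\<lambda>y. T y a b c d) x
     - (\<Sum>e\<in>UNIV. \<omega> x $ e $ a $ m * T x e b c d) - (\<Sum>e\<in>UNIV. \<omega> x $ e $ b $ m * T x a e c d)
     - (\<Sum>e\<in>UNIV. \<omega> x $ e $ c $ m * T x a b e d) - (\<Sum>e\<in>UNIV. \<omega> x $ e $ d $ m * T x a b c e)) i j k l"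
proof -
  let ?U = "\<lambda>y a. coord3 (\<theta> y) (T y a) j k l"
  have s: "(\<Sum>r\<in>UNIV. christoffel g x r m j * coord4 (\<theta> x) (T x) i r k l) =
     coord1 (\<theta> x) (\<lambda>a. \<Sum>r\<in>UNIV. christoffel g x r m j * coord3 (\<theta> x) (T x a) r k l) i"
    "(\<Sum>r\<in>UNIV. christoffel g x r m k * coord4 (\<theta> x) (T x) i j r l) =
     coord1 (\<theta> x) (\<lambda>a. \<Sum>r\<in>UNIV. christoffel g x r m k * coord3 (\<theta> x) (T x a) j r l) i"
    "(\<Sum>r\<in>UNIV. christoffel g x r m l * coord4 (\<theta> x) (T x) i j k r) =
     coord1 (\<theta> x) (\<lambda>a. \<Sum>r\<in>UNIV. christoffel g x r m l * coord3 (\<theta> x) (T x a) j k r) i"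
    by (simp_all add: coord4_def coord_linear)
  have "nabla4 g (\<lambda>y. coord4 (\<theta> y) (T y)) x m i j k l =
     coord1 (\<theta> x) (\<lambda>a. pd m (\<lambda>y. ?U y a) x - (\<Sum>c\<in>UNIV. \<omega> x $ c $ a $ m * ?U x c)) i
     - (\<Sum>r\<in>UNIV. christoffel g x r m j * coord4 (\<theta> x) (T x) i r k l)
     - (\<Sum>r\<in>UNIV. christoffel g x r m k * coord4 (\<theta> x) (T x) i j r l)
     - (\<Sum>r\<in>UNIV. christoffel g x r m l * coord4 (\<theta> x) (T x) i j k r)"
    unfolding nabla4_def
    using slot_derivative[OF x, of ?U m i] coord3_differentiable[OF x T]
    by (simp add: coord4_def)
  also have "\<dots> = coord1 (\<theta> x) (\<lambda>a. nabla3 g (\<lambda>y. coord3 (\<theta> y) (T y a)) x m j k l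
     - (\<Sum>c\<in>UNIV. \<omega> x $ c $ a $ m * ?U x c)) i"
    unfolding s coord1_diff nabla3_def by simp
  also have "\<dots> = coord4 (\<theta> x) (\<lambda>a b c d. pd m (\<lambda>y. T y a b c d) x
     - (\<Sum>e\<in>UNIV. \<omega> x $ e $ a $ m * T x e b c d) - (\<Sum>e\<in>UNIV. \<omega> x $ e $ b $ m * T x a e c d)
     - (\<Sum>e\<in>UNIV. \<omega> x $ e $ c $ m * T x a b e d) - (\<Sum>e\<in>UNIV. \<omega> x $ e $ d $ m * T x a b c e)) i j k l"
    unfolding nabla3_coord[OF x T] unfolding coord4_def coord3_def coord2_def by (simp add: coord_linear)
  finally show ?thesis .
qed

text \<open>Cartan's second structure equation. Differentiating \<open>christoffel_coframe\<close> gives the derivatives of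
  the Christoffel symbols; in the antisymmetrization the second derivatives of the coframe cancel,
  and the remaining terms assemble into \<open>d \<omega> + \<omega> \<and> \<omega>\<close>.\<close>

lemma riem_coframe:
  assumes x: "x \<in> U"
    and B: "\<And>k a. (\<lambda>y. B y $ k $ a) differentiable (at x)"
    and d\<theta>: "\<And>m a i. pd m (\<lambda>y. \<theta> y $ a $ i) differentiable (at x)"
    and \<omega>: "\<And>a c m. (\<lambda>y. \<omega> y $ a $ c $ m) differentiable (at x)"
  shows "(\<Sum>d\<in>UNIV. \<theta> x $ e $ d * riem g x a b c d) = - (\<Sum>f\<in>UNIV. curvature_form \<omega> x e f $ a $ b * \<theta> x $ f $ c)"
proof -
  note \<theta> = coframe_differentiable[OF x]
  have G: "(\<lambda>y. christoffel g y k i j) differentiable (at x)" for k i j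
    by (rule differentiable_cong_open[OF open_U x christoffel_eq[symmetric]])
       (use \<theta> B d\<theta> \<omega> in auto)
  let ?G = "\<lambda>k i j. christoffel g x k i j"
  define S1 where "S1 a b = (\<Sum>k\<in>UNIV. pd b (\<lambda>y. \<theta> y $ e $ k) x * ?G k a c)" for a b
  define S2 where "S2 a b = (\<Sum>f\<in>UNIV. pd b (\<lambda>y. \<omega> y $ e $ f $ a) x * \<theta> x $ f $ c)" for a b
  define S3 where "S3 a b = (\<Sum>f\<in>UNIV. \<omega> x $ e $ f $ a * pd b (\<lambda>y. \<theta> y $ f $ c) x)" for a b
  define S4 where "S4 a b = (\<Sum>f\<in>UNIV. \<Sum>h\<in>UNIV. \<omega> x $ e $ f $ b * (\<omega> x $ f $ h $ a * \<theta> x $ h $ c))" for a b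
  have D: "(\<Sum>k\<in>UNIV. \<theta> x $ e $ k * pd b (\<lambda>y. christoffel g y k a c) x) =
     pd b (pd a (\<lambda>y. \<theta> y $ e $ c)) x + S2 a b + S3 a b - S1 a b" for a b
  proof -
    have "pd b (\<lambda>y. \<Sum>k\<in>UNIV. \<theta> y $ e $ k * christoffel g y k a c) x =
       pd b (\<lambda>y. pd a (\<lambda>y. \<theta> y $ e $ c) y + (\<Sum>f\<in>UNIV. \<omega> y $ e $ f $ a * \<theta> y $ f $ c)) x"
      by (rule pd_cong[OF open_U x christoffel_coframe])
    then show ?thesis
      by (simp add: pd_sum pd_add pd_mult \<theta> G d\<theta> \<omega> sum.distrib S1_def S2_def S3_def)
  qed
  have Q: "(\<Sum>d\<in>UNIV. \<theta> x $ e $ d * (\<Sum>m\<in>UNIV. ?G d b m * ?G m a c)) = S1 a b + S3 b a + S4 a b" for a b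
  proof -
    have "(\<Sum>d\<in>UNIV. \<theta> x $ e $ d * (\<Sum>m\<in>UNIV. ?G d b m * ?G m a c)) =
       (\<Sum>m\<in>UNIV. (\<Sum>d\<in>UNIV. \<theta> x $ e $ d * ?G d b m) * ?G m a c)"
      unfolding sum_distrib_left sum_distrib_right by (subst sum.swap) (simp add: ac_simps)
    also have "\<dots> = S1 a b + (\<Sum>m\<in>UNIV. \<Sum>f\<in>UNIV. \<omega> x $ e $ f $ b * \<theta> x $ f $ m * ?G m a c)"
      unfolding christoffel_coframe[OF x] by (simp add: S1_def sum.distrib sum_distrib_right distrib_right)
    also have "(\<Sum>m\<in>UNIV. \<Sum>f\<in>UNIV. \<omega> x $ e $ f $ b * \<theta> x $ f $ m * ?G m a c) =
       (\<Sum>f\<in>UNIV. \<omega> x $ e $ f $ b * (\<Sum>m\<in>UNIV. \<theta> x $ f $ m * ?G m a c))"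
      by (subst sum.swap) (simp add: sum_distrib_left mult.assoc)
    also have "\<dots> = S3 b a + S4 a b"
      unfolding christoffel_coframe[OF x] by (simp add: S3_def S4_def sum.distrib sum_distrib_left distrib_left)
    finally show ?thesis by simp
  qed
  have comm: "pd b (pd a (\<lambda>y. \<theta> y $ e $ c)) x = pd a (pd b (\<lambda>y. \<theta> y $ e $ c)) x"
    by (rule pd_commute[OF open_U x]) (use coframe_differentiable d\<theta> in auto)
  have "(\<Sum>d\<in>UNIV. \<theta> x $ e $ d * riem g x a b c d) = S2 a b - S2 b a + S4 a b - S4 b a"
    unfolding riem_def distrib_left right_diff_distrib sum.distrib sum_subtractf D Q comm by simp
  also have "\<dots> = - (\<Sum>f\<in>UNIV. curvature_form \<omega> x e f $ a $ b * \<theta> x $ f $ c)"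
  proof -
    have 4: "S4 a b = (\<Sum>f\<in>UNIV. (\<Sum>h\<in>UNIV. \<omega> x $ e $ h $ b * \<omega> x $ h $ f $ a) * \<theta> x $ f $ c)" for a b
      unfolding S4_def sum_distrib_right by (subst sum.swap) (simp add: mult.assoc)
    show ?thesis unfolding 4 S2_def curvature_form_def
      by (simp add: ext_d_def wedge_def outer_def sum.distrib sum_subtractf algebra_simps flip: sum_negf)
  qed
  finally show ?thesis .
qed

lemma rm_coord:
  assumes x: "x \<in> U"
    and B: "\<And>k a. (\<lambda>y. B y $ k $ a) differentiable (at x)"
    and d\<theta>: "\<And>m a i. pd m (\<lambda>y. \<theta> y $ a $ i) differentiable (at x)"
    and \<omega>: "\<And>a c m. (\<lambda>y. \<omega> y $ a $ c $ m) differentiable (at x)"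
    and \<Omega>: "\<And>a c i j. curvature_form \<omega> x a c $ i $ j = coord2 (\<theta> x) (\<Omega> a c) i j"
  shows "rm g x i j k l = coord4 (\<theta> x) (\<lambda>a b c d. - \<Omega> d c a b) i j k l"
proof -
  have "rm g x i j k l = (\<Sum>a\<in>UNIV. \<theta> x $ a $ l * (\<Sum>e\<in>UNIV. \<theta> x $ a $ e * riem g x i j k e))"
    unfolding rm_def metric_component[OF x] sum_distrib_left sum_distrib_right
    by (subst sum.swap) (simp add: ac_simps)
  also have "\<dots> = - (\<Sum>a\<in>UNIV. \<theta> x $ a $ l * (\<Sum>f\<in>UNIV. coord2 (\<theta> x) (\<Omega> a f) i j * \<theta> x $ f $ k))"
    unfolding riem_coframe[OF x B d\<theta> \<omega>] \<Omega> by (simp add: sum_negf)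
  also have "\<dots> = coord4 (\<theta> x) (\<lambda>a b c d. - \<Omega> d c a b) i j k l"
  proof -
    have "coord4 (\<theta> x) (\<lambda>a b c d. - \<Omega> d c a b) i j k l =
      coord1 (\<theta> x) (\<lambda>a. coord1 (\<theta> x) (\<lambda>b. \<Sum>c\<in>UNIV. \<theta> x $ c $ k * (\<Sum>d\<in>UNIV. \<theta> x $ d $ l * - \<Omega> d c a b)) j) i"
      unfolding coord4_def coord3_def coord2_def
      by (intro coord1_cong) (simp add: coord1_def)
    also have "\<dots> = - (\<Sum>c\<in>UNIV. \<Sum>d\<in>UNIV. \<theta> x $ d $ l * (coord2 (\<theta> x) (\<Omega> d c) i j * \<theta> x $ c $ k))"
      by (simp add: coord_linear coord2_def sum_distrib_left ac_simps sum_negf)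
    finally show ?thesis by (subst (asm) sum.swap) (simp add: sum_distrib_left)
  qed
  finally show ?thesis .
qed

end

section \<open>Contractions in a coframe\<close>

lemma metric_inverse_left:
  fixes \<theta> B :: "real^'n::finite^'n"
  assumes "B ** \<theta> = mat 1" "G = transpose \<theta> ** \<theta>"
  shows "matrix_inv G ** G = mat 1"
proof -
  have "matrix_inv G ** G = B ** transpose (\<theta> ** B) ** \<theta>"
    unfolding inverse_metric[OF assms] by (simp add: assms(2) matrix_mul_assoc matrix_transpose_mul)
  moreover have "\<theta> ** B = mat 1" using assms(1) matrix_left_right_inverse by blast
  ultimately show ?thesis using assms(1) by (simp add: transpose_mat)
qed

text \<open>Regrouping the slots as \<open>(2, 4)\<close> and \<open>(1, 3)\<close> puts the pair that the Ricci trace contracts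
  into the form required by \<open>contract\<close>.\<close>

lemma coord4_transpose:
  "coord4 \<theta> T i j k l = coord2 \<theta> (\<lambda>b d. coord2 \<theta> (\<lambda>a c. T a b c d) i k) j l"
proof -
  have "coord4 \<theta> T i j k l = coord1 \<theta> (\<lambda>b. coord1 \<theta> (\<lambda>a. coord1 \<theta> (\<lambda>c. coord1 \<theta> (\<lambda>d. T a b c d) l) k) i) j"
    unfolding coord4_def coord3_def coord2_def by (rule coord1_swap)
  also have "\<dots> = coord1 \<theta> (\<lambda>b. coord1 \<theta> (\<lambda>a. coord1 \<theta> (\<lambda>d. coord1 \<theta> (\<lambda>c. T a b c d) k) l) i) j"
    by (intro coord1_cong coord1_swap)
  also have "\<dots> = coord1 \<theta> (\<lambda>b. coord1 \<theta> (\<lambda>d. coord1 \<theta> (\<lambda>a. coord1 \<theta> (\<lambda>c. T a b c d) k) i) l) j"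
    by (intro coord1_cong coord1_swap)
  finally show ?thesis unfolding coord2_def .
qed

lemma coord4_pairs: "coord4 \<theta> T i j k l = coord2 \<theta> (\<lambda>a b. coord2 \<theta> (T a b) k l) i j"
  unfolding coord4_def coord3_def coord2_def ..

lemma coord2_flip: "coord2 \<theta> T j i = coord2 \<theta> (\<lambda>a b. T b a) i j"
  unfolding coord2_def by (rule coord1_swap)

context
  fixes \<theta> B :: "real^'n::finite^'n" and G
  assumes inv: "B ** \<theta> = mat 1" and G: "G = transpose \<theta> ** \<theta>"
begin

lemma metric_coord: "G $ i $ j = coord2 \<theta> (\<lambda>a b. if a = b then 1 else 0) i j"
  by (simp add: G coord2_def coord1_def matrix_matrix_mult_def transpose_def if_distrib cong: if_cong)

lemma contract_24:
  "(\<Sum>i\<in>UNIV. \<Sum>j\<in>UNIV. matrix_inv G $ i $ j * coord4 \<theta> T b i c j) = coord2 \<theta> (\<lambda>a d. \<Sum>h\<in>UNIV. T a h d h) b c"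
  unfolding coord4_transpose contract[OF inv G] by (simp add: coord2_def coord_linear)

lemma ricci_coord:
  assumes g: "g x = G" and R: "\<And>i j k l. rm g x i j k l = coord4 \<theta> R i j k l"
  shows "ricci g x $ b $ c = coord2 \<theta> (\<lambda>e f. \<Sum>h\<in>UNIV. R e h f h) b c"
proof -
  have "matrix_inv G ** G = mat 1" by (rule metric_inverse_left[OF inv G])
  then have *: "(\<Sum>d\<in>UNIV. matrix_inv G $ a $ d * G $ d $ e) = (if a = e then 1 else 0)" for a e
    by (simp add: matrix_matrix_mult_def mat_def vec_eq_iff)
  have "(\<Sum>d\<in>UNIV. matrix_inv G $ a $ d * rm g x b a c d) = riem g x b a c a" for a
  proof -
    have "(\<Sum>d\<in>UNIV. matrix_inv G $ a $ d * rm g x b a c d) =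
       (\<Sum>e\<in>UNIV. (\<Sum>d\<in>UNIV. matrix_inv G $ a $ d * G $ d $ e) * riem g x b a c e)"
      unfolding rm_def g sum_distrib_left sum_distrib_right by (subst sum.swap) (simp add: ac_simps)
    then show ?thesis unfolding * by (simp add: if_distrib[of "\<lambda>x. x * _"] cong: if_cong)
  qed
  then have "ricci g x $ b $ c = (\<Sum>i\<in>UNIV. \<Sum>j\<in>UNIV. matrix_inv G $ i $ j * rm g x b i c j)"
    by (simp add: ricci_def)
  then show ?thesis unfolding R contract_24 .
qed

lemma scal_coord:
  assumes g: "g x = G" and R: "\<And>b c. ricci g x $ b $ c = coord2 \<theta> r b c"
  shows "scal g x = (\<Sum>a\<in>UNIV. r a a)"
  unfolding scal_def g R by (rule contract[OF inv G])

end

section \<open>An orthonormal coframe on a surface\<close>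

lemma smooth_on_ext_d:
  assumes "open S" "\<And>i. smooth_on S (\<lambda>x. w x $ i :: real)"
  shows "smooth_on S (\<lambda>x. ext_d w x $ i $ j)"
  unfolding ext_d_def by simp (intro smooth_diff smooth_pd assms)

lemma wedge_component: "wedge u v $ i $ j = u $ i * v $ j - v $ i * u $ j"
  by (simp add: wedge_def outer_def)

text \<open>A two-form on a surface has a single component.\<close>

lemma two_form_eq:
  fixes A C :: "real^2^2"
  assumes "\<And>i j. A $ j $ i = - A $ i $ j" "\<And>i j. C $ j $ i = - C $ i $ j" "A $ 1 $ 2 = C $ 1 $ 2"
  shows "A = C"
proof -
  have "A $ i $ i = 0" "C $ i $ i = 0" for i using assms(1,2)[of i i] by auto
  then show ?thesis using assms(3) assms(1,2)[of 2 1] by (simp add: vec_eq_iff forall_2)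
qed

lemma ext_d_skew: "ext_d w x $ j $ i = - ext_d w x $ i $ j"
  by (simp add: ext_d_def)

text \<open>The Cholesky factors of the metric form an oriented orthonormal coframe \<open>u, v\<close>, whose coefficients
  are algebraic in those of the metric. Every two-form on a surface is a multiple of
  \<open>u \<and> v\<close>; writing \<open>d u = p u \<and> v\<close> and \<open>d v = q u \<and> v\<close> determines the connection form as
  \<open>\<phi> = p u + q v\<close>. The second structure equation
  identifies the Gauss curvature, and shows that it is smooth.\<close>

lemma surface_coframe:
  fixes gS :: "real^2 \<Rightarrow> real^2^2"
  assumes D: "open D" and gS: "smooth_on D gS"
    and sym: "\<And>x. x \<in> D \<Longrightarrow> transpose (gS x) = gS x"
    and pos: "\<And>x w. x \<in> D \<Longrightarrow> w \<noteq> 0 \<Longrightarrow> w \<bullet> (gS x *v w) > 0"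
  obtains u v \<phi> :: "real^2 \<Rightarrow> real^2"
  where "\<And>i. smooth_on D (\<lambda>x. u x $ i)" "\<And>i. smooth_on D (\<lambda>x. v x $ i)" "\<And>i. smooth_on D (\<lambda>x. \<phi> x $ i)"
    and "smooth_on D (gauss_curvature gS)"
    and "\<And>x. x \<in> D \<Longrightarrow> gS x = outer (u x) (u x) + outer (v x) (v x)"
    and "\<And>x. x \<in> D \<Longrightarrow> u x $ 1 * v x $ 2 - v x $ 1 * u x $ 2 > 0"
    and "\<And>x. x \<in> D \<Longrightarrow> ext_d u x = wedge (\<phi> x) (v x)"
    and "\<And>x. x \<in> D \<Longrightarrow> ext_d v x = - wedge (\<phi> x) (u x)"
    and "\<And>x. x \<in> D \<Longrightarrow> ext_d \<phi> x = - gauss_curvature gS x *\<^sub>R wedge (u x) (v x)"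
proof -
  define E where "E x = gS x $ 1 $ 1" for x
  define F where "F x = gS x $ 1 $ 2" for x
  define H where "H x = gS x $ 2 $ 2" for x
  define d where "d x = E x * H x - F x * F x" for x
  have F': "gS x $ 2 $ 1 = F x" if "x \<in> D" for x
    using sym[OF that] by (simp add: transpose_def vec_eq_iff F_def)
  have E_pos: "E x > 0" if "x \<in> D" for x
    using pos[OF that, of "axis 1 1"]
    by (simp add: axis_eq_0_iff) (simp add: E_def inner_vec_def matrix_vector_mult_def sum_2 axis_def)
  have d_pos: "d x > 0" if x: "x \<in> D" for x
  proof -
    \<comment> \<open>The metric takes the value \<open>E * d\<close> on this vector, which is orthogonal to the first axis.\<close>
    have "vector [- F x, E x] \<noteq> (0 :: real^2)"
      using E_pos[OF x] by (metis vector_2(2) zero_index less_irrefl)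
    from pos[OF x this] have "E x * d x > 0"
      by (simp add: inner_vec_def matrix_vector_mult_def sum_2 F'[OF x] d_def algebra_simps flip: E_def F_def H_def)
    then show ?thesis using E_pos[OF x] by (simp add: zero_less_mult_iff)
  qed
  define s where "s x = sqrt (d x)" for x
  have s_pos: "s x > 0" if "x \<in> D" for x using d_pos[OF that] by (simp add: s_def)
  define u :: "real^2 \<Rightarrow> real^2" where "u x = vector [sqrt (E x), F x / sqrt (E x)]" for x
  define v :: "real^2 \<Rightarrow> real^2" where "v x = vector [0, s x / sqrt (E x)]" for x
  have sE: "sqrt (E x) > 0" "sqrt (E x) * sqrt (E x) = E x" if "x \<in> D" for x using E_pos[OF that] by auto
  have uv: "u x $ 1 * v x $ 2 - v x $ 1 * u x $ 2 = s x" if "x \<in> D" for x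
    using sE[OF that] by (simp add: u_def v_def)
  have sm: "smooth_on D E" "smooth_on D F" "smooth_on D H"
    unfolding E_def F_def H_def by (intro smooth_component[OF D] gS)+
  have sms: "smooth_on D d" "smooth_on D s" "smooth_on D (\<lambda>x. sqrt (E x))"
  proof -
    show d: "smooth_on D d" unfolding d_def by (intro smooth_diff[OF D] smooth_mult[OF D] sm)
    show "smooth_on D s" unfolding s_def by (intro smooth_sqrt[OF D] d d_pos)
    show "smooth_on D (\<lambda>x. sqrt (E x))" by (intro smooth_sqrt[OF D] sm E_pos)
  qed
  have smu: "smooth_on D (\<lambda>x. u x $ i)" and smv: "smooth_on D (\<lambda>x. v x $ i)" for i
  proof -
    have 2: "smooth_on D (\<lambda>x. F x / sqrt (E x))" "smooth_on D (\<lambda>x. s x / sqrt (E x))"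
      using smooth_divide[OF D sm(2) sms(3) sE(1)] smooth_divide[OF D sms(2) sms(3) sE(1)] by auto
    have i: "i = 1 \<or> i = 2" using exhaust_2 by auto
    show "smooth_on D (\<lambda>x. u x $ i)" using i 2 sms by (auto simp: u_def)
    show "smooth_on D (\<lambda>x. v x $ i)" using i 2 smooth_const[OF D, of 0] by (auto simp: v_def)
  qed
  define p where "p x = ext_d u x $ 1 $ 2 / s x" for x
  define q where "q x = ext_d v x $ 1 $ 2 / s x" for x
  define \<phi> where "\<phi> x = p x *\<^sub>R u x + q x *\<^sub>R v x" for x
  have smpq: "smooth_on D p" "smooth_on D q"
    unfolding p_def q_def by (intro smooth_divide[OF D] smooth_on_ext_d[OF D] smu smv sms s_pos; simp)+
  have sm\<phi>: "smooth_on D (\<lambda>x. \<phi> x $ i)" for i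
    unfolding \<phi>_def by simp (intro smooth_add[OF D] smooth_mult[OF D] smpq smu smv)
  have gS_eq: "gS x = outer (u x) (u x) + outer (v x) (v x)" if x: "x \<in> D" for x
  proof -
    have "s x * s x = E x * H x - F x * F x" using d_pos[OF x] by (simp add: s_def flip: d_def)
    then show ?thesis using sE[OF x]
      by (simp add: vec_eq_iff forall_2 outer_def u_def v_def F'[OF x] E_pos[OF x] flip: E_def F_def H_def)
         (use E_pos[OF x] in \<open>auto simp: field_simps\<close>)
  qed
  have wedge_skew: "wedge a b $ j $ i = - wedge a b $ i $ j" for a b :: "real^2" and i j
    by (simp add: wedge_component)
  have du: "ext_d u x = wedge (\<phi> x) (v x)" if x: "x \<in> D" for x
  proof (rule two_form_eq)
    have "wedge (\<phi> x) (v x) $ 1 $ 2 = p x * s x"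
      unfolding uv[OF x, symmetric] by (simp add: wedge_component \<phi>_def algebra_simps)
    then show "ext_d u x $ 1 $ 2 = wedge (\<phi> x) (v x) $ 1 $ 2" using s_pos[OF x] by (simp add: p_def)
  qed (rule ext_d_skew wedge_skew)+
  have dv: "ext_d v x = - wedge (\<phi> x) (u x)" if x: "x \<in> D" for x
  proof (rule two_form_eq)
    have "(- wedge (\<phi> x) (u x)) $ 1 $ 2 = q x * s x"
      unfolding uv[OF x, symmetric] by (simp add: wedge_component \<phi>_def algebra_simps)
    then show "ext_d v x $ 1 $ 2 = (- wedge (\<phi> x) (u x)) $ 1 $ 2" using s_pos[OF x] by (simp add: q_def)
  qed (simp_all add: wedge_component ext_d_def)
  define \<theta> :: "real^2 \<Rightarrow> real^2^2" where "\<theta> x = vector [u x, v x]" for x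
  define B :: "real^2 \<Rightarrow> real^2^2" where
    "B x = vector [vector [v x $ 2 / s x, - u x $ 2 / s x], vector [- v x $ 1 / s x, u x $ 1 / s x]]" for x
  define \<omega> :: "real^2 \<Rightarrow> real^2^2^2" where "\<omega> x = vector [vector [0, - \<phi> x], vector [\<phi> x, 0]]" for x
  have smD: "\<And>f x. smooth_on D f \<Longrightarrow> x \<in> D \<Longrightarrow> f differentiable (at x)"
    using smooth_differentiable[OF D] .
  interpret cartan_coframe D gS \<theta> B \<omega>
  proof
    fix x assume x: "x \<in> D"
    show "B x ** \<theta> x = mat 1"
      using uv[OF x] s_pos[OF x]
      by (simp add: vec_eq_iff forall_2 matrix_matrix_mult_def sum_2 B_def \<theta>_def mat_def field_simps)
    show "gS x = transpose (\<theta> x) ** \<theta> x"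
      by (simp add: gS_eq[OF x] vec_eq_iff forall_2 matrix_matrix_mult_def sum_2 transpose_def \<theta>_def outer_def)
    show "(\<lambda>y. \<theta> y $ a $ i) differentiable (at x)" for a i
      using exhaust_2[of a] smD[OF smu x] smD[OF smv x] by (auto simp: \<theta>_def)
    show "\<omega> x $ c $ a = - \<omega> x $ a $ c" for a c
      using exhaust_2[of a] exhaust_2[of c] by (auto simp: \<omega>_def)
    show "ext_d (\<lambda>y. \<theta> y $ a) x = - (\<Sum>c\<in>UNIV. wedge (\<omega> x $ a $ c) (\<theta> x $ c))" for a
      using exhaust_2[of a] du[OF x] dv[OF x]
      by (auto simp: \<theta>_def \<omega>_def sum_2 vec_eq_iff wedge_component)
  qed (rule D)
  have k: "ext_d \<phi> x = - gauss_curvature gS x *\<^sub>R wedge (u x) (v x)" if x: "x \<in> D" for x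
  proof (rule two_form_eq)
    have rc: "(\<Sum>e\<in>UNIV. \<theta> x $ a $ e * riem gS x 1 2 1 e) = - (\<Sum>f\<in>UNIV. curvature_form \<omega> x a f $ 1 $ 2 * \<theta> x $ f $ 1)" for a
    proof (rule riem_coframe[OF x])
      show "(\<lambda>y. B y $ k $ a) differentiable (at x)" for k a
        using exhaust_2[of k] exhaust_2[of a] s_pos[OF x]
          smD[OF smu x] smD[OF smv x] smD[OF sms(2) x] by (auto simp: B_def)
      show "pd m (\<lambda>y. \<theta> y $ a $ i) differentiable (at x)" for m a i
        using exhaust_2[of a] smD[OF smooth_pd[OF D smu] x] smD[OF smooth_pd[OF D smv] x] by (auto simp: \<theta>_def)
      show "(\<lambda>y. \<omega> y $ a $ c $ m) differentiable (at x)" for a c m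
        using exhaust_2[of a] exhaust_2[of c] smD[OF sm\<phi> x] by (auto simp: \<omega>_def)
    qed
    have cf: "curvature_form \<omega> x 1 1 $ 1 $ 2 = 0" "curvature_form \<omega> x 2 2 $ 1 $ 2 = 0"
      "curvature_form \<omega> x 2 1 $ 1 $ 2 = ext_d \<phi> x $ 1 $ 2" "curvature_form \<omega> x 1 2 $ 1 $ 2 = - ext_d \<phi> x $ 1 $ 2"
      using smD[OF sm\<phi> x]
      by (simp_all add: curvature_form_def \<omega>_def sum_2 wedge_component ext_d_def pd_minus)
    have "rm gS x 1 2 1 2 = (\<Sum>a\<in>UNIV. \<theta> x $ a $ 2 * (\<Sum>e\<in>UNIV. \<theta> x $ a $ e * riem gS x 1 2 1 e))"
      unfolding rm_def metric_component[OF x] sum_distrib_left sum_distrib_right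
      by (subst sum.swap) (simp add: ac_simps)
    also have "\<dots> = - ext_d \<phi> x $ 1 $ 2 * s x"
      unfolding rc sum_2 cf uv[OF x, symmetric] by (simp add: \<theta>_def algebra_simps)
    finally have "rm gS x 1 2 1 2 = - ext_d \<phi> x $ 1 $ 2 * s x" .
    moreover have "det (gS x) = s x * s x"
      using d_pos[OF x] by (simp add: det_2 s_def d_def F'[OF x] flip: E_def F_def H_def)
    ultimately have "gauss_curvature gS x * s x = - ext_d \<phi> x $ 1 $ 2"
      using s_pos[OF x] by (simp add: gauss_curvature_def)
    then show "ext_d \<phi> x $ 1 $ 2 = (- gauss_curvature gS x *\<^sub>R wedge (u x) (v x)) $ 1 $ 2"
      using uv[OF x] by (simp add: wedge_component)
  qed (simp_all add: wedge_component ext_d_def algebra_simps)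
  have "smooth_on D (gauss_curvature gS)"
  proof (rule smooth_cong[OF D])
    show "smooth_on D (\<lambda>x. ((-1) * ext_d \<phi> x $ 1 $ 2) / s x)"
      by (intro smooth_divide[OF D] smooth_mult[OF D] smooth_const[OF D] smooth_on_ext_d[OF D] sm\<phi> sms s_pos)
    fix x assume x: "x \<in> D"
    show "(-1) * ext_d \<phi> x $ 1 $ 2 / s x = gauss_curvature gS x"
      unfolding k[OF x] using uv[OF x] s_pos[OF x] by (simp add: wedge_component)
  qed
  then show ?thesis
    using that[of u v \<phi>] smu smv sm\<phi> gS_eq du dv k uv s_pos by auto
qed

section \<open>Pullbacks from the base\<close>

lemma vector_4 [simp]:
  "(vector [a, b, c, d] :: 'a::zero^4) $ 1 = a" "(vector [a, b, c, d] :: 'a^4) $ 2 = b"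
  "(vector [a, b, c, d] :: 'a^4) $ 3 = c" "(vector [a, b, c, d] :: 'a^4) $ 4 = d"
  unfolding vector_def by simp_all

lemma base_linear: "bounded_linear base"
  unfolding linear_conv_bounded_linear[symmetric]
  by (rule linearI) (simp_all add: base_def vec_eq_iff forall_2)

lemma matrix_base: "matrix base $ i $ j = (if i = 1 \<and> j = 1 \<or> i = 2 \<and> j = 2 then 1 else 0)"
  using exhaust_2[of i] by (auto simp: matrix_def base_def axis_def)

lemma pull1_eq: "pull1 w = vector [w $ 1, w $ 2, 0, 0]"
  by (simp add: pull1_def vec_eq_iff forall_4 matrix_vector_mult_def transpose_def sum_2 matrix_base)

lemma pull2_component:
  "pull2 b $ i $ j = (if (i = 1 \<or> i = 2) \<and> (j = 1 \<or> j = 2)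
     then b $ (if i = 1 then 1 else 2) $ (if j = 1 then 1 else 2) else 0)"
  using exhaust_4[of i] exhaust_4[of j]
  by (auto simp: pull2_def matrix_matrix_mult_def transpose_def sum_2 matrix_base)

lemma pull2_wedge: "pull2 (wedge a b) = wedge (pull1 a) (pull1 b)"
  by (simp add: vec_eq_iff forall_4 pull2_component wedge_component pull1_eq)

lemma pd_base:
  fixes f :: "real^2 \<Rightarrow> real"
  assumes "f differentiable (at (base x))"
  shows "pd i (\<lambda>y. f (base y)) x = (if i = 1 then pd 1 f (base x) else if i = 2 then pd 2 f (base x) else 0)"
proof -
  have "((\<lambda>y. f (base y)) has_derivative (\<lambda>h. \<Sum>i\<in>UNIV. base h $ i * pd i f (base x))) (at x)"
    by (rule has_derivative_compose[OF bounded_linear_imp_has_derivative[OF base_linear] has_derivative_pd[OF assms]])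
  from pd_eq[OF this, of i] show ?thesis
    using exhaust_4[of i] by (auto simp: base_def sum_2 axis_def)
qed

lemma differentiable_base:
  fixes f :: "real^2 \<Rightarrow> real"
  assumes "f differentiable (at (base x))"
  shows "(\<lambda>y. f (base y)) differentiable (at x)"
  using has_derivative_compose[OF bounded_linear_imp_has_derivative[OF base_linear] has_derivative_pd[OF assms]]
  unfolding differentiable_def by blast

lemma ext_d_pull1:
  assumes "\<And>i. (\<lambda>y. w y $ i) differentiable (at (base x))"
  shows "ext_d (\<lambda>y. pull1 (w (base y))) x = pull2 (ext_d w (base x))"
  by (simp add: vec_eq_iff forall_4 ext_d_def pull2_component pull1_eq pd_base[OF assms])

section \<open>The Calabi coframe\<close>

lemma ext_d_add:
  assumes "\<And>i. (\<lambda>y. v y $ i) differentiable (at x)" "\<And>i. (\<lambda>y. w y $ i) differentiable (at x)"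
  shows "ext_d (\<lambda>y. v y + w y) x = ext_d v x + ext_d w x"
  by (simp add: vec_eq_iff ext_d_def pd_add assms)

lemma ext_d_minus:
  assumes "\<And>i. (\<lambda>y. w y $ i) differentiable (at x)"
  shows "ext_d (\<lambda>y. - w y) x = - ext_d w x"
  by (simp add: vec_eq_iff ext_d_def pd_minus assms)

lemma ext_d_const [simp]: "ext_d (\<lambda>y. w) x = 0"
  by (simp add: vec_eq_iff ext_d_def)

lemma coordinate_function_differentiable:
  "(f has_real_derivative f') (at (x $ i)) \<Longrightarrow> (\<lambda>y. f (y $ i)) differentiable (at x)"
  by (erule differentiable_chain) (intro differentiable_component differentiable_ident)

lemma pd_coordinate_function:
  "(f has_real_derivative f') (at (x $ i)) \<Longrightarrow> pd j (\<lambda>y. f (y $ i)) x = (if j = i then f' else 0)"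
  by (subst pd_chain[of f f' "\<lambda>y. y $ i"]) (auto intro: differentiable_component differentiable_ident)

lemma ext_d_scale:
  fixes w :: "real^4 \<Rightarrow> real^4"
  assumes f: "(f has_real_derivative f') (at (x $ 3))" and w: "\<And>i. (\<lambda>y. w y $ i) differentiable (at x)"
  shows "ext_d (\<lambda>y. f (y $ 3) *\<^sub>R w y) x = f' *\<^sub>R wedge (axis 3 1) (w x) + f (x $ 3) *\<^sub>R ext_d w x"
  using pd_mult[OF coordinate_function_differentiable[OF f] w] pd_coordinate_function[OF f]
  by (auto simp: vec_eq_iff ext_d_def wedge_component algebra_simps axis_def)

text \<open>The frame components of the two-form \<open>e\<^sub>p \<and> e\<^sub>q\<close>.\<close>

definition eps :: "4 \<Rightarrow> 4 \<Rightarrow> 4 \<Rightarrow> 4 \<Rightarrow> real" where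
  "eps p q i j = (if i = p \<and> j = q then 1 else 0) - (if i = q \<and> j = p then 1 else 0)"

lemma coord2_eps: "coord2 \<theta> (eps p q) i j = wedge (\<theta> $ p) (\<theta> $ q) $ i $ j"
proof -
  have "(\<Sum>a\<in>UNIV. \<theta> $ a $ i * (\<Sum>b\<in>UNIV. \<theta> $ b $ j * (if a = p \<and> b = q then 1 else 0))) = \<theta> $ p $ i * \<theta> $ q $ j" for p q
  proof -
    have "(\<Sum>b\<in>UNIV. \<theta> $ b $ j * (if a = p \<and> b = q then 1 else 0)) = (if a = p then \<theta> $ q $ j else 0)" for a
      by (cases "a = p") (auto simp: if_distrib cong: if_cong)
    then show ?thesis by (simp only:) (simp add: if_distrib cong: if_cong)
  qed
  then show ?thesis
    by (simp add: coord2_def coord1_def eps_def right_diff_distrib sum_subtractf wedge_component mult.commute)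
qed

text \<open>The frame components of the curvature tensor of every metric of the Calabi form. The
  symmetries of the ansatz leave five independent components: the sectional curvatures are \<open>A\<close> on
  the horizontal plane \<open>12\<close>, \<open>- E\<close> on the vertical plane \<open>34\<close>, \<open>- C\<close> on the planes containing
  \<open>3\<close> and \<open>- D\<close> on those containing \<open>4\<close>; and \<open>B\<close>, with a factor forced by the Bianchi identity,
  couples complementary planes.\<close>

definition calabi_curvature :: "real \<Rightarrow> real \<Rightarrow> real \<Rightarrow> real \<Rightarrow> real \<Rightarrow> 4 \<Rightarrow> 4 \<Rightarrow> 4 \<Rightarrow> 4 \<Rightarrow> real" where
  "calabi_curvature A B C D E i j k l =
     (A * eps 1 2 i j - 2 * B * eps 3 4 i j) * eps 1 2 k l - (E * eps 3 4 i j + 2 * B * eps 1 2 i j) * eps 3 4 k l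
     - (C * eps 1 3 i j + B * eps 2 4 i j) * eps 1 3 k l - (D * eps 2 4 i j + B * eps 1 3 i j) * eps 2 4 k l
     - (C * eps 2 3 i j - B * eps 1 4 i j) * eps 2 3 k l - (D * eps 1 4 i j - B * eps 2 3 i j) * eps 1 4 k l"

lemma eps_skew: "eps p q j i = - eps p q i j"
  unfolding eps_def by (simp add: conj_commute)

lemma calabi_curvature_skew: "calabi_curvature A B C D E i j l k = - calabi_curvature A B C D E i j k l"
  by (simp add: calabi_curvature_def eps_skew[of _ _ l k])

lemma calabi_curvature_pairs:
  "calabi_curvature A B C D E i j 1 2 = A * eps 1 2 i j - 2 * B * eps 3 4 i j"
  "calabi_curvature A B C D E i j 3 4 = - (E * eps 3 4 i j + 2 * B * eps 1 2 i j)"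
  "calabi_curvature A B C D E i j 1 3 = - (C * eps 1 3 i j + B * eps 2 4 i j)"
  "calabi_curvature A B C D E i j 2 4 = - (D * eps 2 4 i j + B * eps 1 3 i j)"
  "calabi_curvature A B C D E i j 2 3 = - (C * eps 2 3 i j - B * eps 1 4 i j)"
  "calabi_curvature A B C D E i j 1 4 = - (D * eps 1 4 i j - B * eps 2 3 i j)"
  by (simp_all add: calabi_curvature_def eps_def[of _ _ 1 2] eps_def[of _ _ 3 4] eps_def[of _ _ 1 3]
     eps_def[of _ _ 2 4] eps_def[of _ _ 2 3] eps_def[of _ _ 1 4])

definition base_metric :: "(real^2 \<Rightarrow> real^2) \<Rightarrow> (real^2 \<Rightarrow> real^2) \<Rightarrow> real^4 \<Rightarrow> real^4^4" where
  "base_metric u v x = outer (pull1 (u (base x))) (pull1 (u (base x))) + outer (pull1 (v (base x))) (pull1 (v (base x)))"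

definition contact_form :: "(real^2 \<Rightarrow> real^2) \<Rightarrow> real^4 \<Rightarrow> real^4" where
  "contact_form \<alpha> x = axis 4 1 + pull1 (\<alpha> (base x))"

text \<open>\<open>D\<close> is a coordinate domain of the surface with oriented orthonormal coframe \<open>u, v\<close>, connection
  form \<open>\<phi>\<close> and Gauss curvature \<open>k\<close>; \<open>N\<close> is a domain of the total space, whose coordinates are the
  two of the base, the momentum \<open>z\<close> and the fibre parameter \<open>t\<close>.\<close>

locale calabi_base =
  fixes D :: "(real^2) set" and N :: "(real^4) set" and u v \<phi> \<alpha> :: "real^2 \<Rightarrow> real^2" and k :: "real^2 \<Rightarrow> real"
  assumes open_D: "open D" and open_N: "open N" and base_N: "x \<in> N \<Longrightarrow> base x \<in> D"
    and smooth: "smooth_on D (\<lambda>y. u y $ i)" "smooth_on D (\<lambda>y. v y $ i)"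
      "smooth_on D (\<lambda>y. \<phi> y $ i)" "smooth_on D (\<lambda>y. \<alpha> y $ i)"
    and area: "y \<in> D \<Longrightarrow> u y $ 1 * v y $ 2 - v y $ 1 * u y $ 2 > 0"
    and du: "y \<in> D \<Longrightarrow> ext_d u y = wedge (\<phi> y) (v y)"
    and dv: "y \<in> D \<Longrightarrow> ext_d v y = - wedge (\<phi> y) (u y)"
    and d\<phi>: "y \<in> D \<Longrightarrow> ext_d \<phi> y = - k y *\<^sub>R wedge (u y) (v y)"
    and d\<alpha>: "y \<in> D \<Longrightarrow> ext_d \<alpha> y = wedge (u y) (v y)"

text \<open>The general metric of this shape is
  \<open>r\<^sup>2 g\<^sub>\<Sigma> + dz\<^sup>2 / n\<^sup>2 + l\<^sup>2 (dt + \<alpha>)\<^sup>2\<close> with \<open>r, n, l\<close> functions of \<open>z\<close>. Leaving the three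
  functions free lets a single computation of the curvature serve both the Kaehler metric and its
  conformal companion. The parameters \<open>a\<close> and \<open>c\<close> are the logarithmic derivatives of \<open>r\<close> and \<open>l\<close>
  along the unit vector field dual to \<open>dz / n\<close>, and \<open>a'\<close>, \<open>c'\<close> are their derivatives along it.\<close>

locale calabi_coframe = calabi_base D N u v \<phi> \<alpha> k
  for D :: "(real^2) set" and N :: "(real^4) set" and u v \<phi> \<alpha> :: "real^2 \<Rightarrow> real^2" and k :: "real^2 \<Rightarrow> real" +
  fixes r n l a c n' a' c' :: "real \<Rightarrow> real" and G :: "real^4 \<Rightarrow> real^4^4"
  assumes r_pos: "x \<in> N \<Longrightarrow> r (x $ 3) > 0" and n_pos: "x \<in> N \<Longrightarrow> n (x $ 3) > 0" and l_pos: "x \<in> N \<Longrightarrow> l (x $ 3) > 0"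
    and dr: "x \<in> N \<Longrightarrow> (r has_real_derivative a (x $ 3) * r (x $ 3) / n (x $ 3)) (at (x $ 3))"
    and dl: "x \<in> N \<Longrightarrow> (l has_real_derivative c (x $ 3) * l (x $ 3) / n (x $ 3)) (at (x $ 3))"
    and dn: "x \<in> N \<Longrightarrow> (n has_real_derivative n' (x $ 3)) (at (x $ 3))"
    and dn': "x \<in> N \<Longrightarrow> n' differentiable (at (x $ 3))"
    and da: "x \<in> N \<Longrightarrow> (a has_real_derivative a' (x $ 3) / n (x $ 3)) (at (x $ 3))"
    and dc: "x \<in> N \<Longrightarrow> (c has_real_derivative c' (x $ 3) / n (x $ 3)) (at (x $ 3))"
    and metric_form: "x \<in> N \<Longrightarrow> G x = (r (x $ 3))\<^sup>2 *\<^sub>R base_metric u v x + (1 / n (x $ 3))\<^sup>2 *\<^sub>R outer (axis 3 1) (axis 3 1)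
        + (l (x $ 3))\<^sup>2 *\<^sub>R outer (contact_form \<alpha> x) (contact_form \<alpha> x)"
begin

text \<open>From \<open>d (dt + \<alpha>) = u \<and> v\<close>, the last coframe element satisfies
  \<open>d e\<^sub>4 = c e\<^sub>3 \<and> e\<^sub>4 + 2 b e\<^sub>1 \<and> e\<^sub>2\<close> for this \<open>b\<close>: it measures the twisting of the horizontal
  distribution.\<close>

definition b :: "real \<Rightarrow> real" where "b z = l z / (2 * (r z)\<^sup>2)"

lemma db: "x \<in> N \<Longrightarrow> (b has_real_derivative b (x $ 3) * (c (x $ 3) - 2 * a (x $ 3)) / n (x $ 3)) (at (x $ 3))"
  unfolding b_def
  by (rule derivative_eq_intros dl dr refl | assumption | use r_pos[of x] n_pos[of x] in force)+
     (use r_pos[of x] n_pos[of x] in \<open>simp add: field_simps power2_eq_square\<close>)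

definition e1 :: "real^4 \<Rightarrow> real^4" where "e1 x = r (x $ 3) *\<^sub>R pull1 (u (base x))"
definition e2 :: "real^4 \<Rightarrow> real^4" where "e2 x = r (x $ 3) *\<^sub>R pull1 (v (base x))"
definition e3 :: "real^4 \<Rightarrow> real^4" where "e3 x = (1 / n (x $ 3)) *\<^sub>R axis 3 1"
definition e4 :: "real^4 \<Rightarrow> real^4" where "e4 x = l (x $ 3) *\<^sub>R (axis 4 1 + pull1 (\<alpha> (base x)))"
definition \<Phi> :: "real^4 \<Rightarrow> real^4" where "\<Phi> x = pull1 (\<phi> (base x))"

definition \<theta> :: "real^4 \<Rightarrow> real^4^4" where "\<theta> x = vector [e1 x, e2 x, e3 x, e4 x]"

definition rot :: "real^4 \<Rightarrow> real^4" where "rot x = \<Phi> x + b (x $ 3) *\<^sub>R e4 x"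

definition \<omega> :: "real^4 \<Rightarrow> real^4^4^4" where
  "\<omega> x = vector [
    vector [0, - rot x, a (x $ 3) *\<^sub>R e1 x, - (b (x $ 3) *\<^sub>R e2 x)],
    vector [rot x, 0, a (x $ 3) *\<^sub>R e2 x, b (x $ 3) *\<^sub>R e1 x],
    vector [- (a (x $ 3) *\<^sub>R e1 x), - (a (x $ 3) *\<^sub>R e2 x), 0, - (c (x $ 3) *\<^sub>R e4 x)],
    vector [b (x $ 3) *\<^sub>R e2 x, - (b (x $ 3) *\<^sub>R e1 x), c (x $ 3) *\<^sub>R e4 x, 0]]"

definition B :: "real^4 \<Rightarrow> real^4^4" where
  "B x = (let y = base x; s = (u y $ 1 * v y $ 2 - v y $ 1 * u y $ 2) * r (x $ 3) in vector [
     vector [v y $ 2 / s, - u y $ 2 / s, 0, 0],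
     vector [- v y $ 1 / s, u y $ 1 / s, 0, 0],
     vector [0, 0, n (x $ 3), 0],
     vector [(\<alpha> y $ 2 * v y $ 1 - \<alpha> y $ 1 * v y $ 2) / s, (\<alpha> y $ 1 * u y $ 2 - \<alpha> y $ 2 * u y $ 1) / s, 0, 1 / l (x $ 3)]])"

lemma smD: "smooth_on D f \<Longrightarrow> x \<in> N \<Longrightarrow> (\<lambda>y. f (base y) :: real) differentiable (at x)"
  using differentiable_base smooth_differentiable[OF open_D] base_N by blast

lemma smooth_pull1: "(\<And>i. smooth_on D (\<lambda>y. w y $ i)) \<Longrightarrow> smooth_on D (\<lambda>y. pull1 (w y) $ i)"
  using exhaust_4[of i] by (auto simp: pull1_eq smooth_const[OF open_D])

lemma dinv_n: "x \<in> N \<Longrightarrow> ((\<lambda>z. 1 / n z) has_real_derivative - n' (x $ 3) / (n (x $ 3))\<^sup>2) (at (x $ 3))"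
  by (rule derivative_eq_intros dn refl | assumption | use n_pos[of x] in force)+
     (simp add: power2_eq_square)

lemmas z_differentiable = coordinate_function_differentiable[OF dr] coordinate_function_differentiable[OF dl]
  coordinate_function_differentiable[OF dn] coordinate_function_differentiable[OF da]
  coordinate_function_differentiable[OF dc] coordinate_function_differentiable[OF db]
  coordinate_function_differentiable[OF dinv_n]

lemma pull1_differentiable:
  assumes "x \<in> N" "\<And>i. smooth_on D (\<lambda>y. w y $ i)"
  shows "(\<lambda>y. pull1 (w (base y)) $ i) differentiable (at x)"
  using smD[OF smooth_pull1[OF assms(2)] assms(1)] .

lemma e_differentiable:
  assumes x: "x \<in> N"
  shows "(\<lambda>y. e1 y $ i) differentiable (at x)" "(\<lambda>y. e2 y $ i) differentiable (at x)"
    "(\<lambda>y. e3 y $ i) differentiable (at x)" "(\<lambda>y. e4 y $ i) differentiable (at x)"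
    "(\<lambda>y. \<Phi> y $ i) differentiable (at x)" "(\<lambda>y. rot y $ i) differentiable (at x)"
proof -
  note d = z_differentiable[OF x] pull1_differentiable[OF x smooth(1)] pull1_differentiable[OF x smooth(2)]
    pull1_differentiable[OF x smooth(3)] pull1_differentiable[OF x smooth(4)]
  show "(\<lambda>y. e1 y $ i) differentiable (at x)" "(\<lambda>y. e2 y $ i) differentiable (at x)"
    "(\<lambda>y. \<Phi> y $ i) differentiable (at x)"
    unfolding e1_def e2_def \<Phi>_def by (simp_all add: d)
  show "(\<lambda>y. e3 y $ i) differentiable (at x)"
    unfolding e3_def vector_scaleR_component real_scaleR_def
    by (intro differentiable_mult d differentiable_const)
  show "(\<lambda>y. e4 y $ i) differentiable (at x)" 
    unfolding e4_def by (simp add: d)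
  show "(\<lambda>y. rot y $ i) differentiable (at x)" 
    unfolding e4_def rot_def \<Phi>_def by (simp add: d)
qed

lemma ext_d_scale_e3:
  assumes x: "x \<in> N" and f: "(f has_real_derivative f' / n (x $ 3)) (at (x $ 3))"
    and w: "\<And>i. (\<lambda>y. w y $ i) differentiable (at x)"
  shows "ext_d (\<lambda>y. f (y $ 3) *\<^sub>R w y) x = f' *\<^sub>R wedge (e3 x) (w x) + f (x $ 3) *\<^sub>R ext_d w x"
  unfolding ext_d_scale[OF f w]
  using n_pos[OF x] by (simp add: e3_def vec_eq_iff wedge_component algebra_simps)

lemma ext_d_e1: assumes x: "x \<in> N" shows "ext_d e1 x = a (x $ 3) *\<^sub>R wedge (e3 x) (e1 x) + wedge (\<Phi> x) (e2 x)"
proof -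
  have "ext_d e1 x = (a (x $ 3) * r (x $ 3)) *\<^sub>R wedge (e3 x) (pull1 (u (base x)))
      + r (x $ 3) *\<^sub>R pull2 (ext_d u (base x))"
    unfolding e1_def using ext_d_scale_e3[OF x dr[OF x] pull1_differentiable[OF x smooth(1)]]
    by (simp add: ext_d_pull1 smooth_differentiable[OF open_D smooth(1) base_N[OF x]])
  then show ?thesis unfolding du[OF base_N[OF x]] pull2_wedge
    by (simp add: e1_def e2_def \<Phi>_def vec_eq_iff wedge_component algebra_simps)
qed

lemma pull2_uminus: "pull2 (- w) = - pull2 w" and pull2_scaleR: "pull2 (t *\<^sub>R w) = t *\<^sub>R pull2 w"
  by (auto simp: vec_eq_iff pull2_component)

lemma ext_d_e2: assumes x: "x \<in> N" shows "ext_d e2 x = a (x $ 3) *\<^sub>R wedge (e3 x) (e2 x) - wedge (\<Phi> x) (e1 x)"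
proof -
  have "ext_d e2 x = (a (x $ 3) * r (x $ 3)) *\<^sub>R wedge (e3 x) (pull1 (v (base x)))
      + r (x $ 3) *\<^sub>R pull2 (ext_d v (base x))"
    unfolding e2_def using ext_d_scale_e3[OF x dr[OF x] pull1_differentiable[OF x smooth(2)]]
    by (simp add: ext_d_pull1 smooth_differentiable[OF open_D smooth(2) base_N[OF x]])
  then show ?thesis unfolding dv[OF base_N[OF x]] pull2_uminus pull2_wedge
    by (simp add: e1_def e2_def \<Phi>_def vec_eq_iff wedge_component algebra_simps)
qed

lemma ext_d_e3: assumes x: "x \<in> N" shows "ext_d e3 x = 0"
  unfolding e3_def using ext_d_scale[OF dinv_n[OF x], of "\<lambda>y. axis 3 1"]
  by (simp add: vec_eq_iff wedge_component axis_def)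

lemma wedge_e1_e2: "wedge (e1 x) (e2 x) = (r (x $ 3))\<^sup>2 *\<^sub>R wedge (pull1 (u (base x))) (pull1 (v (base x)))"
  by (simp add: vec_eq_iff wedge_component e1_def e2_def power2_eq_square algebra_simps)

lemma ext_d_e4: assumes x: "x \<in> N"
  shows "ext_d e4 x = c (x $ 3) *\<^sub>R wedge (e3 x) (e4 x) + (2 * b (x $ 3)) *\<^sub>R wedge (e1 x) (e2 x)"
proof -
  note p = pull1_differentiable[OF x smooth(4)]
  have "ext_d (\<lambda>y. axis 4 1 + pull1 (\<alpha> (base y))) x = pull2 (ext_d \<alpha> (base x))"
    using ext_d_add[of "\<lambda>y. axis 4 1" x, OF _ p]
    by (simp add: ext_d_pull1 smooth_differentiable[OF open_D smooth(4) base_N[OF x]])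
  then have "ext_d e4 x = (c (x $ 3) * l (x $ 3)) *\<^sub>R wedge (e3 x) (axis 4 1 + pull1 (\<alpha> (base x)))
      + l (x $ 3) *\<^sub>R pull2 (ext_d \<alpha> (base x))"
    unfolding e4_def using ext_d_scale_e3[OF x dl[OF x], of "\<lambda>y. axis 4 1 + pull1 (\<alpha> (base y))"] p
    by simp
  moreover have "l (x $ 3) = 2 * b (x $ 3) * (r (x $ 3))\<^sup>2" using r_pos[OF x] by (simp add: b_def)
  ultimately show ?thesis unfolding d\<alpha>[OF base_N[OF x]] pull2_wedge wedge_e1_e2
    by (simp add: e4_def vec_eq_iff wedge_component algebra_simps)
qed

lemma ext_d_\<Phi>: assumes x: "x \<in> N" shows "ext_d \<Phi> x = - (k (base x) / (r (x $ 3))\<^sup>2) *\<^sub>R wedge (e1 x) (e2 x)"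
proof -
  have "ext_d \<Phi> x = pull2 (ext_d \<phi> (base x))"
    unfolding \<Phi>_def by (simp add: ext_d_pull1 smooth_differentiable[OF open_D smooth(3) base_N[OF x]])
  then show ?thesis unfolding d\<phi>[OF base_N[OF x]] pull2_scaleR pull2_wedge wedge_e1_e2
    using r_pos[OF x] by simp
qed

lemma B_\<theta>: assumes x: "x \<in> N" shows "B x ** \<theta> x = mat 1"
proof -
  define s where "s = u (base x) $ 1 * v (base x) $ 2 - v (base x) $ 1 * u (base x) $ 2"
  have "s > 0" "r (x $ 3) > 0" "n (x $ 3) > 0" "l (x $ 3) > 0"
    using area[OF base_N[OF x]] r_pos[OF x] n_pos[OF x] l_pos[OF x] by (auto simp: s_def)
  then show ?thesis
    unfolding B_def Let_def s_def[symmetric]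
    by (simp add: vec_eq_iff forall_4 matrix_matrix_mult_def sum_4 \<theta>_def e1_def e2_def e3_def e4_def pull1_eq
       mat_def axis_def add_divide_distrib[symmetric] diff_divide_distrib[symmetric])
      (simp add: s_def algebra_simps divide_simps)
qed

sublocale cartan_coframe N G \<theta> B \<omega>
proof
  fix x assume x: "x \<in> N"
  show "B x ** \<theta> x = mat 1" by (rule B_\<theta>[OF x])
  show "G x = transpose (\<theta> x) ** \<theta> x"
    unfolding metric_form[OF x] base_metric_def contact_form_def
    by (simp add: vec_eq_iff matrix_matrix_mult_def transpose_def sum_4 \<theta>_def e1_def e2_def e3_def e4_def
        outer_def power2_eq_square algebra_simps)
  show "(\<lambda>y. \<theta> y $ p $ i) differentiable (at x)" for p i
    using exhaust_4[of p] e_differentiable[OF x] by (auto simp: \<theta>_def)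
  show "\<omega> x $ q $ p = - \<omega> x $ p $ q" for p q
    using exhaust_4[of p] exhaust_4[of q] by (auto simp: \<omega>_def)
  show "ext_d (\<lambda>y. \<theta> y $ p) x = - (\<Sum>q\<in>UNIV. wedge (\<omega> x $ p $ q) (\<theta> x $ q))" for p
    using exhaust_4[of p] ext_d_e1[OF x] ext_d_e2[OF x] ext_d_e3[OF x] ext_d_e4[OF x]
    by (auto simp: \<theta>_def \<omega>_def rot_def sum_4 vec_eq_iff wedge_component algebra_simps)
qed (rule open_N)

text \<open>The five components of the curvature in terms of the rates \<open>a, b, c\<close>.\<close>

definition K1 where "K1 x = k (base x) / (r (x $ 3))\<^sup>2 - (a (x $ 3))\<^sup>2 - 3 * (b (x $ 3))\<^sup>2" for x :: "real^4"
definition K2 where "K2 z = b z * (c z - a z)" for z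
definition K3 where "K3 z = a' z + (a z)\<^sup>2" for z
definition K4 where "K4 z = a z * c z - (b z)\<^sup>2" for z
definition K5 where "K5 z = c' z + (c z)\<^sup>2" for z

lemma curvature_form_skew:
  assumes x: "x \<in> N"
  shows "curvature_form \<omega> x q p = - curvature_form \<omega> x p q"
proof -
  have d: "(\<lambda>y. \<omega> y $ p $ q $ m) differentiable (at x)" for m
    using exhaust_4[of p] exhaust_4[of q] z_differentiable[OF x] e_differentiable[OF x] by (auto simp: \<omega>_def)
  have s: "\<omega> y $ q $ p = - \<omega> y $ p $ q" for p q y
    using exhaust_4[of p] exhaust_4[of q] by (auto simp: \<omega>_def)
  have "ext_d (\<lambda>y. \<omega> y $ q $ p) x = - ext_d (\<lambda>y. \<omega> y $ p $ q) x"
    unfolding s[of _ q p] by (rule ext_d_minus[OF d])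
  moreover have "wedge (\<omega> x $ q $ h) (\<omega> x $ h $ p) = - wedge (\<omega> x $ p $ h) (\<omega> x $ h $ q)" for h
    unfolding s[of _ q h] s[of _ h p] by (simp add: vec_eq_iff wedge_component)
  ultimately show ?thesis by (simp add: curvature_form_def sum_negf)
qed

text \<open>Each entry of \<open>d \<omega> + \<omega> \<and> \<omega>\<close> expands by the product rule and the derivatives of the
  coframe computed above. The base enters only through \<open>d \<phi>\<close>: the terms with the undifferentiated
  \<open>\<phi>\<close> cancel, since \<open>\<phi>\<close> is the gauge potential of rotations of \<open>e\<^sub>1, e\<^sub>2\<close>.\<close>

lemma curvature_forms:
  assumes x: "x \<in> N"
  shows "curvature_form \<omega> x 2 1 = - K1 x *\<^sub>R wedge (e1 x) (e2 x) + (2 * K2 (x $ 3)) *\<^sub>R wedge (e3 x) (e4 x)"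
    "curvature_form \<omega> x 4 3 = K5 (x $ 3) *\<^sub>R wedge (e3 x) (e4 x) + (2 * K2 (x $ 3)) *\<^sub>R wedge (e1 x) (e2 x)"
    "curvature_form \<omega> x 3 1 = K3 (x $ 3) *\<^sub>R wedge (e1 x) (e3 x) + K2 (x $ 3) *\<^sub>R wedge (e2 x) (e4 x)"
    "curvature_form \<omega> x 3 2 = K3 (x $ 3) *\<^sub>R wedge (e2 x) (e3 x) - K2 (x $ 3) *\<^sub>R wedge (e1 x) (e4 x)"
    "curvature_form \<omega> x 4 1 = K4 (x $ 3) *\<^sub>R wedge (e1 x) (e4 x) - K2 (x $ 3) *\<^sub>R wedge (e2 x) (e3 x)"
    "curvature_form \<omega> x 4 2 = K4 (x $ 3) *\<^sub>R wedge (e2 x) (e4 x) + K2 (x $ 3) *\<^sub>R wedge (e1 x) (e3 x)"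
proof -
  note d = z_differentiable[OF x] e_differentiable[OF x]
  note ed = ext_d_e1[OF x] ext_d_e2[OF x] ext_d_e4[OF x] ext_d_\<Phi>[OF x]
  note sc = ext_d_scale_e3[OF x da[OF x]] ext_d_scale_e3[OF x dc[OF x]] ext_d_scale_e3[OF x db[OF x]]
  have "ext_d (\<lambda>y. \<Phi> y + b (y $ 3) *\<^sub>R e4 y) x = ext_d \<Phi> x + ext_d (\<lambda>y. b (y $ 3) *\<^sub>R e4 y) x"
    by (rule ext_d_add) (simp_all add: d)
  then show "curvature_form \<omega> x 2 1 = - K1 x *\<^sub>R wedge (e1 x) (e2 x) + (2 * K2 (x $ 3)) *\<^sub>R wedge (e3 x) (e4 x)"
    by (simp add: curvature_form_def \<omega>_def rot_def sum_4 sc d ed K1_def K2_def vec_eq_iff wedge_component algebra_simps power2_eq_square)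
  show "curvature_form \<omega> x 4 3 = K5 (x $ 3) *\<^sub>R wedge (e3 x) (e4 x) + (2 * K2 (x $ 3)) *\<^sub>R wedge (e1 x) (e2 x)"
    by (simp add: curvature_form_def \<omega>_def rot_def sum_4 sc d ed K5_def K2_def vec_eq_iff wedge_component algebra_simps power2_eq_square)
  show "curvature_form \<omega> x 4 1 = K4 (x $ 3) *\<^sub>R wedge (e1 x) (e4 x) - K2 (x $ 3) *\<^sub>R wedge (e2 x) (e3 x)"
    by (simp add: curvature_form_def \<omega>_def rot_def sum_4 sc d ed K4_def K2_def vec_eq_iff wedge_component algebra_simps power2_eq_square)
  have m: "ext_d (\<lambda>y. - (f (y $ 3) *\<^sub>R w y)) x = - ext_d (\<lambda>y. f (y $ 3) *\<^sub>R w y) x"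
    if "\<And>i. (\<lambda>y. (f (y $ 3) *\<^sub>R w y) $ i) differentiable (at x)" for f w
    by (rule ext_d_minus[OF that])
  show "curvature_form \<omega> x 4 2 = K4 (x $ 3) *\<^sub>R wedge (e2 x) (e4 x) + K2 (x $ 3) *\<^sub>R wedge (e1 x) (e3 x)"
    by (simp add: curvature_form_def \<omega>_def rot_def sum_4 m sc d ed K4_def K2_def vec_eq_iff wedge_component algebra_simps power2_eq_square)
  show "curvature_form \<omega> x 3 1 = K3 (x $ 3) *\<^sub>R wedge (e1 x) (e3 x) + K2 (x $ 3) *\<^sub>R wedge (e2 x) (e4 x)"
    by (simp add: curvature_form_def \<omega>_def rot_def sum_4 m sc d ed K3_def K2_def vec_eq_iff wedge_component algebra_simps power2_eq_square)
  show "curvature_form \<omega> x 3 2 = K3 (x $ 3) *\<^sub>R wedge (e2 x) (e3 x) - K2 (x $ 3) *\<^sub>R wedge (e1 x) (e4 x)"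
    by (simp add: curvature_form_def \<omega>_def rot_def sum_4 m sc d ed K3_def K2_def vec_eq_iff wedge_component algebra_simps power2_eq_square)
qed

lemma pd_product_differentiable:
  assumes x: "x \<in> N" and f: "\<And>y. y \<in> N \<Longrightarrow> (f has_real_derivative f' (y $ 3)) (at (y $ 3))"
    and f': "f' differentiable (at (x $ 3))" and h: "smooth_on D h"
  shows "pd m (\<lambda>y. f (y $ 3) * h (base y)) differentiable (at x)"
proof (rule differentiable_cong_open[OF open_N x])
  define q where "q y = (if m = 1 then pd 1 h (base y) else if m = 2 then pd 2 h (base y) else 0)" for y :: "real^4"
  show "(if m = 3 then f' (y $ 3) else 0) * h (base y) + f (y $ 3) * q y = pd m (\<lambda>y. f (y $ 3) * h (base y)) y"
    if y: "y \<in> N" for y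
    using pd_mult[OF coordinate_function_differentiable[OF f[OF y]] smD[OF h y]]
    by (simp add: pd_coordinate_function[OF f[OF y]] pd_base[OF smooth_differentiable[OF open_D h base_N[OF y]]] q_def)
  obtain d where "(f' has_real_derivative d) (at (x $ 3))" using f' real_differentiable_def by blast
  then have 1: "(\<lambda>y. f' (y $ 3)) differentiable (at x)" by (rule coordinate_function_differentiable)
  have "q differentiable (at x)"
    unfolding q_def using smD[OF smooth_pd[OF open_D h] x] by (cases "m = 1"; cases "m = 2") auto
  then show "(\<lambda>y. (if m = 3 then f' (y $ 3) else 0) * h (base y) + f (y $ 3) * q y) differentiable (at x)"
    using 1 smD[OF h x] coordinate_function_differentiable[OF f[OF x]] by (cases "m = 3") auto
qed

lemma frame_differentiable:
  assumes x: "x \<in> N"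
  shows "(\<lambda>y. B y $ i $ p) differentiable (at x)"
proof -
  have uv: "\<And>i. (\<lambda>y. u (base y) $ i) differentiable (at x)" "\<And>i. (\<lambda>y. v (base y) $ i) differentiable (at x)"
    "\<And>i. (\<lambda>y. \<alpha> (base y) $ i) differentiable (at x)"
    using smD[OF smooth(1) x] smD[OF smooth(2) x] smD[OF smooth(4) x] by auto
  have ne: "u (base x) $ 1 * v (base x) $ 2 - v (base x) $ 1 * u (base x) $ 2 \<noteq> 0" "r (x $ 3) \<noteq> 0" "l (x $ 3) \<noteq> 0"
    using area[OF base_N[OF x]] r_pos[OF x] l_pos[OF x] by auto
  show ?thesis
    using exhaust_4[of i] exhaust_4[of p] ne z_differentiable[OF x] uv
    by (auto simp: B_def Let_def)
qed

lemma pd_coframe_differentiable: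
  assumes x: "x \<in> N"
  shows "pd m (\<lambda>y. \<theta> y $ p $ i) differentiable (at x)"
proof -
  have dd: "(\<lambda>z. a z * r z / n z) differentiable (at (x $ 3))" "(\<lambda>z. c z * l z / n z) differentiable (at (x $ 3))"
    "(\<lambda>z. - n' z / (n z)\<^sup>2) differentiable (at (x $ 3))"
  proof -
    have "r differentiable (at (x $ 3))" "l differentiable (at (x $ 3))" "n differentiable (at (x $ 3))"
      "a differentiable (at (x $ 3))" "c differentiable (at (x $ 3))"
      using dr[OF x] dl[OF x] dn[OF x] da[OF x] dc[OF x] unfolding real_differentiable_def by blast+
    then show "(\<lambda>z. a z * r z / n z) differentiable (at (x $ 3))"
      "(\<lambda>z. c z * l z / n z) differentiable (at (x $ 3))"
      "(\<lambda>z. - n' z / (n z)\<^sup>2) differentiable (at (x $ 3))"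
      using n_pos[OF x] dn'[OF x] by simp_all
  qed
  have c: "smooth_on D (\<lambda>y. axis j 1 $ i + pull1 (\<alpha> y) $ i)" "smooth_on D (\<lambda>y. axis j 1 $ i :: real)" for i j :: 4
    by (intro smooth_add[OF open_D] smooth_const[OF open_D] smooth_pull1 smooth)+
  have "pd m (\<lambda>y. r (y $ 3) * pull1 (u (base y)) $ i) differentiable (at x)"
    "pd m (\<lambda>y. r (y $ 3) * pull1 (v (base y)) $ i) differentiable (at x)"
    "pd m (\<lambda>y. 1 / n (y $ 3) * axis 3 1 $ i) differentiable (at x)"
    "pd m (\<lambda>y. l (y $ 3) * (axis 4 1 $ i + pull1 (\<alpha> (base y)) $ i)) differentiable (at x)"
    using pd_product_differentiable[OF x dr dd(1) smooth_pull1[OF smooth(1)]]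
      pd_product_differentiable[OF x dr dd(1) smooth_pull1[OF smooth(2)]]
      pd_product_differentiable[OF x dinv_n dd(3) c(2)]
      pd_product_differentiable[OF x dl dd(2) c(1)] by auto
  then show ?thesis
    using exhaust_4[of p] by (auto simp: \<theta>_def e1_def e2_def e3_def e4_def)
qed

lemma connection_differentiable:
  "x \<in> N \<Longrightarrow> (\<lambda>y. \<omega> y $ p $ q $ m) differentiable (at x)"
  using exhaust_4[of p] exhaust_4[of q] z_differentiable e_differentiable by (auto simp: \<omega>_def)

lemma curvature:
  assumes x: "x \<in> N"
  shows "rm G x i j p q = coord4 (\<theta> x)
    (calabi_curvature (K1 x) (K2 (x $ 3)) (K3 (x $ 3)) (K4 (x $ 3)) (K5 (x $ 3))) i j p q"
proof -
  let ?R = "calabi_curvature (K1 x) (K2 (x $ 3)) (K3 (x $ 3)) (K4 (x $ 3)) (K5 (x $ 3))"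
  define P where "P p q \<longleftrightarrow> (\<forall>i j. curvature_form \<omega> x p q $ i $ j = coord2 (\<theta> x) (\<lambda>e f. - ?R e f q p) i j)" for p q
  have \<theta>: "\<theta> x $ 1 = e1 x" "\<theta> x $ 2 = e2 x" "\<theta> x $ 3 = e3 x" "\<theta> x $ 4 = e4 x" by (simp_all add: \<theta>_def)
  have lin2: "coord2 (\<theta> x) (\<lambda>e f. s * S e f + t * T e f) i j = s * coord2 (\<theta> x) S i j + t * coord2 (\<theta> x) T i j"
    "coord2 (\<theta> x) (\<lambda>e f. s * S e f - t * T e f) i j = s * coord2 (\<theta> x) S i j - t * coord2 (\<theta> x) T i j"
    "coord2 (\<theta> x) (\<lambda>e f. - (s * S e f) - t * T e f) i j = - s * coord2 (\<theta> x) S i j - t * coord2 (\<theta> x) T i j"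
    for s t S T i j
    by (simp_all add: coord2_def coord_linear)
  have six: "P 2 1" "P 4 3" "P 3 1" "P 3 2" "P 4 1" "P 4 2"
    unfolding P_def calabi_curvature_pairs curvature_forms[OF x]
    by (simp_all add: lin2 coord2_eps \<theta>)
  have flip: "P q p" if "P p q" for p q
    using that unfolding P_def curvature_form_skew[OF x, of q p]
    by (simp add: calabi_curvature_skew[of _ _ _ _ _ _ _ p q] coord2_def coord_linear)
  have diag: "P p p" for p
    unfolding P_def using curvature_form_skew[OF x, of p p] calabi_curvature_skew[of _ _ _ _ _ _ _ p p]
    by (simp add: vec_eq_iff)
  have "P p q" for p q
    using exhaust_4[of p] exhaust_4[of q] six flip diag by metis
  then show ?thesis
    using rm_coord[OF x frame_differentiable[OF x] pd_coframe_differentiable[OF x] connection_differentiable[OF x],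
      of "\<lambda>p q e f. - ?R e f q p"] by (simp add: P_def)
qed

end

section \<open>Curvature tensors of a 4-manifold in an orthonormal coframe\<close>

lemma det_4:
  "det (A::'a::comm_ring_1^4^4) =
    A$1$1 * (A$2$2 * A$3$3 * A$4$4 + A$2$3 * A$3$4 * A$4$2 + A$2$4 * A$3$2 * A$4$3
       - A$2$2 * A$3$4 * A$4$3 - A$2$3 * A$3$2 * A$4$4 - A$2$4 * A$3$3 * A$4$2)
    - A$1$2 * (A$2$1 * A$3$3 * A$4$4 + A$2$3 * A$3$4 * A$4$1 + A$2$4 * A$3$1 * A$4$3
       - A$2$1 * A$3$4 * A$4$3 - A$2$3 * A$3$1 * A$4$4 - A$2$4 * A$3$3 * A$4$1)
    + A$1$3 * (A$2$1 * A$3$2 * A$4$4 + A$2$2 * A$3$4 * A$4$1 + A$2$4 * A$3$1 * A$4$2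
       - A$2$1 * A$3$4 * A$4$2 - A$2$2 * A$3$1 * A$4$4 - A$2$4 * A$3$2 * A$4$1)
    - A$1$4 * (A$2$1 * A$3$2 * A$4$3 + A$2$2 * A$3$3 * A$4$1 + A$2$3 * A$3$1 * A$4$2
       - A$2$1 * A$3$3 * A$4$2 - A$2$2 * A$3$1 * A$4$3 - A$2$3 * A$3$2 * A$4$1)"
proof -
  have f1: "finite {2::4, 3, 4}" "1 \<notin> {2::4, 3, 4}"
    and f2: "finite {3::4, 4}" "2 \<notin> {3::4, 4}"
    and f3: "finite {4::4}" "3 \<notin> {4::4}"
    by auto
  show ?thesis
    unfolding det_def UNIV_4
    unfolding sum_over_permutations_insert[OF f1]
    unfolding sum_over_permutations_insert[OF f2]
    unfolding sum_over_permutations_insert[OF f3]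
    unfolding permutes_sing
    by (simp add: sign_swap_id permutation_swap_id sign_compose sign_id swap_id_eq permutation_compose algebra_simps)
qed

definition kronecker :: "4 \<Rightarrow> 4 \<Rightarrow> real" where
  "kronecker a b = (if a = b then 1 else 0)"

definition levi_civita :: "4 \<Rightarrow> 4 \<Rightarrow> 4 \<Rightarrow> 4 \<Rightarrow> real" where
  "levi_civita a b c d = det (vector [axis a 1, axis b 1, axis c 1, axis d 1] :: real^4^4)"

definition frame_schouten :: "(4 \<Rightarrow> 4 \<Rightarrow> real) \<Rightarrow> 4 \<Rightarrow> 4 \<Rightarrow> real" where
  "frame_schouten r a b = r a b / 2 - (\<Sum>c\<in>UNIV. r c c) / 12 * kronecker a b"

definition frame_weyl :: "(4 \<Rightarrow> 4 \<Rightarrow> 4 \<Rightarrow> 4 \<Rightarrow> real) \<Rightarrow> (4 \<Rightarrow> 4 \<Rightarrow> real) \<Rightarrow> 4 \<Rightarrow> 4 \<Rightarrow> 4 \<Rightarrow> 4 \<Rightarrow> real" where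
  "frame_weyl R h a b c d = R a b c d - (h a c * kronecker b d + h b d * kronecker a c
     - h a d * kronecker b c - h b c * kronecker a d)"

definition frame_star :: "(4 \<Rightarrow> 4 \<Rightarrow> 4 \<Rightarrow> 4 \<Rightarrow> real) \<Rightarrow> 4 \<Rightarrow> 4 \<Rightarrow> 4 \<Rightarrow> 4 \<Rightarrow> real" where
  "frame_star W a b c d = (\<Sum>p\<in>UNIV. \<Sum>q\<in>UNIV. levi_civita a b p q * W p q c d) / 2"

lemma det_rows_linear:
  fixes w :: "real^4"
  shows "det (vector [w, x, y, z] :: real^4^4) = (\<Sum>a\<in>UNIV. w $ a * det (vector [axis a 1, x, y, z] :: real^4^4))"
    "det (vector [x, w, y, z] :: real^4^4) = (\<Sum>a\<in>UNIV. w $ a * det (vector [x, axis a 1, y, z] :: real^4^4))"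
    "det (vector [x, y, w, z] :: real^4^4) = (\<Sum>a\<in>UNIV. w $ a * det (vector [x, y, axis a 1, z] :: real^4^4))"
    "det (vector [x, y, z, w] :: real^4^4) = (\<Sum>a\<in>UNIV. w $ a * det (vector [x, y, z, axis a 1] :: real^4^4))"
  by (simp_all add: det_4 sum_4 axis_def algebra_simps)

text \<open>Changing the coframe multiplies the volume form by the determinant.\<close>

lemma coord4_levi_civita: "coord4 \<theta> levi_civita i j k l = levi_civita i j k l * det \<theta>"
proof -
  have c: "column i \<theta> $ a = \<theta> $ a $ i" for i a by (simp add: column_def)
  have ax: "(\<Sum>k\<in>UNIV. axis i 1 $ k * f k) = f i" for i and f :: "4 \<Rightarrow> real"
    by (simp add: axis_def if_distrib[of "\<lambda>x. x * _"] cong: if_cong)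
  have "(vector [axis i 1, axis j 1, axis k 1, axis l 1] :: real^4^4) ** transpose \<theta> =
      vector [column i \<theta>, column j \<theta>, column k \<theta>, column l \<theta>]"
    by (simp add: vec_eq_iff forall_4 matrix_matrix_mult_def transpose_def column_def ax)
  then have "levi_civita i j k l * det \<theta> = det (vector [column i \<theta>, column j \<theta>, column k \<theta>, column l \<theta>] :: real^4^4)"
    unfolding levi_civita_def by (metis det_mul det_transpose)
  also have "\<dots> = coord4 \<theta> levi_civita i j k l"
    unfolding det_rows_linear(1)[of "column i \<theta>"] unfolding det_rows_linear(2)[of _ "column j \<theta>"]
    unfolding det_rows_linear(3)[of _ _ "column k \<theta>"] unfolding det_rows_linear(4)[of _ _ _ "column l \<theta>"]
    by (simp add: c coord4_def coord3_def coord2_def coord1_def levi_civita_def)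
  finally show ?thesis by simp
qed

lemma coord4_product_13:
  "coord4 \<theta> (\<lambda>a b c d. S a c * T b d) i j k l = coord2 \<theta> S i k * coord2 \<theta> T j l"
  unfolding coord4_transpose by (simp add: coord2_def coord_linear)

lemma coord4_flip34: "coord4 \<theta> (\<lambda>a b c d. T a b d c) i j k l = coord4 \<theta> T i j l k"
  unfolding coord4_pairs by (subst coord2_flip[symmetric]) (rule refl)

lemma coord4_product_14:
  "coord4 \<theta> (\<lambda>a b c d. S a d * T b c) i j k l = coord2 \<theta> S i l * coord2 \<theta> T j k"
  using coord4_flip34[of \<theta> "\<lambda>a b c d. S a c * T b d" i j k l] coord4_product_13 by metis

lemma coord4_product_24:
  "coord4 \<theta> (\<lambda>a b c d. T b d * S a c) i j k l = coord2 \<theta> T j l * coord2 \<theta> S i k"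
  using coord4_product_13[of \<theta> S T] by (simp add: mult.commute)

lemma coord4_product_23:
  "coord4 \<theta> (\<lambda>a b c d. T b c * S a d) i j k l = coord2 \<theta> T j k * coord2 \<theta> S i l"
  using coord4_product_14[of \<theta> S T] by (simp add: mult.commute)

lemma coord4_linear:
  "coord4 \<theta> (\<lambda>a b c d. S a b c d + T a b c d) i j k l = coord4 \<theta> S i j k l + coord4 \<theta> T i j k l"
  "coord4 \<theta> (\<lambda>a b c d. S a b c d - T a b c d) i j k l = coord4 \<theta> S i j k l - coord4 \<theta> T i j k l"
  "coord4 \<theta> (\<lambda>a b c d. T a b c d / t) i j k l = coord4 \<theta> T i j k l / t"
  by (simp_all add: coord4_def coord3_def coord2_def coord_linear)

lemma coord2_linear:
  "coord2 \<theta> (\<lambda>a b. S a b + T a b) i j = coord2 \<theta> S i j + coord2 \<theta> T i j"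
  "coord2 \<theta> (\<lambda>a b. S a b - T a b) i j = coord2 \<theta> S i j - coord2 \<theta> T i j"
  "coord2 \<theta> (\<lambda>a b. t * T a b) i j = t * coord2 \<theta> T i j"
  "coord2 \<theta> (\<lambda>a b. T a b / t) i j = coord2 \<theta> T i j / t"
  by (simp_all add: coord2_def coord_linear)

lemma sum_swap_pairs:
  "(\<Sum>p\<in>A. \<Sum>q\<in>B. \<Sum>e\<in>C. \<Sum>f\<in>D. F p q e f) = (\<Sum>q\<in>B. \<Sum>f\<in>D. \<Sum>p\<in>A. \<Sum>e\<in>C. F p q e f)"
proof -
  have "(\<Sum>p\<in>A. \<Sum>q\<in>B. \<Sum>e\<in>C. \<Sum>f\<in>D. F p q e f) = (\<Sum>q\<in>B. \<Sum>p\<in>A. \<Sum>e\<in>C. \<Sum>f\<in>D. F p q e f)"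
    by (rule sum.swap)
  also have "\<dots> = (\<Sum>q\<in>B. \<Sum>p\<in>A. \<Sum>f\<in>D. \<Sum>e\<in>C. F p q e f)"
    by (rule sum.cong[OF refl], rule sum.cong[OF refl], rule sum.swap)
  also have "\<dots> = (\<Sum>q\<in>B. \<Sum>f\<in>D. \<Sum>p\<in>A. \<Sum>e\<in>C. F p q e f)"
    by (rule sum.cong[OF refl], rule sum.swap)
  finally show ?thesis .
qed

text \<open>At a single point, an oriented orthonormal coframe together with the frame components of the
  curvature tensor determines the frame components of all curvature tensors of order zero.\<close>

locale curvature_coframe =
  fixes g :: "real^4 \<Rightarrow> real^4^4" and x :: "real^4" and \<theta> B :: "real^4^4" and R :: "4 \<Rightarrow> 4 \<Rightarrow> 4 \<Rightarrow> 4 \<Rightarrow> real"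
  assumes frame: "B ** \<theta> = mat 1" and metric: "g x = transpose \<theta> ** \<theta>" and oriented: "det \<theta> > 0"
    and rm: "rm g x i j k l = coord4 \<theta> R i j k l"
begin

definition Ric where "Ric a b = (\<Sum>h\<in>UNIV. R a h b h)"
definition H where "H = frame_schouten Ric"
definition W where "W = frame_weyl R H"

lemma metric_frame: "g x $ i $ j = coord2 \<theta> kronecker i j"
  using metric_coord[OF frame metric, of i j] by (simp add: kronecker_def[abs_def])

lemma ricci_frame: "ricci g x $ i $ j = coord2 \<theta> Ric i j"
  unfolding Ric_def[abs_def] by (rule ricci_coord[OF frame metric refl rm])

lemma scal_frame: "scal g x = (\<Sum>a\<in>UNIV. Ric a a)"
  by (rule scal_coord[OF frame metric refl ricci_frame])

lemma norm_ricci_frame: "norm_ricci g x $ i $ j = coord2 \<theta> H i j"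
  unfolding H_def frame_schouten_def[abs_def] coord2_linear
  by (simp add: norm_ricci_def ricci0_def ricci_frame metric_frame scal_frame algebra_simps)

lemma weyl_frame: "weyl g x i j k l = coord4 \<theta> W i j k l"
  unfolding W_def frame_weyl_def[abs_def] coord4_linear coord4_product_13 coord4_product_14
    coord4_product_23 coord4_product_24
  by (simp add: weyl_def Let_def rm norm_ricci_frame metric_frame)

lemma vol_frame: "vol g x i j k l = coord4 \<theta> levi_civita i j k l"
proof -
  have "det (g x) = (det \<theta>)\<^sup>2" by (simp add: metric det_mul det_transpose power2_eq_square)
  then show ?thesis using oriented
    by (simp add: vol_def coord4_levi_civita real_sqrt_abs flip: levi_civita_def)
qed

lemma contract_pairs:
  "(\<Sum>p\<in>UNIV. \<Sum>q\<in>UNIV. \<Sum>e\<in>UNIV. \<Sum>f\<in>UNIV. coord2 \<theta> X p q * matrix_inv (g x) $ p $ e * matrix_inv (g x) $ q $ f * coord2 \<theta> Y e f)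
   = (\<Sum>a\<in>UNIV. \<Sum>b\<in>UNIV. X a b * Y a b)"
proof -
  have "(\<Sum>p\<in>UNIV. \<Sum>q\<in>UNIV. \<Sum>e\<in>UNIV. \<Sum>f\<in>UNIV. coord2 \<theta> X p q * matrix_inv (g x) $ p $ e * matrix_inv (g x) $ q $ f * coord2 \<theta> Y e f)
    = (\<Sum>q\<in>UNIV. \<Sum>f\<in>UNIV. matrix_inv (g x) $ q $ f * (\<Sum>p\<in>UNIV. \<Sum>e\<in>UNIV. matrix_inv (g x) $ p $ e *
        (coord1 \<theta> (\<lambda>a. coord1 \<theta> (X a) q) p * coord1 \<theta> (\<lambda>a. coord1 \<theta> (Y a) f) e)))"
    unfolding coord2_def sum_distrib_left by (subst sum_swap_pairs) (simp add: ac_simps)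
  also have "\<dots> = (\<Sum>q\<in>UNIV. \<Sum>f\<in>UNIV. \<Sum>a\<in>UNIV. matrix_inv (g x) $ q $ f * (coord1 \<theta> (X a) q * coord1 \<theta> (Y a) f))"
    unfolding contract1[OF frame metric] by (simp add: sum_distrib_left)
  also have "\<dots> = (\<Sum>a\<in>UNIV. \<Sum>q\<in>UNIV. \<Sum>f\<in>UNIV. matrix_inv (g x) $ q $ f * (coord1 \<theta> (X a) q * coord1 \<theta> (Y a) f))"
    by (subst (2) sum.swap, subst sum.swap, rule refl)
  finally show ?thesis unfolding contract1[OF frame metric] .
qed

lemma star_weyl_frame: "star_weyl g x i j k l = coord4 \<theta> (frame_star W) i j k l"
proof -
  have L: "vol g x i j p q = coord2 \<theta> (\<lambda>c d. coord2 \<theta> (\<lambda>a b. levi_civita a b c d) i j) p q" for p q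
    unfolding vol_frame coord4_pairs
    by (simp add: coord2_def coord1_def sum_4 algebra_simps)
  have Y: "weyl g x e f k l = coord2 \<theta> (\<lambda>a b. coord2 \<theta> (\<lambda>c d. W a b c d) k l) e f" for e f
    unfolding weyl_frame coord4_pairs ..
  have "star_weyl g x i j k l = (\<Sum>p\<in>UNIV. \<Sum>q\<in>UNIV. coord2 \<theta> (\<lambda>a b. levi_civita a b p q) i j * coord2 \<theta> (\<lambda>c d. W p q c d) k l) / 2"
    unfolding star_weyl_def L Y contract_pairs ..
  also have "\<dots> = coord4 \<theta> (frame_star W) i j k l"
    unfolding coord4_pairs frame_star_def[abs_def] by (simp add: coord2_def coord_linear)
  finally show ?thesis .
qed

lemma weyl_plus_frame: "weyl_plus g x i j k l = coord4 \<theta> (\<lambda>a b c d. (W a b c d + frame_star W a b c d) / 2) i j k l"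
  and weyl_minus_frame: "weyl_minus g x i j k l = coord4 \<theta> (\<lambda>a b c d. (W a b c d - frame_star W a b c d) / 2) i j k l"
  unfolding weyl_plus_def weyl_minus_def weyl_frame star_weyl_frame coord4_linear by simp_all

end

section \<open>Algebra of Calabi curvature tensors\<close>

lemma eps_delta: "eps i j a b = (if a = i then 1 else 0) * (if b = j then 1 else 0)
    - (if a = j then 1 else 0) * (if b = i then 1 else 0)"
  unfolding eps_def
  by (cases "a = i"; cases "b = j"; cases "a = j"; cases "b = i"; simp only: simp_thms if_True if_False; simp)

text \<open>Laplace expansion of the determinant along its first two rows.\<close>

lemma levi_civita_eps:
  "levi_civita a b c d = eps 1 2 a b * eps 3 4 c d + eps 3 4 a b * eps 1 2 c d
     - eps 1 3 a b * eps 2 4 c d - eps 2 4 a b * eps 1 3 c d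
     + eps 1 4 a b * eps 2 3 c d + eps 2 3 a b * eps 1 4 c d"
proof -
  define e where "e i a = (if a = i then 1 else 0 :: real)" for i a :: 4
  have ax: "axis a 1 $ i = e i a" for i a by (cases "a = i") (simp_all add: axis_def e_def)
  have ep: "eps i j a b = e i a * e j b - e j a * e i b" for i j a b
    by (simp only: eps_delta e_def)
  show ?thesis unfolding levi_civita_def det_4 vector_4 ax ep by algebra
qed

text \<open>The symmetric form with eigenvalue \<open>p\<close> on the horizontal plane and \<open>q\<close> on the vertical one. The Ricci
  tensor, the normalized Ricci tensor and the Bach tensor of a Kaehler metric of Calabi type all
  have this shape.\<close>

definition split_form :: "real \<Rightarrow> real \<Rightarrow> 4 \<Rightarrow> 4 \<Rightarrow> real" where
  "split_form p q a b = (if a = b then if a = 1 \<or> a = 2 then p else q else 0)"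

lemma calabi_ricci:
  "(\<Sum>h\<in>UNIV. calabi_curvature A C C C E a h b h) = split_form (A - 2 * C) (- 2 * C - E) a b"
  using exhaust_4[of a] exhaust_4[of b]
  by (auto simp: sum_4 calabi_curvature_def eps_def split_form_def)

lemma calabi_scal:
  "(\<Sum>a\<in>UNIV. \<Sum>h\<in>UNIV. calabi_curvature A B C D E a h a h) = 2 * A - 4 * C - 4 * D - 2 * E"
  by (simp add: sum_4 calabi_curvature_def eps_def)

text \<open>With \<open>\<Omega> = e\<^sub>1\<^sub>2 + e\<^sub>3\<^sub>4\<close> and \<open>\<Omega>', \<Omega>''\<close> completing it to an orthogonal basis of the selfdual
  forms, this is \<open>\<Omega> \<otimes> \<Omega> - (\<Omega>' \<otimes> \<Omega>' + \<Omega>'' \<otimes> \<Omega>'') / 2\<close>: the symmetric trace-free endomorphism of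
  the selfdual forms, unique up to scale, that is invariant under rotations fixing \<open>\<Omega>\<close>.\<close>

definition sd_part :: "4 \<Rightarrow> 4 \<Rightarrow> 4 \<Rightarrow> 4 \<Rightarrow> real" where
  "sd_part a b c d = (eps 1 2 a b + eps 3 4 a b) * (eps 1 2 c d + eps 3 4 c d)
     - ((eps 1 3 a b - eps 2 4 a b) * (eps 1 3 c d - eps 2 4 c d)
      + (eps 1 4 a b + eps 2 3 a b) * (eps 1 4 c d + eps 2 3 c d)) / 2"

text \<open>The counterpart for the antiselfdual forms, with \<open>e\<^sub>1\<^sub>2 - e\<^sub>3\<^sub>4\<close> as the distinguished one.\<close>

definition asd_part :: "4 \<Rightarrow> 4 \<Rightarrow> 4 \<Rightarrow> 4 \<Rightarrow> real" where
  "asd_part a b c d = (eps 1 2 a b - eps 3 4 a b) * (eps 1 2 c d - eps 3 4 c d)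
     - ((eps 1 3 a b + eps 2 4 a b) * (eps 1 3 c d + eps 2 4 c d)
      + (eps 1 4 a b - eps 2 3 a b) * (eps 1 4 c d - eps 2 3 c d)) / 2"

lemma frame_schouten_split:
  "frame_schouten (split_form p q) = split_form (p / 2 - (p + q) / 6) (q / 2 - (p + q) / 6)"
  by (intro ext) (simp add: frame_schouten_def split_form_def kronecker_def sum_4)

lemma kulkarni_nomizu_split:
  "split_form p q a c * kronecker b d + split_form p q b d * kronecker a c
     - split_form p q a d * kronecker b c - split_form p q b c * kronecker a d =
   2 * p * (eps 1 2 a b * eps 1 2 c d) + 2 * q * (eps 3 4 a b * eps 3 4 c d)
     + (p + q) * (eps 1 3 a b * eps 1 3 c d + eps 1 4 a b * eps 1 4 c d
       + eps 2 3 a b * eps 2 3 c d + eps 2 4 a b * eps 2 4 c d)"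
proof -
  define e where "e i a = (if a = i then 1 else 0 :: real)" for i a :: 4
  \<comment> \<open>With \<open>X\<close> and \<open>Y\<close> the projections to the two planes, the identity splits into polynomial identities
    in the components of four unit vectors.\<close>
  define X where "X a b = e 1 a * e 1 b + e 2 a * e 2 b" for a b
  define Y where "Y a b = e 3 a * e 3 b + e 4 a * e 4 b" for a b
  have k: "kronecker a b = X a b + Y a b" for a b
    using exhaust_4[of a] exhaust_4[of b] by (auto simp: kronecker_def e_def X_def Y_def)
  have s: "split_form p q a b = p * X a b + q * Y a b" for a b
    using exhaust_4[of a] exhaust_4[of b] by (auto simp: split_form_def e_def X_def Y_def)
  have ep: "eps i j a b = e i a * e j b - e j a * e i b" for i j a b
    by (simp only: eps_delta e_def)
  have XX: "X a c * X b d - X a d * X b c = eps 1 2 a b * eps 1 2 c d"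
    and YY: "Y a c * Y b d - Y a d * Y b c = eps 3 4 a b * eps 3 4 c d"
    unfolding X_def Y_def ep by algebra+
  have XY: "X a c * Y b d + X b d * Y a c - X a d * Y b c - X b c * Y a d =
    eps 1 3 a b * eps 1 3 c d + eps 1 4 a b * eps 1 4 c d + eps 2 3 a b * eps 2 3 c d + eps 2 4 a b * eps 2 4 c d"
    unfolding X_def Y_def ep by algebra
  show ?thesis unfolding k s XX[symmetric] YY[symmetric] XY[symmetric] by (simp add: algebra_simps)
qed

text \<open>Here \<open>s\<close> is a twelfth of the scalar curvature and \<open>p, q\<close> are the eigenvalues of the normalized
  Ricci tensor. By symmetry both halves of the Weyl tensor have two equal eigenvalues, so a single
  scalar describes each: for a Kaehler metric the selfdual one is the scalar curvature up to a
  constant, and the antiselfdual one carries the remaining freedom.\<close>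

lemma calabi_weyl:
  assumes s: "s = (A - 4 * C - E) / 6" and p: "p = (A - 2 * C) / 2 - s" and q: "q = (- 2 * C - E) / 2 - s"
  shows "frame_weyl (calabi_curvature A C C C E) (split_form p q) a b c d =
     s * sd_part a b c d + (2 * C + s) * asd_part a b c d"
proof -
  have "6 * s = A - 4 * C - E" "2 * p = A - 2 * C - 2 * s" "2 * q = - 2 * C - E - 2 * s"
    using s p q by simp_all
  then have q': "q = s - p" and A: "A = 2 * p + 2 * C + 2 * s" and E: "E = 2 * p - 2 * C - 4 * s"
    by simp_all
  have k: "split_form p q a c * kronecker b d + split_form p q b d * kronecker a c
     - split_form p q a d * kronecker b c - split_form p q b c * kronecker a d =
     2 * p * (eps 1 2 a b * eps 1 2 c d) + 2 * (s - p) * (eps 3 4 a b * eps 3 4 c d)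
     + s * (eps 1 3 a b * eps 1 3 c d + eps 1 4 a b * eps 1 4 c d
       + eps 2 3 a b * eps 2 3 c d + eps 2 4 a b * eps 2 4 c d)"
    unfolding kulkarni_nomizu_split q' by simp
  have half: "2 * (X - Y / 2) = 2 * X - Y" for X Y :: real by simp
  have "2 * sd_part a b c d = 2 * ((eps 1 2 a b + eps 3 4 a b) * (eps 1 2 c d + eps 3 4 c d))
     - ((eps 1 3 a b - eps 2 4 a b) * (eps 1 3 c d - eps 2 4 c d)
      + (eps 1 4 a b + eps 2 3 a b) * (eps 1 4 c d + eps 2 3 c d))"
    "2 * asd_part a b c d = 2 * ((eps 1 2 a b - eps 3 4 a b) * (eps 1 2 c d - eps 3 4 c d))
     - ((eps 1 3 a b + eps 2 4 a b) * (eps 1 3 c d + eps 2 4 c d)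
      + (eps 1 4 a b - eps 2 3 a b) * (eps 1 4 c d - eps 2 3 c d))"
    by (simp_all only: sd_part_def asd_part_def half)
  then show ?thesis unfolding frame_weyl_def k unfolding A E calabi_curvature_def by algebra
qed

text \<open>The Hodge star on two-forms in an oriented orthonormal coframe.\<close>

definition frame_star2 :: "(4 \<Rightarrow> 4 \<Rightarrow> real) \<Rightarrow> 4 \<Rightarrow> 4 \<Rightarrow> real" where
  "frame_star2 X a b = (\<Sum>p\<in>UNIV. \<Sum>q\<in>UNIV. levi_civita a b p q * X p q) / 2"

lemmas eps_values = eps_def[of _ _ 1] eps_def[of _ _ 2] eps_def[of _ _ 3] eps_def[of _ _ 4]

lemma frame_star2_eps:
  "frame_star2 (eps 1 2) a b = eps 3 4 a b" "frame_star2 (eps 3 4) a b = eps 1 2 a b"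
  "frame_star2 (eps 1 3) a b = - eps 2 4 a b" "frame_star2 (eps 2 4) a b = - eps 1 3 a b"
  "frame_star2 (eps 1 4) a b = eps 2 3 a b" "frame_star2 (eps 2 3) a b = eps 1 4 a b"
  by (simp_all add: frame_star2_def levi_civita_eps sum_4 eps_values)

lemma frame_star_product: "frame_star (\<lambda>a b c d. X a b * Y c d) a b c d = frame_star2 X a b * Y c d"
  by (simp add: frame_star_def frame_star2_def sum_distrib_right mult.assoc)

lemma frame_star_linear:
  "frame_star (\<lambda>a b c d. S a b c d + T a b c d) a b c d = frame_star S a b c d + frame_star T a b c d"
  "frame_star (\<lambda>a b c d. S a b c d - T a b c d) a b c d = frame_star S a b c d - frame_star T a b c d"
  "frame_star (\<lambda>a b c d. t * T a b c d) a b c d = t * frame_star T a b c d"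
  "frame_star (\<lambda>a b c d. T a b c d / t) a b c d = frame_star T a b c d / t"
  by (simp_all add: frame_star_def sum.distrib sum_subtractf sum_distrib_left distrib_left right_diff_distrib
      add_divide_distrib diff_divide_distrib mult.left_commute flip: sum_divide_distrib)

lemma frame_star2_linear:
  "frame_star2 (\<lambda>a b. S a b + T a b) a b = frame_star2 S a b + frame_star2 T a b"
  "frame_star2 (\<lambda>a b. S a b - T a b) a b = frame_star2 S a b - frame_star2 T a b"
  by (simp_all add: frame_star2_def sum.distrib sum_subtractf distrib_left right_diff_distrib
      add_divide_distrib diff_divide_distrib)

lemma frame_star_sd_part: "frame_star sd_part a b c d = sd_part a b c d"
  and frame_star_asd_part: "frame_star asd_part a b c d = - asd_part a b c d"
  unfolding sd_part_def[abs_def] asd_part_def[abs_def] frame_star_linear frame_star_product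
    frame_star2_linear frame_star2_eps by (simp_all add: field_simps)

text \<open>The connection \<open>\<omega>\<close> of the Calabi coframe evaluated on the frame vector \<open>e\<^sub>h\<close>, in the case
  \<open>a = b = A\<close> which characterizes the Kaehler metric. The function \<open>f\<close> holds the frame components of
  the connection form of the base; it multiplies the infinitesimal rotation of \<open>e\<^sub>1, e\<^sub>2\<close> and must
  drop out of every invariant result.\<close>

definition calabi_connection :: "(4 \<Rightarrow> real) \<Rightarrow> real \<Rightarrow> real \<Rightarrow> 4 \<Rightarrow> 4 \<Rightarrow> 4 \<Rightarrow> real" where
  "calabi_connection f A c d a h = - (f h + A * kronecker h 4) * eps 1 2 d a
     + A * (kronecker h 1 * (eps 1 3 d a + eps 2 4 d a) + kronecker h 2 * (eps 2 3 d a - eps 1 4 d a))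
     - c * kronecker h 4 * eps 3 4 d a"

text \<open>Covariant derivative of a tensor whose frame components are functions of \<open>z\<close>: such functions vary
  only along \<open>e\<^sub>3\<close>, where \<open>T'\<close> is their derivative.\<close>

definition frame_nabla2 where
  "frame_nabla2 \<omega> T' T h a b = kronecker h 3 * T' a b - (\<Sum>d\<in>UNIV. \<omega> d a h * T d b) - (\<Sum>d\<in>UNIV. \<omega> d b h * T a d)"

definition frame_nabla3 where
  "frame_nabla3 \<omega> T' T h a b c = kronecker h 3 * T' a b c - (\<Sum>d\<in>UNIV. \<omega> d a h * T d b c)
     - (\<Sum>d\<in>UNIV. \<omega> d b h * T a d c) - (\<Sum>d\<in>UNIV. \<omega> d c h * T a b d)"

definition frame_nabla4 where
  "frame_nabla4 \<omega> T' T h a b c d = kronecker h 3 * T' a b c d - (\<Sum>e\<in>UNIV. \<omega> e a h * T e b c d)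
     - (\<Sum>e\<in>UNIV. \<omega> e b h * T a e c d) - (\<Sum>e\<in>UNIV. \<omega> e c h * T a b e d) - (\<Sum>e\<in>UNIV. \<omega> e d h * T a b c e)"

definition sym_unit :: "4 \<Rightarrow> 4 \<Rightarrow> 4 \<Rightarrow> 4 \<Rightarrow> real" where
  "sym_unit p q i j = kronecker i p * kronecker j q + kronecker i q * kronecker j p"

text \<open>The shape of the covariant derivative of a split form: \<open>P, Q\<close> are the rates of change of the two
  eigenvalues along \<open>e\<^sub>3\<close>, and \<open>t\<close> measures how parallel transport mixes the two planes, in proportion
  to the difference of the eigenvalues.\<close>

definition schouten_derivative :: "real \<Rightarrow> real \<Rightarrow> real \<Rightarrow> 4 \<Rightarrow> 4 \<Rightarrow> 4 \<Rightarrow> real" where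
  "schouten_derivative P Q t h a b = kronecker h 3 * split_form P Q a b
     + t * (kronecker h 1 * (sym_unit 1 3 a b + sym_unit 2 4 a b) + kronecker h 2 * (sym_unit 2 3 a b - sym_unit 1 4 a b))"

lemma frame_nabla2_split:
  "frame_nabla2 (calabi_connection f A c) (split_form P Q) (split_form p q) h a b
     = schouten_derivative P Q (A * (q - p)) h a b"
proof -
  have "\<forall>h a b. frame_nabla2 (calabi_connection f A c) (split_form P Q) (split_form p q) h a b
     = schouten_derivative P Q (A * (q - p)) h a b"
    unfolding forall_4
    by (simp add: frame_nabla2_def calabi_connection_def schouten_derivative_def split_form_def sym_unit_def
      kronecker_def eps_def sum_4 algebra_simps)
  then show ?thesis by blast
qed

definition calabi_cotton :: "real \<Rightarrow> real \<Rightarrow> real \<Rightarrow> 4 \<Rightarrow> 4 \<Rightarrow> 4 \<Rightarrow> real" where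
  "calabi_cotton P Q t a b c = schouten_derivative P Q t b a c - schouten_derivative P Q t a b c"

text \<open>The divergence of the Cotton tensor and the contraction of the Weyl tensor with the normalized Ricci
  tensor are both diagonal, with equal entries in the horizontal directions.\<close>

lemma calabi_bach:
  "- (\<Sum>i\<in>UNIV. frame_nabla3 (calabi_connection f A c) (calabi_cotton P1 Q1 t1) (calabi_cotton P Q t) i i a b)
     + (\<Sum>i\<in>UNIV. \<Sum>k\<in>UNIV. split_form p q i k * (s * sd_part i a k b + w * asd_part i a k b)) =
   kronecker a b * (if a = 1 \<or> a = 2 then P1 - t1 + (A + c) * (P - t) + 3 * A * t - (q - p) * (s + w)
     else if a = 3 then 2 * A * (P - t) + c * Q + (q - p) * (s + w)
     else Q1 + 2 * A * Q - 6 * A * t + (q - p) * (s + w))"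
  using exhaust_4[of a] exhaust_4[of b]
  apply (elim disjE)
  apply (simp_all add: frame_nabla3_def calabi_connection_def calabi_cotton_def schouten_derivative_def split_form_def sym_unit_def
      kronecker_def eps_def sum_4 sd_part_def asd_part_def)
  apply (simp_all add: field_simps)
  done

text \<open>An orthogonal basis of the antiselfdual forms. Differentiating the basis and expanding is far
  shorter than differentiating the 256 components of \<open>asd_part\<close>.\<close>

definition asd1 :: "4 \<Rightarrow> 4 \<Rightarrow> real" where "asd1 a b = eps 1 2 a b - eps 3 4 a b"
definition asd2 :: "4 \<Rightarrow> 4 \<Rightarrow> real" where "asd2 a b = eps 1 3 a b + eps 2 4 a b"
definition asd3 :: "4 \<Rightarrow> 4 \<Rightarrow> real" where "asd3 a b = eps 1 4 a b - eps 2 3 a b"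

lemma asd_part_eq: "asd_part a b c d = asd1 a b * asd1 c d - (asd2 a b * asd2 c d + asd3 a b * asd3 c d) / 2"
  by (simp only: asd_part_def asd1_def asd2_def asd3_def)

text \<open>The action of a skew endomorphism on two-forms. On antiselfdual forms it depends on the antiselfdual
  part of the endomorphism alone and is, up to scale, the cross product of the basis.\<close>

definition commutator :: "(4 \<Rightarrow> 4 \<Rightarrow> real) \<Rightarrow> (4 \<Rightarrow> 4 \<Rightarrow> real) \<Rightarrow> 4 \<Rightarrow> 4 \<Rightarrow> real" where
  "commutator X F a b = - (\<Sum>d\<in>UNIV. X d a * F d b) - (\<Sum>d\<in>UNIV. X d b * F a d)"

lemma commutator_asd:
  "commutator (eps 1 2) asd1 a b = 0" "commutator (eps 1 2) asd2 a b = asd3 a b" "commutator (eps 1 2) asd3 a b = - asd2 a b"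
  "commutator (eps 3 4) asd1 a b = 0" "commutator (eps 3 4) asd2 a b = - asd3 a b" "commutator (eps 3 4) asd3 a b = asd2 a b"
  "commutator asd2 asd1 a b = - 2 * asd3 a b" "commutator asd2 asd2 a b = 0" "commutator asd2 asd3 a b = 2 * asd1 a b"
  "commutator asd3 asd1 a b = 2 * asd2 a b" "commutator asd3 asd2 a b = - 2 * asd1 a b" "commutator asd3 asd3 a b = 0"
  using exhaust_4[of a] exhaust_4[of b]
  by (auto simp: commutator_def asd1_def asd2_def asd3_def sum_4
    eps_values)

lemma frame_nabla2_asd:
  defines "\<tau> \<equiv> \<lambda>f A c h. f h + (A - c) * kronecker h 4"
  shows "frame_nabla2 (calabi_connection f A c) (\<lambda>a b. 0) asd1 h a b
      = - 2 * A * (kronecker h 1 * asd3 a b + kronecker h 2 * asd2 a b)"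
    "frame_nabla2 (calabi_connection f A c) (\<lambda>a b. 0) asd2 h a b
      = 2 * A * kronecker h 2 * asd1 a b - \<tau> f A c h * asd3 a b"
    "frame_nabla2 (calabi_connection f A c) (\<lambda>a b. 0) asd3 h a b
      = 2 * A * kronecker h 1 * asd1 a b + \<tau> f A c h * asd2 a b"
proof -
  have w: "calabi_connection f A c d a h = - (f h + A * kronecker h 4) * eps 1 2 d a
     + (A * kronecker h 1 * asd2 d a - A * kronecker h 2 * asd3 d a) - c * kronecker h 4 * eps 3 4 d a" for d a
    by (simp add: calabi_connection_def asd2_def asd3_def algebra_simps)
  have n: "frame_nabla2 (calabi_connection f A c) (\<lambda>a b. 0) F h a b =
      - (f h + A * kronecker h 4) * commutator (eps 1 2) F a b
      + (A * kronecker h 1 * commutator asd2 F a b - A * kronecker h 2 * commutator asd3 F a b)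
      - c * kronecker h 4 * commutator (eps 3 4) F a b" for F
    by (simp add: frame_nabla2_def w commutator_def sum_4 algebra_simps)
  show "frame_nabla2 (calabi_connection f A c) (\<lambda>a b. 0) asd1 h a b
      = - 2 * A * (kronecker h 1 * asd3 a b + kronecker h 2 * asd2 a b)"
    "frame_nabla2 (calabi_connection f A c) (\<lambda>a b. 0) asd2 h a b
      = 2 * A * kronecker h 2 * asd1 a b - \<tau> f A c h * asd3 a b"
    "frame_nabla2 (calabi_connection f A c) (\<lambda>a b. 0) asd3 h a b
      = 2 * A * kronecker h 1 * asd1 a b + \<tau> f A c h * asd2 a b"
    unfolding n commutator_asd by (simp_all add: \<tau>_def algebra_simps)
qed

lemma frame_nabla4_product:
  "frame_nabla4 \<omega> (\<lambda>a b c d. 0) (\<lambda>a b c d. X a b * Y c d) h a b c d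
     = frame_nabla2 \<omega> (\<lambda>a b. 0) X h a b * Y c d + X a b * frame_nabla2 \<omega> (\<lambda>a b. 0) Y h c d"
  by (simp add: frame_nabla4_def frame_nabla2_def sum_distrib_left sum_distrib_right algebra_simps)

lemma frame_nabla4_linear:
  "frame_nabla4 \<omega> (\<lambda>a b c d. 0) (\<lambda>a b c d. S a b c d + T a b c d) h a b c d
    = frame_nabla4 \<omega> (\<lambda>a b c d. 0) S h a b c d + frame_nabla4 \<omega> (\<lambda>a b c d. 0) T h a b c d"
  "frame_nabla4 \<omega> (\<lambda>a b c d. 0) (\<lambda>a b c d. S a b c d - T a b c d) h a b c d
    = frame_nabla4 \<omega> (\<lambda>a b c d. 0) S h a b c d - frame_nabla4 \<omega> (\<lambda>a b c d. 0) T h a b c d"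
  "frame_nabla4 \<omega> (\<lambda>a b c d. 0) (\<lambda>a b c d. T a b c d / t) h a b c d
    = frame_nabla4 \<omega> (\<lambda>a b c d. 0) T h a b c d / t"
  "frame_nabla4 \<omega> (\<lambda>a b c d. w1 * T a b c d) (\<lambda>a b c d. w * T a b c d) h a b c d
    = kronecker h 3 * w1 * T a b c d + w * frame_nabla4 \<omega> (\<lambda>a b c d. 0) T h a b c d"
  by (simp_all add: frame_nabla4_def sum.distrib sum_subtractf sum_distrib_left distrib_left right_diff_distrib
      add_divide_distrib diff_divide_distrib mult.left_commute flip: sum_divide_distrib)

lemma frame_nabla4_asd_part:
  "frame_nabla4 (calabi_connection f A c) (\<lambda>a b c d. 0) asd_part h a b i j = - 3 * A *
     (kronecker h 1 * (asd1 a b * asd3 i j + asd3 a b * asd1 i j)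
      + kronecker h 2 * (asd1 a b * asd2 i j + asd2 a b * asd1 i j))"
  unfolding asd_part_eq[abs_def] frame_nabla4_linear frame_nabla4_product frame_nabla2_asd
  by (simp add: field_simps)

text \<open>Only the derivative of the scalar factor and the rotation of the distinguished form contribute;
  the trace collects both into multiples of the same tensor.\<close>

lemma calabi_asd_divergence:
  "- (\<Sum>a\<in>UNIV. frame_nabla4 (calabi_connection f A c) (\<lambda>a b c d. w1 * asd_part a b c d) (\<lambda>a b c d. w * asd_part a b c d) a a i j k)
   = - (w1 + 6 * A * w) * asd_part 3 i j k"
proof -
  have "asd1 3 i = - kronecker i 4" "asd2 3 i = - kronecker i 1" "asd3 3 i = kronecker i 2"
    "asd1 1 i = kronecker i 2" "asd3 1 i = kronecker i 4" "asd1 2 i = - kronecker i 1" "asd2 2 i = kronecker i 4"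
    using exhaust_4[of i] by (auto simp: asd1_def asd2_def asd3_def eps_def kronecker_def)
  then show ?thesis
    unfolding frame_nabla4_linear(4) frame_nabla4_asd_part unfolding sum_4 asd_part_eq
    by (simp add: kronecker_def[of 1] kronecker_def[of 2] kronecker_def[of 3] kronecker_def[of 4] field_simps)
qed

section \<open>Tensors whose frame components depend on the momentum only\<close>

lemma coord2_coord1:
  "coord2 \<theta> (\<lambda>a b. coord1 \<theta> (\<lambda>h. F h a b) m) i j = coord3 \<theta> F m i j"
  unfolding coord3_def by (simp add: coord1_def[of _ _ m] coord2_def coord_linear)

lemma coord3_coord1:
  "coord3 \<theta> (\<lambda>a b c. coord1 \<theta> (\<lambda>h. F h a b c) m) i j k = coord4 \<theta> F m i j k"
  unfolding coord4_def by (simp add: coord1_def[of _ _ m] coord3_def coord2_def coord_linear)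

lemma coord4_coord1:
  "coord4 \<theta> (\<lambda>a b c d. coord1 \<theta> (\<lambda>h. F h a b c d) m) i j k l = coord1 \<theta> (\<lambda>h. coord4 \<theta> (F h) i j k l) m"
  by (simp add: coord1_def[of _ _ m] coord4_def coord3_def coord2_def coord_linear)

lemma coord2_swap:
  "coord2 \<theta> (\<lambda>a b. coord2 \<theta> (F a b) k l) i j = coord2 \<theta> (\<lambda>c d. coord2 \<theta> (\<lambda>a b. F a b c d) i j) k l"
proof -
  have "coord2 \<theta> T k l = (\<Sum>c\<in>UNIV. \<theta>$c$k * (\<Sum>d\<in>UNIV. \<theta>$d$l * T c d))" for T
    by (simp add: coord2_def coord1_def)
  then show ?thesis by (simp only:) (simp only: coord2_def coord_linear)
qed

context cartan_coframe
begin

lemma nabla2_cong: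
  assumes "x \<in> U" "\<And>y i j. y \<in> U \<Longrightarrow> S y i j = T y i j"
  shows "nabla2 g S x m i j = nabla2 g T x m i j"
  using pd_cong[OF open_U assms(1), of "\<lambda>y. S y i j" "\<lambda>y. T y i j"] assms by (simp add: nabla2_def)

lemma nabla3_cong:
  assumes "x \<in> U" "\<And>y i j k. y \<in> U \<Longrightarrow> S y i j k = T y i j k"
  shows "nabla3 g S x m i j k = nabla3 g T x m i j k"
  using pd_cong[OF open_U assms(1), of "\<lambda>y. S y i j k" "\<lambda>y. T y i j k"] assms by (simp add: nabla3_def)

lemma nabla4_cong:
  assumes "x \<in> U" "\<And>y i j k l. y \<in> U \<Longrightarrow> S y i j k l = T y i j k l"
  shows "nabla4 g S x m i j k l = nabla4 g T x m i j k l"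
  using pd_cong[OF open_U assms(1), of "\<lambda>y. S y i j k l" "\<lambda>y. T y i j k l"] assms by (simp add: nabla4_def)

end

lemma coord1_kronecker: "coord1 \<theta> (\<lambda>h. kronecker h p) m = \<theta> $ p $ m"
proof -
  have "\<theta> $ h $ m * kronecker h p = (if h = p then \<theta> $ p $ m else 0)" for h by (simp add: kronecker_def)
  then show ?thesis by (simp add: coord1_def)
qed

context calabi_coframe
begin

text \<open>The components of the pulled-back connection form in the coframe.\<close>

definition \<phi>_frame :: "real^4 \<Rightarrow> 4 \<Rightarrow> real" where
  "\<phi>_frame x h = (\<Sum>i\<in>UNIV. B x $ i $ h * \<Phi> x $ i)"

lemma coord1_\<phi>_frame:
  assumes x: "x \<in> N" shows "coord1 (\<theta> x) (\<phi>_frame x) m = \<Phi> x $ m"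
proof -
  have "(\<Sum>h\<in>UNIV. B x $ i $ h * \<theta> x $ h $ m) = (if i = m then 1 else 0)" for i
    using B_\<theta>[OF x] by (simp add: matrix_matrix_mult_def mat_def vec_eq_iff)
  then have "(\<Sum>i\<in>UNIV. (\<Sum>h\<in>UNIV. B x $ i $ h * \<theta> x $ h $ m) * \<Phi> x $ i) = \<Phi> x $ m"
    by (simp add: if_distrib[of "\<lambda>x. x * _"] cong: if_cong)
  then show ?thesis
    unfolding coord1_def \<phi>_frame_def sum_distrib_left sum_distrib_right
    by (subst (asm) sum.swap) (simp add: ac_simps)
qed

lemma connection_frame:
  assumes x: "x \<in> N" and A: "a (x $ 3) = A" "b (x $ 3) = A" "c (x $ 3) = C"
  shows "\<omega> x $ d $ e $ m = coord1 (\<theta> x) (\<lambda>h. calabi_connection (\<phi>_frame x) A C d e h) m"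
proof -
  have "coord1 (\<theta> x) (\<lambda>h. calabi_connection (\<phi>_frame x) A C d e h) m =
     - (\<Phi> x $ m + A * e4 x $ m) * eps 1 2 d e
     + A * (e1 x $ m * (eps 1 3 d e + eps 2 4 d e) + e2 x $ m * (eps 2 3 d e - eps 1 4 d e))
     - C * e4 x $ m * eps 3 4 d e"
    unfolding calabi_connection_def coord_linear coord1_kronecker coord1_\<phi>_frame[OF x] by (simp add: \<theta>_def)
  then show ?thesis
    using exhaust_4[of d] exhaust_4[of e]
    by (elim disjE) (simp_all add: \<omega>_def rot_def A eps_values algebra_simps)
qed

text \<open>As \<open>dz = n e\<^sub>3\<close>, the differential of a function of \<open>z\<close> is a multiple of \<open>e\<^sub>3\<close>.\<close>

lemma momentum_derivative:
  assumes x: "x \<in> N" and T: "(T has_real_derivative T' / n (x $ 3)) (at (x $ 3))"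
  shows "pd m (\<lambda>y. T (y $ 3)) x = coord1 (\<theta> x) (\<lambda>h. kronecker h 3 * T') m"
  unfolding coord_linear coord1_kronecker pd_coordinate_function[OF T]
  by (simp add: \<theta>_def e3_def axis_def)

context
  fixes x A C
  assumes x: "x \<in> N" and A: "a (x $ 3) = A" "b (x $ 3) = A" "c (x $ 3) = C"
begin

abbreviation (input) "conn \<equiv> calabi_connection (\<phi>_frame x) A C"

text \<open>With constant frame components along the fibres and the base, covariant differentiation becomes the
  algebra of \<open>frame_nabla2\<close>, and likewise for ranks three and four. The hypotheses hold for
  the Kaehler metric, where \<open>a = b\<close>.\<close>

lemma nabla2_momentum:
  assumes T: "\<And>i j. ((\<lambda>z. T z i j) has_real_derivative T' i j / n (x $ 3)) (at (x $ 3))"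
  shows "nabla2 G (\<lambda>y. coord2 (\<theta> y) (T (y $ 3))) x m i j
    = coord3 (\<theta> x) (frame_nabla2 conn T' (T (x $ 3))) m i j"
proof -
  have "nabla2 G (\<lambda>y. coord2 (\<theta> y) (T (y $ 3))) x m i j = coord2 (\<theta> x) (\<lambda>p q. pd m (\<lambda>y. T (y $ 3) p q) x
     - (\<Sum>d\<in>UNIV. \<omega> x $ d $ p $ m * T (x $ 3) d q) - (\<Sum>d\<in>UNIV. \<omega> x $ d $ q $ m * T (x $ 3) p d)) i j"
    by (rule nabla2_coord[OF x coordinate_function_differentiable[OF T]])
  then show ?thesis
    unfolding connection_frame[OF x A] momentum_derivative[OF x T] coord2_coord1[symmetric] frame_nabla2_def
    by (simp only: coord_linear)
qed

lemma nabla3_momentum: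
  assumes T: "\<And>p q r. ((\<lambda>z. T z p q r) has_real_derivative T' p q r / n (x $ 3)) (at (x $ 3))"
  shows "nabla3 G (\<lambda>y. coord3 (\<theta> y) (T (y $ 3))) x m i j i1
    = coord4 (\<theta> x) (frame_nabla3 conn T' (T (x $ 3))) m i j i1"
proof -
  have "nabla3 G (\<lambda>y. coord3 (\<theta> y) (T (y $ 3))) x m i j i1 = coord3 (\<theta> x) (\<lambda>p q r. pd m (\<lambda>y. T (y $ 3) p q r) x
     - (\<Sum>d\<in>UNIV. \<omega> x $ d $ p $ m * T (x $ 3) d q r) - (\<Sum>d\<in>UNIV. \<omega> x $ d $ q $ m * T (x $ 3) p d r)
     - (\<Sum>d\<in>UNIV. \<omega> x $ d $ r $ m * T (x $ 3) p q d)) i j i1"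
    by (rule nabla3_coord[OF x coordinate_function_differentiable[OF T]])
  then show ?thesis
    unfolding connection_frame[OF x A] momentum_derivative[OF x T] coord3_coord1[symmetric] frame_nabla3_def
    by (simp only: coord_linear)
qed

lemma nabla4_momentum:
  assumes T: "\<And>p q r s. ((\<lambda>z. T z p q r s) has_real_derivative T' p q r s / n (x $ 3)) (at (x $ 3))"
  shows "nabla4 G (\<lambda>y. coord4 (\<theta> y) (T (y $ 3))) x m i j i1 i2
    = coord1 (\<theta> x) (\<lambda>h. coord4 (\<theta> x) (frame_nabla4 conn T' (T (x $ 3)) h) i j i1 i2) m"
proof -
  have "nabla4 G (\<lambda>y. coord4 (\<theta> y) (T (y $ 3))) x m i j i1 i2 = coord4 (\<theta> x) (\<lambda>p q r s. pd m (\<lambda>y. T (y $ 3) p q r s) x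
     - (\<Sum>d\<in>UNIV. \<omega> x $ d $ p $ m * T (x $ 3) d q r s) - (\<Sum>d\<in>UNIV. \<omega> x $ d $ q $ m * T (x $ 3) p d r s)
     - (\<Sum>d\<in>UNIV. \<omega> x $ d $ r $ m * T (x $ 3) p q d s) - (\<Sum>d\<in>UNIV. \<omega> x $ d $ s $ m * T (x $ 3) p q r d)) i j i1 i2"
    by (rule nabla4_coord[OF x coordinate_function_differentiable[OF T]])
  then show ?thesis
    unfolding connection_frame[OF x A] momentum_derivative[OF x T] coord4_coord1[symmetric] frame_nabla4_def
    by (simp only: coord_linear)
qed

end

text \<open>The coframe \<open>e\<^sub>1, e\<^sub>2, e\<^sub>3, e\<^sub>4\<close> is oriented.\<close>

lemma det_coframe: assumes x: "x \<in> N" shows "det (\<theta> x) > 0"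
proof -
  have "det (\<theta> x) = (r (x $ 3))\<^sup>2 * (u (base x) $ 1 * v (base x) $ 2 - v (base x) $ 1 * u (base x) $ 2)
     * l (x $ 3) / n (x $ 3)"
    by (simp add: det_4 \<theta>_def e1_def e2_def e3_def e4_def pull1_eq axis_def algebra_simps power2_eq_square
      diff_divide_distrib)
  then show ?thesis
    using area[OF base_N[OF x]] r_pos[OF x] n_pos[OF x] l_pos[OF x] by simp
qed

lemma curvature_coframe_at:
  assumes x: "x \<in> N"
  shows "curvature_coframe G x (\<theta> x) (B x) (calabi_curvature (K1 x) (K2 (x $ 3)) (K3 (x $ 3)) (K4 (x $ 3)) (K5 (x $ 3)))"
  by unfold_locales (use B_\<theta>[OF x] metric[OF x] det_coframe[OF x] curvature[OF x] in auto)

lemma scal_calabi: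
  assumes x: "x \<in> N"
  shows "scal G x = 2 * K1 x - 4 * K3 (x $ 3) - 4 * K4 (x $ 3) - 2 * K5 (x $ 3)"
  using curvature_coframe.scal_frame[OF curvature_coframe_at[OF x]]
  unfolding curvature_coframe.Ric_def[OF curvature_coframe_at[OF x]] calabi_scal by simp

end

section \<open>Contractions of covariant derivatives\<close>

context curvature_coframe
begin

lemma contract_12:
  "(\<Sum>i\<in>UNIV. \<Sum>j\<in>UNIV. matrix_inv (g x) $ i $ j * coord4 \<theta> T i j k l) = coord2 \<theta> (\<lambda>c d. \<Sum>a\<in>UNIV. T a a c d) k l"
  unfolding coord4_pairs contract[OF frame metric] by (simp add: coord2_def coord_linear)

lemma contract_derivative:
  "(\<Sum>m\<in>UNIV. \<Sum>i\<in>UNIV. matrix_inv (g x) $ m $ i * coord1 \<theta> (\<lambda>h. coord4 \<theta> (T h) i j k l) m)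
    = coord3 \<theta> (\<lambda>b c d. \<Sum>a\<in>UNIV. T a a b c d) j k l"
proof -
  have e: "coord1 \<theta> (\<lambda>h. coord4 \<theta> (T h) i j k l) m = coord2 \<theta> (\<lambda>h a. coord3 \<theta> (T h a) j k l) m i" for i m
    unfolding coord4_def coord2_def ..
  show ?thesis unfolding e contract[OF frame metric]
    by (simp add: coord3_def coord2_def coord_linear)
qed

lemma contract_weyl_schouten:
  "(\<Sum>i\<in>UNIV. \<Sum>j\<in>UNIV. \<Sum>k\<in>UNIV. \<Sum>l\<in>UNIV. matrix_inv (g x) $ i $ j * matrix_inv (g x) $ k $ l *
        coord2 \<theta> S j l * coord4 \<theta> T i b k c) = coord2 \<theta> (\<lambda>b c. \<Sum>i\<in>UNIV. \<Sum>k\<in>UNIV. S i k * T i b k c) b c"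
proof -
  define X where "X p q = coord2 \<theta> (\<lambda>b d. T p b q d) b c" for p q
  have "coord4 \<theta> T i b k c = coord2 \<theta> X i k" for i k
    unfolding coord4_transpose X_def[abs_def] by (rule coord2_swap)
  then have "(\<Sum>i\<in>UNIV. \<Sum>j\<in>UNIV. \<Sum>k\<in>UNIV. \<Sum>l\<in>UNIV. matrix_inv (g x) $ i $ j * matrix_inv (g x) $ k $ l *
        coord2 \<theta> S j l * coord4 \<theta> T i b k c) =
      (\<Sum>i\<in>UNIV. \<Sum>j\<in>UNIV. \<Sum>k\<in>UNIV. \<Sum>l\<in>UNIV.
        coord2 \<theta> X i k * matrix_inv (g x) $ i $ j * matrix_inv (g x) $ k $ l * coord2 \<theta> S j l)"
    by (simp add: ac_simps)
  also have "\<dots> = (\<Sum>i\<in>UNIV. \<Sum>k\<in>UNIV. \<Sum>j\<in>UNIV. \<Sum>l\<in>UNIV.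
        coord2 \<theta> X i k * matrix_inv (g x) $ i $ j * matrix_inv (g x) $ k $ l * coord2 \<theta> S j l)"
    by (rule sum.cong[OF refl], rule sum.swap)
  also have "\<dots> = (\<Sum>i\<in>UNIV. \<Sum>k\<in>UNIV. X i k * S i k)"
    by (rule contract_pairs)
  also have "\<dots> = coord2 \<theta> (\<lambda>b c. \<Sum>i\<in>UNIV. \<Sum>k\<in>UNIV. S i k * T i b k c) b c"
    unfolding X_def by (simp add: coord2_def coord_linear mult.commute)
  finally show ?thesis .
qed

end

section \<open>The Kaehler metric and its conformal companion\<close>

definition profile_metric ::
    "(real^2 \<Rightarrow> real^2) \<Rightarrow> (real^2 \<Rightarrow> real^2) \<Rightarrow> (real^2 \<Rightarrow> real^2) \<Rightarrow> (real \<Rightarrow> real) \<Rightarrow> real^4 \<Rightarrow> real^4^4" where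
  "profile_metric u v \<alpha> V x = x $ 3 *\<^sub>R base_metric u v x + (x $ 3 / V (x $ 3)) *\<^sub>R outer (axis 3 1) (axis 3 1)
     + (V (x $ 3) / x $ 3) *\<^sub>R outer (contact_form \<alpha> x) (contact_form \<alpha> x)"

locale momentum_profile = calabi_base D N u v \<phi> \<alpha> k
  for D :: "(real^2) set" and N :: "(real^4) set" and u v \<phi> \<alpha> :: "real^2 \<Rightarrow> real^2" and k :: "real^2 \<Rightarrow> real" +
  fixes V V1 V2 :: "real \<Rightarrow> real" and g :: "real^4 \<Rightarrow> real^4^4"
  assumes z_pos: "x \<in> N \<Longrightarrow> x $ 3 > 0" and V_pos: "x \<in> N \<Longrightarrow> V (x $ 3) > 0"
    and dV: "x \<in> N \<Longrightarrow> (V has_real_derivative V1 (x $ 3)) (at (x $ 3))"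
    and dV1: "x \<in> N \<Longrightarrow> (V1 has_real_derivative V2 (x $ 3)) (at (x $ 3))"
    and metric_eq: "x \<in> N \<Longrightarrow> g x = profile_metric u v \<alpha> V x"
begin

text \<open>The norm of the Killing field \<open>\<partial>/\<partial>t\<close>; its square is \<open>V z / z\<close>, with derivatives \<open>Y1\<close> and \<open>Y2\<close>.\<close>

definition m where "m z = sqrt (V z / z)"
definition Y1 where "Y1 z = V1 z / z - V z / z\<^sup>2"
definition Y2 where "Y2 z = V2 z / z - 2 * V1 z / z\<^sup>2 + 2 * V z / z ^ 3"

lemma m_pos: "x \<in> N \<Longrightarrow> m (x $ 3) > 0"
  using z_pos V_pos by (simp add: m_def)

lemma m_square: "x \<in> N \<Longrightarrow> (m (x $ 3))\<^sup>2 = V (x $ 3) / x $ 3" "x \<in> N \<Longrightarrow> m (x $ 3) * m (x $ 3) = V (x $ 3) / x $ 3"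
  using z_pos V_pos by (simp_all add: m_def less_imp_le)

lemma dY: "x \<in> N \<Longrightarrow> ((\<lambda>z. V z / z) has_real_derivative Y1 (x $ 3)) (at (x $ 3))"
  unfolding Y1_def
  by (rule derivative_eq_intros dV refl | assumption | use z_pos[of x] in force)+
     (use z_pos[of x] in \<open>simp add: field_simps power2_eq_square\<close>)

lemma dY1: "x \<in> N \<Longrightarrow> (Y1 has_real_derivative Y2 (x $ 3)) (at (x $ 3))"
  unfolding Y1_def[abs_def] Y2_def
  by (rule derivative_eq_intros dV dV1 refl | assumption | use z_pos[of x] in force)+
     (use z_pos[of x] in \<open>simp add: field_simps power2_eq_square power3_eq_cube\<close>)

lemma dm: assumes x: "x \<in> N" shows "(m has_real_derivative Y1 (x $ 3) / (2 * m (x $ 3))) (at (x $ 3))"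
proof -
  have p: "V (x $ 3) / x $ 3 > 0" using z_pos[OF x] V_pos[OF x] by simp
  from DERIV_chain2[OF DERIV_real_sqrt[OF p] dY[OF x]] show ?thesis
    unfolding m_def[abs_def] by (simp add: field_simps)
qed

lemma dm': assumes x: "x \<in> N"
  shows "((\<lambda>z. Y1 z / (2 * m z)) has_real_derivative
    (Y2 (x $ 3) / 2 - (Y1 (x $ 3))\<^sup>2 / (4 * (V (x $ 3) / x $ 3))) / m (x $ 3)) (at (x $ 3))"
proof -
  have "((\<lambda>z. Y1 z / (2 * m z)) has_real_derivative
    (Y2 (x $ 3) * (2 * m (x $ 3)) - Y1 (x $ 3) * (2 * (Y1 (x $ 3) / (2 * m (x $ 3))))) / ((2 * m (x $ 3)) * (2 * m (x $ 3)))) (at (x $ 3))"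
    by (rule DERIV_divide[OF dY1[OF x] DERIV_cmult[OF dm[OF x]]]) (use m_pos[OF x] in simp)
  then show ?thesis
    unfolding m_square(1)[OF x, symmetric]
    using m_pos[OF x] by (simp add: field_simps power2_eq_square)
qed

text \<open>The metric itself has \<open>r = sqrt z\<close> and \<open>n = l = m\<close>. The rate \<open>a = m / (2 z)\<close> of the base scaling then
  coincides with the twist \<open>b\<close>, which expresses that the metric is Kaehler.\<close>

sublocale kaehler: calabi_coframe D N u v \<phi> \<alpha> k sqrt m m "\<lambda>z. m z / (2 * z)" "\<lambda>z. Y1 z / (2 * m z)"
  "\<lambda>z. Y1 z / (2 * m z)" "\<lambda>z. Y1 z / (4 * z) - V z / z / (2 * z\<^sup>2)"
  "\<lambda>z. Y2 z / 2 - (Y1 z)\<^sup>2 / (4 * (V z / z))" g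
proof
  fix x assume x: "x \<in> N"
  note z = z_pos[OF x] and mp = m_pos[OF x]
  show "0 < sqrt (x $ 3)" using z by simp
  show "0 < m (x $ 3)" using mp .
  show "(sqrt has_real_derivative m (x $ 3) / (2 * x $ 3) * sqrt (x $ 3) / m (x $ 3)) (at (x $ 3))"
  proof -
    have "m (x $ 3) / (2 * x $ 3) * sqrt (x $ 3) / m (x $ 3) = (sqrt (x $ 3) / x $ 3) / 2" using mp z by simp
    also have "\<dots> = inverse (sqrt (x $ 3)) / 2" using z by (simp add: sqrt_divide_self_eq)
    finally show ?thesis using DERIV_real_sqrt[OF z] by (simp only:)
  qed
  show "(m has_real_derivative Y1 (x $ 3) / (2 * m (x $ 3)) * m (x $ 3) / m (x $ 3)) (at (x $ 3))"
    using dm[OF x] mp by simp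
  show "(m has_real_derivative Y1 (x $ 3) / (2 * m (x $ 3))) (at (x $ 3))"
    using dm[OF x] .
  show "(\<lambda>z. Y1 z / (2 * m z)) differentiable (at (x $ 3))"
    using dm'[OF x] real_differentiable_def by blast
  show "((\<lambda>z. Y1 z / (2 * m z)) has_real_derivative (Y2 (x $ 3) / 2 - (Y1 (x $ 3))\<^sup>2 / (4 * (V (x $ 3) / x $ 3))) / m (x $ 3)) (at (x $ 3))"
    using dm'[OF x] .
  have "((\<lambda>z. m z / (2 * z)) has_real_derivative (Y1 (x $ 3) / (2 * m (x $ 3)) * (2 * x $ 3) - m (x $ 3) * 2) / ((2 * x $ 3) * (2 * x $ 3))) (at (x $ 3))"
    using DERIV_divide[OF dm[OF x] DERIV_cmult[OF DERIV_ident, of 2]] z by simp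
  then show "((\<lambda>z. m z / (2 * z)) has_real_derivative (Y1 (x $ 3) / (4 * x $ 3) - V (x $ 3) / x $ 3 / (2 * (x $ 3)\<^sup>2)) / m (x $ 3)) (at (x $ 3))"
    unfolding m_square(1)[OF x, symmetric]
    using z mp by (simp add: field_simps power2_eq_square)
  show "g x = (sqrt (x $ 3))\<^sup>2 *\<^sub>R base_metric u v x + (1 / m (x $ 3))\<^sup>2 *\<^sub>R outer (axis 3 1) (axis 3 1)
        + (m (x $ 3))\<^sup>2 *\<^sub>R outer (contact_form \<alpha> x) (contact_form \<alpha> x)"
    unfolding metric_eq[OF x] profile_metric_def power_divide m_square[OF x] using z by simp
qed

text \<open>Dividing the metric by \<open>z\<^sup>2\<close> preserves the ansatz, with \<open>r = 1 / sqrt z\<close>, \<open>n = z m\<close> and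
  \<open>l = m / z\<close>. Now \<open>a = - m / 2\<close> is the negative of \<open>b = m / 2\<close>: the rescaled metric is Kaehler for
  the complex structure of the opposite orientation. The conformal scalar curvature is read off
  from the general curvature formula, with no formula for the conformal change of curvature.\<close>

sublocale conformal: calabi_coframe D N u v \<phi> \<alpha> k "\<lambda>z. 1 / sqrt z" "\<lambda>z. z * m z" "\<lambda>z. m z / z" "\<lambda>z. - m z / 2"
  "\<lambda>z. z * (Y1 z / (2 * m z)) - m z" "\<lambda>z. m z + z * (Y1 z / (2 * m z))" "\<lambda>z. - z * Y1 z / 4"
  "\<lambda>z. z\<^sup>2 * (Y2 z / 2 - (Y1 z)\<^sup>2 / (4 * (V z / z)))" "\<lambda>x. (1 / (x $ 3)\<^sup>2) *\<^sub>R g x"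
proof
  fix x assume x: "x \<in> N"
  let ?z = "x $ 3"
  note z = z_pos[OF x] and mp = m_pos[OF x]
  show "0 < 1 / sqrt ?z" "0 < ?z * m ?z" "0 < m ?z / ?z" using z mp by auto
  have "((\<lambda>z. 1 / sqrt z) has_real_derivative (- (inverse (sqrt ?z) / 2) / (sqrt ?z * sqrt ?z))) (at ?z)"
    using DERIV_divide[OF DERIV_const[of 1] DERIV_real_sqrt[OF z]] z by simp
  then show "((\<lambda>z. 1 / sqrt z) has_real_derivative - m ?z / 2 * (1 / sqrt ?z) / (?z * m ?z)) (at ?z)"
    using z mp by (simp add: field_simps)
  have zm: "((\<lambda>z. z * m z) has_real_derivative m ?z + ?z * (Y1 ?z / (2 * m ?z))) (at ?z)"
    using DERIV_mult[OF DERIV_ident dm[OF x]] by (simp add: algebra_simps)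
  then show "((\<lambda>z. z * m z) has_real_derivative m ?z + ?z * (Y1 ?z / (2 * m ?z))) (at ?z)" .
  have "((\<lambda>z. m z / z) has_real_derivative (Y1 ?z / (2 * m ?z) * ?z - m ?z * 1) / (?z * ?z)) (at ?z)"
    by (rule DERIV_divide[OF dm[OF x] DERIV_ident]) (use z in simp)
  moreover have "(Y1 ?z / (2 * m ?z) * ?z - m ?z * 1) / (?z * ?z) = (?z * (Y1 ?z / (2 * m ?z)) - m ?z) * (m ?z / ?z) / (?z * m ?z)"
    using z mp by simp
  ultimately show "((\<lambda>z. m z / z) has_real_derivative (?z * (Y1 ?z / (2 * m ?z)) - m ?z) * (m ?z / ?z) / (?z * m ?z)) (at ?z)"
    by simp
  have zd: "((\<lambda>z. z * (Y1 z / (2 * m z))) has_real_derivative Y1 ?z / (2 * m ?z) + ?z * ((Y2 ?z / 2 - (Y1 ?z)\<^sup>2 / (4 * (V ?z / ?z))) / m ?z)) (at ?z)"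
    using DERIV_mult[OF DERIV_ident dm'[OF x]] by (simp add: algebra_simps)
  show "(\<lambda>z. m z + z * (Y1 z / (2 * m z))) differentiable (at ?z)"
    using DERIV_add[OF dm[OF x] zd] real_differentiable_def by blast
  have "((\<lambda>z. - m z / 2) has_real_derivative - (Y1 ?z / (2 * m ?z)) / 2) (at ?z)"
    using DERIV_cdivide[OF DERIV_minus[OF dm[OF x]], of 2] by simp
  then show "((\<lambda>z. - m z / 2) has_real_derivative - ?z * Y1 ?z / 4 / (?z * m ?z)) (at ?z)"
    using z mp by simp
  have "((\<lambda>z. z * (Y1 z / (2 * m z)) - m z) has_real_derivative
     Y1 ?z / (2 * m ?z) + ?z * ((Y2 ?z / 2 - (Y1 ?z)\<^sup>2 / (4 * (V ?z / ?z))) / m ?z) - Y1 ?z / (2 * m ?z)) (at ?z)"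
    by (rule DERIV_diff[OF zd dm[OF x]])
  then show "((\<lambda>z. z * (Y1 z / (2 * m z)) - m z) has_real_derivative
     ?z\<^sup>2 * (Y2 ?z / 2 - (Y1 ?z)\<^sup>2 / (4 * (V ?z / ?z))) / (?z * m ?z)) (at ?z)"
    using z by (simp add: power2_eq_square)
  have c: "(1 / ?z\<^sup>2) *\<^sub>R (?z *\<^sub>R P + (?z / V ?z) *\<^sub>R Q + (V ?z / ?z) *\<^sub>R R) =
      (1 / sqrt ?z)\<^sup>2 *\<^sub>R P + (1 / (?z * m ?z))\<^sup>2 *\<^sub>R Q + (m ?z / ?z)\<^sup>2 *\<^sub>R R" for P Q R :: "real^4^4"
    unfolding power_divide power_mult_distrib m_square[OF x] scaleR_add_right scaleR_scaleR
    using z V_pos[OF x] by (simp add: power2_eq_square)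
  show "(1 / ?z\<^sup>2) *\<^sub>R g x = (1 / sqrt ?z)\<^sup>2 *\<^sub>R base_metric u v x + (1 / (?z * m ?z))\<^sup>2 *\<^sub>R outer (axis 3 1) (axis 3 1)
        + (m ?z / ?z)\<^sup>2 *\<^sub>R outer (contact_form \<alpha> x) (contact_form \<alpha> x)"
    unfolding metric_eq[OF x] profile_metric_def by (rule c)
qed

context
  fixes x assumes x: "x \<in> N"
begin

lemma kaehler_b: "kaehler.b (x $ 3) = m (x $ 3) / (2 * x $ 3)"
  using z_pos[OF x] by (simp add: kaehler.b_def)

text \<open>Since \<open>a = b\<close>, three of the five curvature components coincide, as the curvature tensor of a Kaehler
  metric commutes with the complex structure.\<close>

lemma kaehler_curvature:
  defines "z \<equiv> x $ 3"
  shows "kaehler.K1 x = k (base x) / z - V z / z ^ 3" "kaehler.K2 z = Y1 z / (4 * z) - V z / (4 * z ^ 3)"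
    "kaehler.K3 z = kaehler.K2 z" "kaehler.K4 z = kaehler.K2 z" "kaehler.K5 z = Y2 z / 2"
proof -
  have z: "z > 0" and mp: "m z > 0" and V: "V z > 0" and m2: "m z * m z = V z / z" "(m z)\<^sup>2 = V z / z"
    using z_pos[OF x] m_pos[OF x] V_pos[OF x] m_square[OF x] by (auto simp: z_def)
  have b: "kaehler.b z = m z / (2 * z)" using kaehler_b by (simp add: z_def)
  show "kaehler.K1 x = k (base x) / z - V z / z ^ 3"
    unfolding kaehler.K1_def z_def[symmetric] b power_divide m2 using z
    by (simp add: power_mult_distrib power3_eq_cube power2_eq_square)
  have K2: "kaehler.K2 z = Y1 z / (4 * z) - V z / (4 * z ^ 3)"
  proof -
    have "kaehler.K2 z = Y1 z / (4 * z) - (m z * m z) / (4 * (z * z))"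
      unfolding kaehler.K2_def b using z mp by (simp add: field_simps)
    then show ?thesis unfolding m2 by (simp add: power3_eq_cube)
  qed
  then show "kaehler.K2 z = Y1 z / (4 * z) - V z / (4 * z ^ 3)" .
  show "kaehler.K3 z = kaehler.K2 z"
    unfolding kaehler.K3_def K2 power_divide m2 using z
    by (simp add: power_mult_distrib power3_eq_cube power2_eq_square)
  show "kaehler.K4 z = kaehler.K2 z"
    unfolding kaehler.K4_def kaehler.K2_def b by (simp add: power2_eq_square algebra_simps)
  show "kaehler.K5 z = Y2 z / 2"
    unfolding kaehler.K5_def power_divide power_mult_distrib m2 by simp
qed

text \<open>All terms in which \<open>V\<close> and its first derivative occur cancel. The scalar curvature is therefore affine in
  \<open>z\<close> precisely if \<open>k\<close> is constant and \<open>V\<close> solves a linear differential equation whose solutions are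
  quartic polynomials.\<close>

lemma scal_kaehler: "scal g x = (2 * k (base x) - V2 (x $ 3)) / x $ 3"
  unfolding kaehler.scal_calabi[OF x] kaehler_curvature unfolding Y1_def Y2_def
  using z_pos[OF x] by (simp add: field_simps power2_eq_square power3_eq_cube)

lemma scal_conformal:
  defines "z \<equiv> x $ 3"
  shows "scal (\<lambda>x. (1 / (x $ 3)\<^sup>2) *\<^sub>R g x) x = 2 * k (base x) * z - 6 * (V z / z) + 4 * z * Y1 z - z\<^sup>2 * Y2 z"
proof -
  have z: "z > 0" and mp: "m z > 0" and V: "V z > 0" and m2: "(m z)\<^sup>2 = V z / z"
    using z_pos[OF x] m_pos[OF x] V_pos[OF x] m_square[OF x] by (auto simp: z_def)
  have b: "conformal.b z = m z / 2" using z by (simp add: conformal.b_def power_divide)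
  have "conformal.K1 x = k (base x) * z - (m z)\<^sup>2"
    unfolding conformal.K1_def z_def[symmetric] b using z by (simp add: power_divide)
  moreover have "conformal.K3 z = - z * Y1 z / 4 + (m z)\<^sup>2 / 4"
    unfolding conformal.K3_def by (simp add: power_divide)
  moreover have "conformal.K4 z = - z * Y1 z / 4 + (m z)\<^sup>2 / 4"
    unfolding conformal.K4_def b using mp by (simp add: power2_eq_square field_simps)
  moreover have "conformal.K5 z = z\<^sup>2 * Y2 z / 2 - z * Y1 z + (m z)\<^sup>2"
  proof -
    have "(z * (Y1 z / (2 * m z)) - m z)\<^sup>2 = z\<^sup>2 * ((Y1 z)\<^sup>2 / (4 * (m z)\<^sup>2)) - z * Y1 z + (m z)\<^sup>2"
      using mp by (simp add: power2_eq_square field_simps)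
    then show ?thesis unfolding conformal.K5_def m2 by (simp add: algebra_simps)
  qed
  ultimately show ?thesis
    unfolding conformal.scal_calabi[OF x] z_def[symmetric] m2 by (simp add: field_simps)
qed

end

end

section \<open>Quartic momentum profiles\<close>

lemma coord3_flip12: "coord3 \<theta> T j i k = coord3 \<theta> (\<lambda>a b c. T b a c) i j k"
  unfolding coord3_def coord2_def by (rule coord1_swap)

lemma coord3_linear:
  "coord3 \<theta> (\<lambda>a b c. S a b c - T a b c) i j k = coord3 \<theta> S i j k - coord3 \<theta> T i j k"
  "coord3 \<theta> (\<lambda>a b c. - T a b c) i j k = - coord3 \<theta> T i j k"
  by (simp_all add: coord3_def coord2_def coord_linear)

lemma split_form_linear: "split_form P Q a b = P * split_form 1 0 a b + Q * split_form 0 1 a b"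
  by (simp add: split_form_def)

text \<open>The tensor is a combination of three constant ones, so its derivative along \<open>z\<close> has the same shape.\<close>

lemma calabi_cotton_linear:
  "calabi_cotton P Q t a b c = P * calabi_cotton 1 0 0 a b c + Q * calabi_cotton 0 1 0 a b c + t * calabi_cotton 0 0 1 a b c"
  unfolding calabi_cotton_def schouten_derivative_def split_form_linear[of P Q] split_form_linear[of 0 0]
  by (simp add: algebra_simps)

definition quartic :: "real \<Rightarrow> real \<Rightarrow> real \<Rightarrow> real \<Rightarrow> real \<Rightarrow> real \<Rightarrow> real" where
  "quartic k A1 A2 A3 A4 z = A1 * z ^ 4 + A2 * z ^ 3 + k * z\<^sup>2 + A3 * z + A4"

definition quartic1 where "quartic1 k A1 A2 A3 z = 4 * A1 * z ^ 3 + 3 * A2 * z\<^sup>2 + 2 * k * z + A3" for z :: real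

definition quartic2 where "quartic2 k A1 A2 z = 12 * A1 * z\<^sup>2 + 6 * A2 * z + 2 * k" for z :: real

locale quartic_profile = momentum_profile D N u v \<phi> \<alpha> "\<lambda>y. k"
    "quartic k A1 A2 A3 A4" "quartic1 k A1 A2 A3" "quartic2 k A1 A2" g
  for D :: "(real^2) set" and N :: "(real^4) set" and u v \<phi> \<alpha> :: "real^2 \<Rightarrow> real^2" and k A1 A2 A3 A4 :: real
    and g :: "real^4 \<Rightarrow> real^4^4"
begin

text \<open>\<open>Y\<close> is \<open>V z / z\<close>; \<open>s\<close> and \<open>w\<close> are the scalars of the selfdual and the antiselfdual half of the Weyl
  tensor, \<open>12 s\<close> being the scalar curvature and \<open>2 w\<close> the conformal scalar curvature; \<open>p\<close> and \<open>q\<close> are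
  the eigenvalues of the normalized Ricci tensor on the horizontal and the vertical plane, and \<open>\<mu>\<close>
  is their difference.\<close>

definition Y where "Y z = A1 * z ^ 3 + A2 * z\<^sup>2 + k * z + A3 + A4 / z"
definition s where "s z = - A1 * z - A2 / 2"
definition w where "w z = - A3 / (2 * z\<^sup>2) - A4 / z ^ 3"
definition p where "p z = - A2 / 4 - A3 / (4 * z\<^sup>2)"
definition q where "q z = - A1 * z - A2 / 4 + A3 / (4 * z\<^sup>2)"
definition \<mu> where "\<mu> z = - A1 * z + A3 / (2 * z\<^sup>2)"

text \<open>The derivatives of \<open>p\<close> and \<open>q\<close>, and \<open>\<tau> = \<mu> / (2 z)\<close>, the coefficient of the mixing of the two planes
  in the covariant derivative of the normalized Ricci tensor.\<close>

definition p1 where "p1 z = A3 / (2 * z ^ 3)"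
definition q1 where "q1 z = - A1 - A3 / (2 * z ^ 3)"
definition \<tau> where "\<tau> z = - A1 / 2 + A3 / (4 * z ^ 3)"

lemma q_minus_p: "q z - p z = \<mu> z"
  by (simp add: q_def p_def \<mu>_def field_simps)

context
  fixes x assumes x: "x \<in> N"
begin

lemma z_nonzero: "x $ 3 \<noteq> 0" using z_pos[OF x] by simp

lemma V_eq: "quartic k A1 A2 A3 A4 (x $ 3) / x $ 3 = Y (x $ 3)"
  unfolding quartic_def using z_nonzero by (simp add: Y_def field_simps power2_eq_square power3_eq_cube power4_eq_xxxx)

lemma Y1_eq: "Y1 (x $ 3) = 3 * A1 * (x $ 3)\<^sup>2 + 2 * A2 * x $ 3 + k - A4 / (x $ 3)\<^sup>2"
  unfolding Y1_def quartic_def quartic1_def using z_nonzero by (simp add: field_simps power2_eq_square power3_eq_cube power4_eq_xxxx)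

lemma Y2_eq: "Y2 (x $ 3) = 6 * A1 * x $ 3 + 2 * A2 + 2 * A4 / (x $ 3) ^ 3"
  unfolding Y2_def quartic_def quartic1_def quartic2_def using z_nonzero by (simp add: field_simps power2_eq_square power3_eq_cube power4_eq_xxxx)

lemma m_square_Y: "m (x $ 3) * m (x $ 3) = Y (x $ 3)"
  using m_square(2)[OF x] unfolding V_eq .

lemma curvature_parameters:
  "kaehler.K1 x = - A1 * x $ 3 - A2 - A3 / (x $ 3)\<^sup>2 - A4 / (x $ 3) ^ 3"
  "kaehler.K2 (x $ 3) = A1 * x $ 3 / 2 + A2 / 4 - A3 / (4 * (x $ 3)\<^sup>2) - A4 / (2 * (x $ 3) ^ 3)"
  "kaehler.K5 (x $ 3) = 3 * A1 * x $ 3 + A2 + A4 / (x $ 3) ^ 3"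
  unfolding kaehler_curvature[OF x] Y1_eq Y2_eq quartic_def[of _ _ _ _ _ "x $ 3"]
  using z_nonzero by (simp_all add: field_simps power2_eq_square power3_eq_cube power4_eq_xxxx)

lemma curvature_parameters':
  "s (x $ 3) = (kaehler.K1 x - 4 * kaehler.K2 (x $ 3) - kaehler.K5 (x $ 3)) / 6"
  "w (x $ 3) = 2 * kaehler.K2 (x $ 3) + s (x $ 3)"
  "p (x $ 3) = (kaehler.K1 x - 2 * kaehler.K2 (x $ 3)) / 2 - s (x $ 3)"
  "q (x $ 3) = (- 2 * kaehler.K2 (x $ 3) - kaehler.K5 (x $ 3)) / 2 - s (x $ 3)"
  unfolding curvature_parameters s_def w_def p_def q_def
  using z_nonzero by (simp_all add: field_simps power2_eq_square power3_eq_cube)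

interpretation curvature_coframe g x "kaehler.\<theta> x" "kaehler.B x"
  "calabi_curvature (kaehler.K1 x) (kaehler.K2 (x $ 3)) (kaehler.K2 (x $ 3)) (kaehler.K2 (x $ 3)) (kaehler.K5 (x $ 3))"
  using kaehler.curvature_coframe_at[OF x] unfolding kaehler_curvature(3,4)[OF x] .

lemma Ric_eq: "Ric = split_form (2 * (p (x $ 3) + s (x $ 3))) (2 * (q (x $ 3) + s (x $ 3)))"
proof -
  have r: "a = b / 2 - c \<Longrightarrow> 2 * (a + c) = b" for a b c :: real by simp
  show ?thesis
    unfolding Ric_def[abs_def] calabi_ricci r[OF curvature_parameters'(3)] r[OF curvature_parameters'(4)] ..
qed

lemma H_eq: "H = split_form (p (x $ 3)) (q (x $ 3))"
proof -
  have "p (x $ 3) + q (x $ 3) = s (x $ 3)"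
    unfolding p_def q_def s_def by simp
  then show ?thesis
    unfolding H_def Ric_eq frame_schouten_split
    by (intro arg_cong2[where f = split_form]) (simp_all add: algebra_simps)
qed

lemma W_eq: "W = (\<lambda>a b c d. s (x $ 3) * sd_part a b c d + w (x $ 3) * asd_part a b c d)"
  unfolding W_def H_eq using calabi_weyl[OF curvature_parameters'(1,3,4)]
  by (intro ext) (simp add: curvature_parameters'(2))

lemma scal_quartic: "scal g x = 12 * s (x $ 3)"
  unfolding scal_kaehler[OF x] s_def quartic2_def using z_nonzero by (simp add: field_simps power2_eq_square)

lemma ricci_quartic: "ricci g x $ i $ j = coord2 (kaehler.\<theta> x) (split_form (2 * (p (x $ 3) + s (x $ 3))) (2 * (q (x $ 3) + s (x $ 3)))) i j"
  unfolding ricci_frame Ric_eq ..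

lemma norm_ricci_quartic: "norm_ricci g x $ i $ j = coord2 (kaehler.\<theta> x) (split_form (p (x $ 3)) (q (x $ 3))) i j"
  unfolding norm_ricci_frame H_eq ..

lemma star_W: "frame_star W a b c d = s (x $ 3) * sd_part a b c d - w (x $ 3) * asd_part a b c d"
  unfolding W_eq frame_star_linear frame_star_sd_part frame_star_asd_part by simp

lemma weyl_plus_quartic: "weyl_plus g x i j i1 i2 = coord4 (kaehler.\<theta> x) (\<lambda>a b c d. s (x $ 3) * sd_part a b c d) i j i1 i2"
proof -
  have "(a + b + (a - b)) / 2 = a" for a b :: real by simp
  then show ?thesis unfolding weyl_plus_frame star_W unfolding W_eq by (simp only:)
qed

lemma weyl_minus_quartic: "weyl_minus g x i j i1 i2 = coord4 (kaehler.\<theta> x) (\<lambda>a b c d. w (x $ 3) * asd_part a b c d) i j i1 i2"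
proof -
  have "(a + b - (a - b)) / 2 = b" for a b :: real by simp
  then show ?thesis unfolding weyl_minus_frame star_W unfolding W_eq by (simp only:)
qed

lemma weyl_quartic: "weyl g x i j i1 i2 = coord4 (kaehler.\<theta> x) (\<lambda>a b c d. s (x $ 3) * sd_part a b c d + w (x $ 3) * asd_part a b c d) i j i1 i2"
  unfolding weyl_frame W_eq ..

lemma weyl_plus_zero_iff: "(\<forall>a b c d. weyl_plus g x a b c d = 0) \<longleftrightarrow> s (x $ 3) = 0"
proof -
  have "sd_part 1 2 1 2 = 1" by (simp add: sd_part_def eps_def)
  then have "(\<forall>a b c d. s (x $ 3) * sd_part a b c d = 0) \<longleftrightarrow> s (x $ 3) = 0" by (metis mult_cancel_left1 mult_eq_0_iff)
  then show ?thesis unfolding weyl_plus_quartic coord4_eq_0_iff[OF kaehler.B_\<theta>[OF x]] .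
qed

lemma weyl_minus_zero_iff: "(\<forall>a b c d. weyl_minus g x a b c d = 0) \<longleftrightarrow> w (x $ 3) = 0"
proof -
  have "asd_part 1 2 1 2 = 1" by (simp add: asd_part_def eps_def)
  then have "(\<forall>a b c d. w (x $ 3) * asd_part a b c d = 0) \<longleftrightarrow> w (x $ 3) = 0" by (metis mult_cancel_left1 mult_eq_0_iff)
  then show ?thesis unfolding weyl_minus_quartic coord4_eq_0_iff[OF kaehler.B_\<theta>[OF x]] .
qed

end

context
  fixes x assumes x: "x \<in> N"
begin

interpretation curvature_coframe g x "kaehler.\<theta> x" "kaehler.B x"
  "calabi_curvature (kaehler.K1 x) (kaehler.K2 (x $ 3)) (kaehler.K2 (x $ 3)) (kaehler.K2 (x $ 3)) (kaehler.K5 (x $ 3))"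
  using kaehler.curvature_coframe_at[OF x] unfolding kaehler_curvature(3,4)[OF x] .

abbreviation (input) "conn \<equiv> calabi_connection (kaehler.\<phi>_frame x) (m (x $ 3) / (2 * x $ 3)) (Y1 (x $ 3) / (2 * m (x $ 3)))"

lemma dw: "(w has_real_derivative A3 / (x $ 3) ^ 3 + 3 * A4 / (x $ 3) ^ 4) (at (x $ 3))"
  unfolding w_def[abs_def]
  by (rule derivative_eq_intros refl | use z_nonzero[OF x] in force)+
     (use z_nonzero[OF x] in \<open>simp add: field_simps power2_eq_square power3_eq_cube power4_eq_xxxx\<close>)

text \<open>The divergence of \<open>w * asd_part\<close> is proportional to the derivative of \<open>z\<^sup>3 * w z\<close>, and
  \<open>z\<^sup>3 * w z = - A3 * z / 2 - A4\<close>.\<close>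

lemma div_weyl_minus_quartic:
  "div_weyl_minus g x i j i1 = coord3 (kaehler.\<theta> x) (\<lambda>b c d. m (x $ 3) * A3 / (2 * (x $ 3) ^ 3) * asd_part 3 b c d) i j i1"
proof -
  let ?w1 = "m (x $ 3) * (A3 / (x $ 3) ^ 3 + 3 * A4 / (x $ 3) ^ 4)"
  have d: "((\<lambda>z. w z * asd_part a b c d) has_real_derivative ?w1 * asd_part a b c d / m (x $ 3)) (at (x $ 3))" for a b c d
    using DERIV_cmult_right[OF dw, of "asd_part a b c d"] m_pos[OF x] by simp
  have n: "nabla4 g (weyl_minus g) x i3 i4 j i1 i2 = coord1 (kaehler.\<theta> x) (\<lambda>h. coord4 (kaehler.\<theta> x)
      (frame_nabla4 conn (\<lambda>a b c d. ?w1 * asd_part a b c d) (\<lambda>a b c d. w (x $ 3) * asd_part a b c d) h) i4 j i1 i2) i3" for i3 i4 j i1 i2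
  proof -
    have "nabla4 g (weyl_minus g) x i3 i4 j i1 i2 =
        nabla4 g (\<lambda>y. coord4 (kaehler.\<theta> y) (\<lambda>a b c d. w (y $ 3) * asd_part a b c d)) x i3 i4 j i1 i2"
      by (rule kaehler.nabla4_cong[OF x weyl_minus_quartic])
    also have "\<dots> = coord1 (kaehler.\<theta> x) (\<lambda>h. coord4 (kaehler.\<theta> x)
      (frame_nabla4 conn (\<lambda>a b c d. ?w1 * asd_part a b c d) (\<lambda>a b c d. w (x $ 3) * asd_part a b c d) h) i4 j i1 i2) i3"
      by (rule kaehler.nabla4_momentum[OF x refl kaehler_b[OF x] refl, where T = "\<lambda>z a b c d. w z * asd_part a b c d", OF d])
    finally show ?thesis .
  qed
  have "div_weyl_minus g x i j i1 = - coord3 (kaehler.\<theta> x) (\<lambda>b c d. \<Sum>a\<in>UNIV.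
      frame_nabla4 conn (\<lambda>a b c d. ?w1 * asd_part a b c d) (\<lambda>a b c d. w (x $ 3) * asd_part a b c d) a a b c d) i j i1"
    unfolding div_weyl_minus_def n contract_derivative ..
  also have "\<dots> = coord3 (kaehler.\<theta> x) (\<lambda>b c d. - (?w1 + 6 * (m (x $ 3) / (2 * x $ 3)) * w (x $ 3)) * asd_part 3 b c d) i j i1"
    unfolding coord3_linear(2)[symmetric] calabi_asd_divergence ..
  also have "- (?w1 + 6 * (m (x $ 3) / (2 * x $ 3)) * w (x $ 3)) = m (x $ 3) * A3 / (2 * (x $ 3) ^ 3)"
    unfolding w_def using z_nonzero[OF x] by (simp add: field_simps power2_eq_square power3_eq_cube power4_eq_xxxx)
  finally show ?thesis .
qed

lemma div_weyl_minus_zero_iff: "(\<forall>b c d. div_weyl_minus g x b c d = 0) \<longleftrightarrow> A3 = 0"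
proof -
  define X where "X = m (x $ 3) * A3 / (2 * (x $ 3) ^ 3)"
  have X0: "X = 0 \<longleftrightarrow> A3 = 0" using m_pos[OF x] z_nonzero[OF x] by (simp add: X_def)
  have "(\<forall>b c d. X * asd_part 3 b c d = 0) \<longleftrightarrow> X = 0"
  proof
    assume "\<forall>b c d. X * asd_part 3 b c d = 0"
    then have "X * asd_part 3 4 3 4 = 0" by blast
    then show "X = 0" by (simp add: asd_part_def eps_def)
  qed simp
  then show ?thesis
    unfolding div_weyl_minus_quartic X_def[symmetric] coord3_eq_0_iff[OF kaehler.B_\<theta>[OF x]] X0 .
qed

lemma dp: "(p has_real_derivative p1 (x $ 3)) (at (x $ 3))"
  unfolding p_def[abs_def] p1_def
  by (rule derivative_eq_intros refl | use z_nonzero[OF x] in force)+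
     (use z_nonzero[OF x] in \<open>simp add: field_simps power2_eq_square power3_eq_cube\<close>)

lemma dq: "(q has_real_derivative q1 (x $ 3)) (at (x $ 3))"
  unfolding q_def[abs_def] q1_def
  by (rule derivative_eq_intros refl | use z_nonzero[OF x] in force)+
     (use z_nonzero[OF x] in \<open>simp add: field_simps power2_eq_square power3_eq_cube\<close>)

lemma dp1: "(p1 has_real_derivative - 3 * A3 / (2 * (x $ 3) ^ 4)) (at (x $ 3))"
  unfolding p1_def[abs_def]
  by (rule derivative_eq_intros refl | use z_nonzero[OF x] in force)+
     (use z_nonzero[OF x] in \<open>simp add: field_simps power2_eq_square power3_eq_cube power4_eq_xxxx\<close>)

lemma dq1: "(q1 has_real_derivative 3 * A3 / (2 * (x $ 3) ^ 4)) (at (x $ 3))"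
  unfolding q1_def[abs_def]
  by (rule derivative_eq_intros refl | use z_nonzero[OF x] in force)+
     (use z_nonzero[OF x] in \<open>simp add: field_simps power2_eq_square power3_eq_cube power4_eq_xxxx\<close>)

lemma d\<tau>: "(\<tau> has_real_derivative - 3 * A3 / (4 * (x $ 3) ^ 4)) (at (x $ 3))"
  unfolding \<tau>_def[abs_def]
  by (rule derivative_eq_intros refl | use z_nonzero[OF x] in force)+
     (use z_nonzero[OF x] in \<open>simp add: field_simps power2_eq_square power3_eq_cube power4_eq_xxxx\<close>)

text \<open>As a combination of two constant forms, the normalized Ricci tensor is differentiated by
  differentiating its eigenvalues; \<open>\<tau>\<close> appears since \<open>m / (2 z) * \<mu> = m * \<tau>\<close>.\<close>

lemma nabla_schouten:
  "nabla2 g (\<lambda>y i j. norm_ricci g y $ i $ j) x i3 i j = coord3 (kaehler.\<theta> x)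
     (schouten_derivative (m (x $ 3) * p1 (x $ 3)) (m (x $ 3) * q1 (x $ 3)) (m (x $ 3) * \<tau> (x $ 3))) i3 i j"
proof -
  let ?m = "m (x $ 3)"
  have d: "((\<lambda>z. split_form (p z) (q z) a b) has_real_derivative split_form (?m * p1 (x $ 3)) (?m * q1 (x $ 3)) a b / ?m) (at (x $ 3))" for a b
  proof -
    have "((\<lambda>z. split_form (p z) (q z) a b) has_real_derivative p1 (x $ 3) * split_form 1 0 a b + q1 (x $ 3) * split_form 0 1 a b) (at (x $ 3))"
      unfolding split_form_linear[of "p _"]
      by (intro DERIV_add DERIV_cmult_right dp dq)
    then show ?thesis unfolding split_form_linear[of "?m * _"] using m_pos[OF x] by (simp add: add_divide_distrib)
  qed
  have t: "?m / (2 * x $ 3) * (q (x $ 3) - p (x $ 3)) = ?m * \<tau> (x $ 3)"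
    unfolding q_minus_p \<mu>_def \<tau>_def using z_nonzero[OF x] by (simp add: field_simps power2_eq_square power3_eq_cube)
  have "nabla2 g (\<lambda>y i j. norm_ricci g y $ i $ j) x i3 i j =
      nabla2 g (\<lambda>y. coord2 (kaehler.\<theta> y) (split_form (p (y $ 3)) (q (y $ 3)))) x i3 i j"
    by (rule kaehler.nabla2_cong[OF x norm_ricci_quartic])
  also have "\<dots> = coord3 (kaehler.\<theta> x) (frame_nabla2 conn (split_form (?m * p1 (x $ 3)) (?m * q1 (x $ 3))) (split_form (p (x $ 3)) (q (x $ 3)))) i3 i j"
    by (rule kaehler.nabla2_momentum[OF x refl kaehler_b[OF x] refl, where T = "\<lambda>z. split_form (p z) (q z)", OF d])
  finally show ?thesis unfolding frame_nabla2_split[abs_def] t .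
qed

lemma cotton_quartic:
  "cotton g x i j i1 = coord3 (kaehler.\<theta> x)
     (calabi_cotton (m (x $ 3) * p1 (x $ 3)) (m (x $ 3) * q1 (x $ 3)) (m (x $ 3) * \<tau> (x $ 3))) i j i1"
  unfolding cotton_def nabla_schouten calabi_cotton_def[abs_def] coord3_linear
  by (subst coord3_flip12) simp

end

context
  fixes x assumes x: "x \<in> N"
begin

interpretation curvature_coframe g x "kaehler.\<theta> x" "kaehler.B x"
  "calabi_curvature (kaehler.K1 x) (kaehler.K2 (x $ 3)) (kaehler.K2 (x $ 3)) (kaehler.K2 (x $ 3)) (kaehler.K5 (x $ 3))"
  using kaehler.curvature_coframe_at[OF x] unfolding kaehler_curvature(3,4)[OF x] .

text \<open>The Cotton tensor carries a factor \<open>m\<close>, which is a square root. Its derivative along \<open>e\<^sub>3\<close>, that is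
  \<open>m\<close> times the derivative in \<open>z\<close>, involves only \<open>m * m = Y\<close> and is rational again.\<close>

lemma dm_times:
  assumes "(f has_real_derivative f') (at (x $ 3))"
  shows "((\<lambda>z. m z * f z) has_real_derivative (Y1 (x $ 3) / 2 * f (x $ 3) + Y (x $ 3) * f') / m (x $ 3)) (at (x $ 3))"
proof -
  have "Y1 (x $ 3) / (2 * m (x $ 3)) * f (x $ 3) + f' * m (x $ 3) = (Y1 (x $ 3) / 2 * f (x $ 3) + Y (x $ 3) * f') / m (x $ 3)"
    unfolding m_square_Y[OF x, symmetric] using m_pos[OF x] by (simp add: field_simps)
  then show ?thesis using DERIV_mult[OF dm[OF x] assms] by (simp add: mult.commute)
qed

text \<open>Every entry of the diagonal is a rational function of \<open>z\<close> that is bilinear in the coefficients of the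
  quartic; all powers of \<open>z\<close> cancel except one, whose coefficient is \<open>4 * A1 * A4 - A2 * A3\<close>.\<close>

lemma bach_quartic:
  "bach g x i j = coord2 (kaehler.\<theta> x) (\<lambda>a b. kronecker a b *
     ((if a = 1 \<or> a = 2 then - 1 else 1) * ((4 * A1 * A4 - A2 * A3) / (2 * (x $ 3)\<^sup>2)))) i j"
proof -
  let ?z = "x $ 3"
  let ?m = "m ?z"
  let ?conn = "calabi_connection (kaehler.\<phi>_frame x) (?m / (2 * ?z)) (Y1 ?z / (2 * ?m))"
  define P Q t where "P = ?m * p1 ?z" and "Q = ?m * q1 ?z" and "t = ?m * \<tau> ?z"
  define P1 where "P1 = Y1 ?z / 2 * p1 ?z + Y ?z * (- 3 * A3 / (2 * ?z ^ 4))"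
  define Q1 where "Q1 = Y1 ?z / 2 * q1 ?z + Y ?z * (3 * A3 / (2 * ?z ^ 4))"
  define t1 where "t1 = Y1 ?z / 2 * \<tau> ?z + Y ?z * (- 3 * A3 / (4 * ?z ^ 4))"
  define S where "S = split_form (p ?z) (q ?z)"
  define Wh where "Wh a b c d = s ?z * sd_part a b c d + w ?z * asd_part a b c d" for a b c d
  have d: "((\<lambda>z. calabi_cotton (m z * p1 z) (m z * q1 z) (m z * \<tau> z) a b c) has_real_derivative calabi_cotton P1 Q1 t1 a b c / ?m) (at ?z)" for a b c
  proof -
    have "((\<lambda>z. calabi_cotton (m z * p1 z) (m z * q1 z) (m z * \<tau> z) a b c) has_real_derivative
       P1 / ?m * calabi_cotton 1 0 0 a b c + Q1 / ?m * calabi_cotton 0 1 0 a b c + t1 / ?m * calabi_cotton 0 0 1 a b c) (at ?z)"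
      unfolding calabi_cotton_linear[of "m _ * _"] P1_def Q1_def t1_def
      by (intro DERIV_add DERIV_cmult_right dm_times dp1[OF x] dq1[OF x] d\<tau>[OF x])
    then show ?thesis unfolding calabi_cotton_linear[of P1] by (simp add: add_divide_distrib)
  qed
  have n: "nabla3 g (cotton g) x i3 i4 i j = coord4 (kaehler.\<theta> x) (frame_nabla3 ?conn (calabi_cotton P1 Q1 t1) (calabi_cotton P Q t)) i3 i4 i j" for i3 i4 i j
  proof -
    have "nabla3 g (cotton g) x i3 i4 i j = nabla3 g (\<lambda>y. coord3 (kaehler.\<theta> y)
        (calabi_cotton (m (y $ 3) * p1 (y $ 3)) (m (y $ 3) * q1 (y $ 3)) (m (y $ 3) * \<tau> (y $ 3)))) x i3 i4 i j"
      by (rule kaehler.nabla3_cong[OF x cotton_quartic])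
    also have "\<dots> = coord4 (kaehler.\<theta> x) (frame_nabla3 ?conn (calabi_cotton P1 Q1 t1) (calabi_cotton P Q t)) i3 i4 i j"
      unfolding P_def Q_def t_def
      by (rule kaehler.nabla3_momentum[OF x refl kaehler_b[OF x] refl, where T = "\<lambda>z. calabi_cotton (m z * p1 z) (m z * q1 z) (m z * \<tau> z)", OF d])
    finally show ?thesis .
  qed
  have "bach g x i j = coord2 (kaehler.\<theta> x) (\<lambda>a b. - (\<Sum>i\<in>UNIV. frame_nabla3 ?conn (calabi_cotton P1 Q1 t1) (calabi_cotton P Q t) i i a b)) i j
     + coord2 (kaehler.\<theta> x) (\<lambda>a b. \<Sum>i\<in>UNIV. \<Sum>k\<in>UNIV. S i k * Wh i a k b) i j"
  proof -
    have "(\<Sum>i3\<in>UNIV. \<Sum>i4\<in>UNIV. matrix_inv (g x) $ i3 $ i4 * - nabla3 g (cotton g) x i3 i4 i j)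
       = - coord2 (kaehler.\<theta> x) (\<lambda>a b. \<Sum>i\<in>UNIV. frame_nabla3 ?conn (calabi_cotton P1 Q1 t1) (calabi_cotton P Q t) i i a b) i j"
      unfolding n contract_12[symmetric] by (simp add: sum_negf)
    also have "\<dots> = coord2 (kaehler.\<theta> x) (\<lambda>a b. - (\<Sum>i\<in>UNIV. frame_nabla3 ?conn (calabi_cotton P1 Q1 t1) (calabi_cotton P Q t) i i a b)) i j"
      by (simp add: coord2_def coord1_minus)
    finally show ?thesis
      unfolding bach_def norm_ricci_quartic[OF x] weyl_quartic[OF x] S_def[symmetric] Wh_def[symmetric]
      contract_weyl_schouten by simp
  qed
  also have "\<dots> = coord2 (kaehler.\<theta> x) (\<lambda>a b. - (\<Sum>i\<in>UNIV. frame_nabla3 ?conn (calabi_cotton P1 Q1 t1) (calabi_cotton P Q t) i i a b)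
     + (\<Sum>i\<in>UNIV. \<Sum>k\<in>UNIV. S i k * Wh i a k b)) i j"
    by (rule coord2_linear(1)[symmetric])
  also have "\<dots> = coord2 (kaehler.\<theta> x) (\<lambda>a b. kronecker a b *
     ((if a = 1 \<or> a = 2 then - 1 else 1) * ((4 * A1 * A4 - A2 * A3) / (2 * ?z\<^sup>2)))) i j"
  proof -
    note nz = z_nonzero[OF x]
    have mm: "?m * ?m = Y ?z" and mp: "?m \<noteq> 0" using m_square_Y[OF x] m_pos[OF x] by auto
    define X where "X = (4 * A1 * A4 - A2 * A3) / (2 * ?z\<^sup>2)"
    have Pt: "P - t = ?m * (p1 ?z - \<tau> ?z)" unfolding P_def t_def by (rule right_diff_distrib[symmetric])
    have t3: "?m / (2 * ?z) * t = Y ?z / (2 * ?z) * \<tau> ?z" "?m / (2 * ?z) * (P - t) = Y ?z / (2 * ?z) * (p1 ?z - \<tau> ?z)"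
      "?m / (2 * ?z) * Q = Y ?z / (2 * ?z) * q1 ?z"
      unfolding Pt mm[symmetric] unfolding t_def Q_def by (simp_all only: times_divide_eq_left times_divide_eq_right mult.assoc)
    have c3: "Y1 ?z / (2 * ?m) * (P - t) = Y1 ?z / 2 * (p1 ?z - \<tau> ?z)" "Y1 ?z / (2 * ?m) * Q = Y1 ?z / 2 * q1 ?z"
      unfolding Pt unfolding Q_def using mp by simp_all
    \<comment> \<open>Naming the inverses of \<open>z\<close> and of two turns the three entries into polynomial identities modulo
      the relations \<open>z y = 1\<close> and \<open>2 h = 1\<close>.\<close>
    define y where "y = 1 / ?z"
    define h :: real where "h = 1 / 2"
    have zy: "?z * y = 1" and h2: "2 * h = 1" using nz by (simp_all add: y_def h_def)
    have conv: "p1 ?z = h * A3 * y ^ 3" "q1 ?z = - A1 - h * A3 * y ^ 3" "\<tau> ?z = - h * A1 + h * h * A3 * y ^ 3"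
      "\<mu> ?z = - A1 * ?z + h * A3 * y ^ 2" "s ?z = - A1 * ?z - h * A2" "w ?z = - h * A3 * y ^ 2 - A4 * y ^ 3"
      "Y1 ?z = 3 * A1 * ?z ^ 2 + 2 * A2 * ?z + k - A4 * y ^ 2" "Y ?z = A1 * ?z ^ 3 + A2 * ?z ^ 2 + k * ?z + A3 + A4 * y"
      "X = h * (4 * A1 * A4 - A2 * A3) * y ^ 2"
      "P1 = h * Y1 ?z * p1 ?z - 3 * h * A3 * Y ?z * y ^ 4" "Q1 = h * Y1 ?z * q1 ?z + 3 * h * A3 * Y ?z * y ^ 4"
      "t1 = h * Y1 ?z * \<tau> ?z - 3 * h * h * A3 * Y ?z * y ^ 4"
      unfolding P1_def Q1_def t1_def X_def Y1_eq[OF x] Y_def p1_def q1_def \<tau>_def \<mu>_def s_def w_def y_def h_def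
      by (simp_all add: power_divide)
    have half: "a / (2 * ?z) = h * y * a" "a / 2 = h * a" for a by (simp_all add: y_def h_def)
    have h: "P1 - t1 + (?m / (2 * ?z) + Y1 ?z / (2 * ?m)) * (P - t) + 3 * (?m / (2 * ?z)) * t - (q ?z - p ?z) * (s ?z + w ?z) = - X"
    proof -
      have 1: "(?m / (2 * ?z) + Y1 ?z / (2 * ?m)) * (P - t) = h * y * Y ?z * (p1 ?z - \<tau> ?z) + h * Y1 ?z * (p1 ?z - \<tau> ?z)"
        unfolding distrib_right t3 c3 unfolding half ..
      have 2: "3 * (?m / (2 * ?z)) * t = 3 * (h * y * Y ?z * \<tau> ?z)"
        unfolding half(1)[of "Y ?z", symmetric] t3(1)[symmetric] by simp
      show ?thesis unfolding 1 2 q_minus_p unfolding conv using zy h2 by algebra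
    qed
    have v3: "2 * (?m / (2 * ?z)) * (P - t) + Y1 ?z / (2 * ?m) * Q + (q ?z - p ?z) * (s ?z + w ?z) = X"
    proof -
      have 1: "2 * (?m / (2 * ?z)) * (P - t) = 2 * (h * y * Y ?z * (p1 ?z - \<tau> ?z))"
        unfolding half(1)[of "Y ?z", symmetric] t3(2)[symmetric] by simp
      show ?thesis unfolding 1 c3 unfolding half q_minus_p unfolding conv using zy h2 by algebra
    qed
    have v4: "Q1 + 2 * (?m / (2 * ?z)) * Q - 6 * (?m / (2 * ?z)) * t + (q ?z - p ?z) * (s ?z + w ?z) = X"
    proof -
      have 1: "2 * (?m / (2 * ?z)) * Q = 2 * (h * y * Y ?z * q1 ?z)" "6 * (?m / (2 * ?z)) * t = 6 * (h * y * Y ?z * \<tau> ?z)"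
        unfolding half(1)[of "Y ?z", symmetric] t3(1,3)[symmetric] by simp_all
      show ?thesis unfolding 1 q_minus_p unfolding conv using zy h2 by algebra
    qed
    show ?thesis unfolding S_def Wh_def calabi_bach h v3 v4 X_def[symmetric]
      by (rule arg_cong[where f = "\<lambda>F. coord2 _ F i j"]) (auto simp: fun_eq_iff)
  qed
  finally show ?thesis .
qed

lemma bach_zero_iff: "(\<forall>b c. bach g x b c = 0) \<longleftrightarrow> 4 * A1 * A4 - A2 * A3 = 0"
proof -
  define X where "X = (4 * A1 * A4 - A2 * A3) / (2 * (x $ 3)\<^sup>2)"
  have X0: "X = 0 \<longleftrightarrow> 4 * A1 * A4 - A2 * A3 = 0" using z_nonzero[OF x] by (simp add: X_def)
  have "(\<forall>a b. kronecker a b * ((if a = 1 \<or> a = 2 then - 1 else 1) * X) = 0) \<longleftrightarrow> X = 0"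
  proof
    assume *: "\<forall>a b. kronecker a b * ((if a = 1 \<or> a = 2 then - 1 else 1) * X) = 0"
    from *[rule_format, of 3 3] show "X = 0" by (simp add: kronecker_def)
  qed simp
  then show ?thesis unfolding bach_quartic coord2_eq_0_iff[OF kaehler.B_\<theta>[OF x]] X_def[symmetric] X0 .
qed

text \<open>Comparison of the eigenvalues on the two planes.\<close>

lemma einstein_iff:
  "ricci g x = t *\<^sub>R g x \<longleftrightarrow> 2 * (p (x $ 3) + s (x $ 3)) = t \<and> 2 * (q (x $ 3) + s (x $ 3)) = t"
proof -
  let ?F = "\<lambda>a b. split_form (2 * (p (x $ 3) + s (x $ 3))) (2 * (q (x $ 3) + s (x $ 3))) a b - t * kronecker a b"
  have e: "ricci g x $ i $ j - t * g x $ i $ j = coord2 (kaehler.\<theta> x) ?F i j" for i j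
    unfolding ricci_quartic[OF x] metric_frame coord2_linear ..
  have "ricci g x = t *\<^sub>R g x \<longleftrightarrow> (\<forall>i j. ricci g x $ i $ j - t * g x $ i $ j = 0)"
    by (simp add: vec_eq_iff)
  then have "ricci g x = t *\<^sub>R g x \<longleftrightarrow> (\<forall>i j. coord2 (kaehler.\<theta> x) ?F i j = 0)"
    unfolding e .
  also have "\<dots> \<longleftrightarrow> (\<forall>a b. ?F a b = 0)" by (rule coord2_eq_0_iff[OF kaehler.B_\<theta>[OF x]])
  also have "\<dots> \<longleftrightarrow> 2 * (p (x $ 3) + s (x $ 3)) = t \<and> 2 * (q (x $ 3) + s (x $ 3)) = t"
  proof
    assume *: "\<forall>a b. ?F a b = 0"
    have "?F 1 1 = 0" "?F 3 3 = 0" using * by blast+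
    then
    show "2 * (p (x $ 3) + s (x $ 3)) = t \<and> 2 * (q (x $ 3) + s (x $ 3)) = t"
      by (simp add: split_form_def kronecker_def)
  qed (simp add: split_form_def kronecker_def)
  finally show ?thesis .
qed

lemma conformal_scal_quartic:
  "scal (\<lambda>x. (1 / (x $ 3)\<^sup>2) *\<^sub>R g x) x = - 6 * A3 - 12 * A4 / x $ 3"
  unfolding scal_conformal[OF x] V_eq[OF x] Y1_eq[OF x] Y2_eq[OF x] Y_def
  using z_nonzero[OF x] by (simp add: field_simps power2_eq_square power3_eq_cube)

end

end

section \<open>The complex structures and holomorphic potentials\<close>

text \<open>For symmetric \<open>M\<close> the twist is the covector obtained by applying first \<open>E\<close> and then \<open>M\<close>, so it
  can be computed from the action of \<open>E\<close> on the coordinate vectors.\<close>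

lemma twist_component:
  assumes "transpose M = M"
  shows "twist M E $ i $ j = (M *v (E *v axis i 1)) $ j"
proof -
  have "M $ k $ j = M $ j $ k" for k using assms by (simp add: transpose_def vec_eq_iff)
  then show ?thesis
    unfolding matrix_vector_mult_basis
    by (simp add: twist_def matrix_matrix_mult_def transpose_def matrix_vector_mult_def column_def mult.commute)
qed

lemma transpose_outer: "transpose E ** outer a b = outer (transpose E *v a) b"
  by (simp add: vec_eq_iff matrix_matrix_mult_def matrix_vector_mult_def outer_def sum_distrib_right mult.assoc)

definition profile_form ::
    "(real^2 \<Rightarrow> real^2) \<Rightarrow> (real^2 \<Rightarrow> real^2) \<Rightarrow> (real^2 \<Rightarrow> real^2) \<Rightarrow> real^4 \<Rightarrow> real^4^4" where
  "profile_form u v \<alpha> x = x $ 3 *\<^sub>R wedge (pull1 (u (base x))) (pull1 (v (base x))) + wedge (axis 3 1) (contact_form \<alpha> x)"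

locale kaehler_profile = momentum_profile D N u v \<phi> \<alpha> k V V1 V2 g
  for D :: "(real^2) set" and N :: "(real^4) set" and u v \<phi> \<alpha> :: "real^2 \<Rightarrow> real^2" and k :: "real^2 \<Rightarrow> real"
    and V V1 V2 :: "real \<Rightarrow> real" and g :: "real^4 \<Rightarrow> real^4^4" +
  fixes J :: "real^4 \<Rightarrow> real^4^4"
  assumes form: "x \<in> N \<Longrightarrow> twist (g x) (J x) = profile_form u v \<alpha> x"
begin

abbreviation "\<eta> \<equiv> contact_form \<alpha>"

lemma \<eta>_component [simp]: "\<eta> x $ 3 = 0" "\<eta> x $ 4 = 1"
  by (simp_all add: contact_form_def pull1_eq axis_def)

context
  fixes x assumes x: "x \<in> N"
begin

private abbreviation (input) "z \<equiv> x $ 3"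

lemma zV: "z \<noteq> 0" "V z \<noteq> 0" "z > 0" "V z > 0"
  using z_pos[OF x] V_pos[OF x] by auto

lemma inv_g: "matrix_inv (g x) ** g x = mat 1" "g x ** matrix_inv (g x) = mat 1"
  using metric_inverse_left[OF kaehler.B_\<theta>[OF x] kaehler.metric[OF x]] matrix_left_right_inverse by blast+

lemma g_cancel: "g x *v a = g x *v b \<Longrightarrow> a = b"
  by (metis inv_g(1) matrix_vector_mul_assoc matrix_vector_mul_lid)

lemma g_sym: "transpose (g x) = g x"
  unfolding kaehler.metric[OF x] by (simp add: matrix_transpose_mul)

lemma g_z: "g x *v axis 3 1 = (z / V z) *\<^sub>R axis 3 1"
  unfolding matrix_vector_mult_basis metric_eq[OF x] profile_metric_def base_metric_def contact_form_def
  by (simp add: vec_eq_iff column_def outer_def pull1_eq axis_def)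

lemma g_t: "g x *v axis 4 1 = (V z / z) *\<^sub>R \<eta> x"
  unfolding matrix_vector_mult_basis metric_eq[OF x] profile_metric_def base_metric_def contact_form_def
  by (simp add: vec_eq_iff column_def outer_def pull1_eq axis_def)

lemma form_\<eta>: "twist (g x) (J x) = z *\<^sub>R wedge (pull1 (u (base x))) (pull1 (v (base x))) + wedge (axis 3 1) (\<eta> x)"
  using form[OF x] by (simp only: profile_form_def)

lemma gJ: "g x *v (J x *v axis 3 1) = \<eta> x" "g x *v (J x *v axis 4 1) = - axis 3 1"
proof -
  have "(g x *v (J x *v axis 3 1)) $ j = \<eta> x $ j" "(g x *v (J x *v axis 4 1)) $ j = (- axis 3 1) $ j" for j
    unfolding twist_component[OF g_sym, symmetric] form_\<eta>
    by (simp_all add: wedge_component pull1_eq axis_def)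
  then show "g x *v (J x *v axis 3 1) = \<eta> x" "g x *v (J x *v axis 4 1) = - axis 3 1"
    by (simp_all add: vec_eq_iff)
qed

lemma J_z: "J x *v axis 3 1 = (z / V z) *\<^sub>R axis 4 1"
  by (rule g_cancel) (use zV in \<open>simp add: gJ g_t matrix_vector_mult_scaleR\<close>)

lemma J_t: "J x *v axis 4 1 = - (V z / z) *\<^sub>R axis 3 1"
  by (rule g_cancel) (use zV in \<open>simp add: gJ g_z matrix_vector_mult_scaleR vec.neg\<close>)

lemma inv_g_z: "matrix_inv (g x) *v axis 3 1 = (V z / z) *\<^sub>R axis 3 1"
  by (rule g_cancel) (use zV in \<open>simp add: matrix_vector_mul_assoc inv_g g_z matrix_vector_mult_scaleR\<close>)

text \<open>The gradient of \<open>z\<close> is \<open>V / z\<close> times the coordinate field \<open>\<partial>/\<partial>z\<close>, and \<open>J\<close> maps it to the Killing field: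
  \<open>z\<close> is its momentum map.\<close>

lemma J_gradient:
  assumes "\<And>i. pd i f x = (if i = 3 then f' else 0)"
  shows "J x *v gradient g f x = f' *\<^sub>R axis 4 1"
proof -
  have "(\<chi> i. pd i f x) = f' *\<^sub>R axis 3 1" by (simp add: assms vec_eq_iff axis_def)
  then show ?thesis
    using zV by (simp add: gradient_def matrix_vector_mult_scaleR inv_g_z J_z)
qed

text \<open>\<open>J\<close> and the inverse metric are invertible, so the gradient, hence the differential, is determined by
  its image.\<close>

lemma J_gradient_converse:
  assumes JJ: "J x ** J x = - mat 1" and f: "f' *\<^sub>R axis 4 1 = J x *v gradient g f x"
  shows "pd i f x = (if i = 3 then f' else 0)"
proof -
  have "(- mat 1) *v y = - y" for y :: "real^4"
    by (simp add: vec_eq_iff matrix_vector_mult_def mat_def sum_negf if_distrib[of "\<lambda>t. t * _"] cong: if_cong)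
  then have "J x *v (J x *v gradient g f x) = - gradient g f x"
    unfolding matrix_vector_mul_assoc JJ .
  then have "gradient g f x = (f' * (V z / z)) *\<^sub>R axis 3 1"
    unfolding f[symmetric] matrix_vector_mult_scaleR J_t by (simp add: minus_equation_iff[of _ "gradient g f x"] eq_commute)
  then have "g x *v gradient g f x = f' *\<^sub>R axis 3 1"
    using zV by (simp add: matrix_vector_mult_scaleR g_z)
  then have "(\<chi> i. pd i f x) = f' *\<^sub>R axis 3 1"
    by (simp add: gradient_def matrix_vector_mul_assoc inv_g)
  then show ?thesis by (simp add: vec_eq_iff axis_def)
qed

text \<open>On the vertical plane \<open>J\<close> rotates \<open>e\<^sub>3\<close> to \<open>e\<^sub>4\<close>, so twisting the split form by \<open>J\<close> weights the two
  summands of the Kaehler form by \<open>P\<close> and \<open>Q\<close>.\<close>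

lemma twist_split:
  assumes "\<And>i j. M $ i $ j = coord2 (kaehler.\<theta> x) (split_form P Q) i j"
  shows "twist M (J x) = P *\<^sub>R twist (g x) (J x) + (Q - P) *\<^sub>R wedge (axis 3 1) (\<eta> x)"
proof -
  have M: "M = P *\<^sub>R g x + (Q - P) *\<^sub>R ((z / V z) *\<^sub>R outer (axis 3 1) (axis 3 1) + (V z / z) *\<^sub>R outer (\<eta> x) (\<eta> x))"
  proof -
    have "coord2 (kaehler.\<theta> x) (split_form P Q) i j = P * g x $ i $ j + (Q - P) *
       (kaehler.e3 x $ i * kaehler.e3 x $ j + kaehler.e4 x $ i * kaehler.e4 x $ j)" for i j
      unfolding kaehler.metric_component[OF x]
      by (simp add: coord2_def coord1_def sum_4 split_form_def kaehler.\<theta>_def algebra_simps)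
    moreover have "kaehler.e3 x $ i * kaehler.e3 x $ j = z / V z * (axis 3 1 $ i * axis 3 1 $ j)"
      "kaehler.e4 x $ i * kaehler.e4 x $ j = V z / z * (\<eta> x $ i * \<eta> x $ j)" for i j
    proof -
      have "kaehler.e3 x $ i * kaehler.e3 x $ j = 1 / (m z * m z) * (axis 3 1 $ i * axis 3 1 $ j)"
        by (simp add: kaehler.e3_def)
      then show "kaehler.e3 x $ i * kaehler.e3 x $ j = z / V z * (axis 3 1 $ i * axis 3 1 $ j)"
        unfolding m_square(2)[OF x] by simp
      have "kaehler.e4 x $ i * kaehler.e4 x $ j = m z * m z * (\<eta> x $ i * \<eta> x $ j)"
        by (simp add: kaehler.e4_def contact_form_def)
      then show "kaehler.e4 x $ i * kaehler.e4 x $ j = V z / z * (\<eta> x $ i * \<eta> x $ j)"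
        unfolding m_square(2)[OF x] .
    qed
    ultimately show ?thesis using assms by (simp add: vec_eq_iff outer_def algebra_simps)
  qed
  have tz: "transpose (J x) *v axis 3 1 = - (V z / z) *\<^sub>R \<eta> x"
  proof -
    have "transpose (J x) *v (g x *v axis 3 1) = - \<eta> x"
      unfolding matrix_vector_mul_assoc twist_def[symmetric] form_\<eta> unfolding matrix_vector_mult_basis
      by (simp add: vec_eq_iff column_def wedge_component pull1_eq axis_def)
    then have "(z / V z) *\<^sub>R (transpose (J x) *v axis 3 1) = - \<eta> x"
      unfolding g_z matrix_vector_mult_scaleR .
    then have "(V z / z) *\<^sub>R ((z / V z) *\<^sub>R (transpose (J x) *v axis 3 1)) = (V z / z) *\<^sub>R (- \<eta> x)" by simp
    then show ?thesis using zV by simp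
  qed
  have tt: "transpose (J x) *v \<eta> x = (z / V z) *\<^sub>R axis 3 1"
  proof -
    have "transpose (J x) *v (g x *v axis 4 1) = axis 3 1"
      unfolding matrix_vector_mul_assoc twist_def[symmetric] form_\<eta> unfolding matrix_vector_mult_basis
      by (simp add: vec_eq_iff column_def wedge_component pull1_eq axis_def)
    then have "(V z / z) *\<^sub>R (transpose (J x) *v \<eta> x) = axis 3 1"
      unfolding g_t matrix_vector_mult_scaleR .
    then have "(z / V z) *\<^sub>R ((V z / z) *\<^sub>R (transpose (J x) *v \<eta> x)) = (z / V z) *\<^sub>R axis 3 1" by simp
    then show ?thesis using zV by simp
  qed
  have ml: "transpose (J x) ** (a *\<^sub>R X + b *\<^sub>R Y) = a *\<^sub>R (transpose (J x) ** X) + b *\<^sub>R (transpose (J x) ** Y)" for a b and X Y :: "real^4^4"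
    by (simp add: vec_eq_iff matrix_matrix_mult_def sum.distrib sum_distrib_left algebra_simps)
  have "transpose (J x) ** ((z / V z) *\<^sub>R outer (axis 3 1) (axis 3 1) + (V z / z) *\<^sub>R outer (\<eta> x) (\<eta> x)) = wedge (axis 3 1) (\<eta> x)"
    unfolding ml transpose_outer tz tt using zV
    by (simp add: vec_eq_iff outer_def wedge_component)
  then show ?thesis unfolding twist_def M ml by simp
qed

text \<open>Reversing \<open>J\<close> on the horizontal plane reverses the sign of the horizontal summand of the Kaehler form.
  The hypotheses describe the complex structure by the vertical span and its orthogonal complement,
  so an arbitrary vector is first decomposed accordingly.\<close>

lemma twist_opposite:
  assumes vert: "\<forall>w\<in>span {axis 4 1, J x *v axis 4 1}. E *v w = J x *v w"
    and hor: "\<forall>w. (\<forall>y\<in>span {axis 4 1, J x *v axis 4 1}. w \<bullet> (g x *v y) = 0) \<longrightarrow> E *v w = - (J x *v w)"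
  shows "twist (g x) E = - twist (g x) (J x) + 2 *\<^sub>R wedge (axis 3 1) (\<eta> x)"
proof -
  let ?S = "span {axis 4 1, J x *v axis 4 1}"
  have e4: "axis 4 1 \<in> ?S" by (simp add: span_base)
  have "(- z / V z) *\<^sub>R (J x *v axis 4 1) \<in> ?S" by (intro span_mul span_base) simp
  then have e3: "axis 3 1 \<in> ?S" using zV by (simp add: J_t)
  have E: "E *v w = - (J x *v w) + 2 *\<^sub>R (w $ 3 *\<^sub>R (J x *v axis 3 1) + (\<eta> x \<bullet> w) *\<^sub>R (J x *v axis 4 1))" for w
  proof -
    define p where "p = w $ 3 *\<^sub>R axis 3 1 + (\<eta> x \<bullet> w) *\<^sub>R (axis 4 1 :: real^4)"
    have "p \<in> ?S" unfolding p_def by (intro span_add span_mul e3 e4)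
    then have 1: "E *v p = J x *v p" using vert by blast
    have o: "(w - p) \<bullet> (g x *v y) = 0" if "y \<in> ?S" for y
      using that
    proof (induction rule: span_induct)
      show "subspace {y. (w - p) \<bullet> (g x *v y) = 0}"
        by (rule subspaceI) (simp_all add: matrix_vector_right_distrib inner_add_right matrix_vector_mult_scaleR)
      fix y assume "y \<in> {axis 4 1, J x *v axis 4 1}"
      moreover have "(w - p) \<bullet> \<eta> x = 0"
      proof -
        have a: "axis 3 1 \<bullet> \<eta> x = 0" "axis 4 1 \<bullet> \<eta> x = 1" by (simp_all add: inner_axis')
        show ?thesis unfolding p_def inner_diff_left inner_add_left inner_scaleR_left a by (simp add: inner_commute)
      qed
      moreover have "(w - p) \<bullet> axis 3 1 = 0"
      proof -
        have "(w - p) $ 3 = 0" by (simp add: p_def axis_def)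
        then show ?thesis by (simp only: inner_axis) simp
      qed
      ultimately show "(w - p) \<bullet> (g x *v y) = 0" by (auto simp: g_t gJ)
    qed
    have 2: "E *v (w - p) = - (J x *v w - J x *v p)"
      using hor o unfolding matrix_vector_mult_diff_distrib[symmetric] by blast
    have "E *v w = E *v p + E *v (w - p)" by (simp flip: matrix_vector_right_distrib)
    also have "\<dots> = - (J x *v w) + 2 *\<^sub>R (J x *v p)"
      unfolding 1 2 by (simp add: scaleR_2)
    finally have "E *v w = - (J x *v w) + 2 *\<^sub>R (J x *v p)" .
    then show ?thesis by (simp add: p_def matrix_vector_right_distrib matrix_vector_mult_scaleR)
  qed
  have lin: "g x *v (- a + 2 *\<^sub>R (s *\<^sub>R b + t *\<^sub>R c)) = - (g x *v a) + 2 *\<^sub>R (s *\<^sub>R (g x *v b) + t *\<^sub>R (g x *v c))" for a b c s t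
    by (simp add: matrix_vector_right_distrib matrix_vector_mult_diff_distrib matrix_vector_mult_scaleR)
  have "twist (g x) E $ i $ j = (- twist (g x) (J x) + 2 *\<^sub>R wedge (axis 3 1) (\<eta> x)) $ i $ j" for i j
    unfolding twist_component[OF g_sym] E lin gJ
    by (simp add: twist_component[OF g_sym] wedge_component inner_axis) (simp add: axis_def)
  then show ?thesis by (simp add: vec_eq_iff)
qed

text \<open>The square of \<open>P \<omega>\<^sub>1 + Q \<omega>\<^sub>2\<close> with simple two-forms \<open>\<omega>\<^sub>1, \<omega>\<^sub>2\<close> is \<open>2 P Q \<omega>\<^sub>1 \<and> \<omega>\<^sub>2\<close>. The factor
  four is the normalization in the definition of the pfaffian.\<close>

lemma pfaffian_split:
  assumes "\<And>i j. M $ i $ j = coord2 (kaehler.\<theta> x) (split_form P Q) i j"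
  shows "4 * wedge4 (twist M (J x)) (twist M (J x)) / wedge4 (twist (g x) (J x)) (twist (g x) (J x)) = 4 * (P * Q)"
proof -
  define \<sigma> where "\<sigma> = z * (u (base x) $ 1 * v (base x) $ 2 - v (base x) $ 1 * u (base x) $ 2)"
  have \<sigma>: "\<sigma> > 0" using area[OF base_N[OF x]] zV by (simp add: \<sigma>_def)
  have w: "wedge4 (P *\<^sub>R twist (g x) (J x) + (Q - P) *\<^sub>R wedge (axis 3 1) (\<eta> x)) (P *\<^sub>R twist (g x) (J x) + (Q - P) *\<^sub>R wedge (axis 3 1) (\<eta> x))
     = 2 * (P * Q) * \<sigma>" for P Q
    unfolding form_\<eta> \<sigma>_def
    by (simp add: wedge4_def wedge_component pull1_eq axis_def algebra_simps)
  show ?thesis unfolding twist_split[OF assms] w using w[of 1 1] \<sigma> by simp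
qed

text \<open>The Lie derivative along \<open>F K\<close> of the metric is the symmetrized product of \<open>d F\<close> and the covector dual to the
  Killing field \<open>K\<close>. As \<open>K\<close> has no zeros, it vanishes only with \<open>d F\<close>.\<close>

lemma lie_metric_momentum:
  assumes K: "\<And>a b. lie_metric g (\<lambda>x. axis 4 1) x a b = 0"
    and X: "\<And>y. y \<in> N \<Longrightarrow> X y = F (y $ 3) *\<^sub>R axis 4 1" and F: "(F has_real_derivative F') (at z)"
  shows "(\<forall>a b. lie_metric g X x a b = 0) \<longleftrightarrow> F' = 0"
proof -
  have d4: "pd 4 (\<lambda>y. g y $ a $ b) x = 0" for a b
    using K[of a b] by (simp add: lie_metric_def sum_4 axis_def)
  have dX: "pd a (\<lambda>y. X y $ i) x = (if i = 4 \<and> a = 3 then F' else 0)" for a i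
  proof -
    have "pd a (\<lambda>y. X y $ i) x = pd a (\<lambda>y. F (y $ 3) * axis 4 1 $ i) x"
      by (rule pd_cong[OF open_N x]) (simp add: X)
    also have "\<dots> = (if i = 4 \<and> a = 3 then F' else 0)"
      using pd_coordinate_function[OF F] by (cases "i = 4") (auto simp: axis_def)
    finally show ?thesis .
  qed
  have L: "lie_metric g X x a b = (if a = 3 then g x $ 4 $ b * F' else 0) + (if b = 3 then g x $ a $ 4 * F' else 0)" for a b
    unfolding lie_metric_def dX by (simp add: sum_4 d4 X[OF x] axis_def)
  have "g x $ 4 $ 4 \<noteq> 0"
    using arg_cong[OF g_t, of "\<lambda>w. w $ 4"] zV by (simp add: matrix_vector_mult_basis column_def)
  then have "lie_metric g X x 3 4 = 0 \<longleftrightarrow> F' = 0" unfolding L by simp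
  then show ?thesis using L by auto
qed

end

text \<open>For \<open>f = h z\<close> the field \<open>J grad f\<close> is \<open>h' z\<close> times the Killing field, so \<open>f\<close> is a holomorphic potential iff
  it is affine in \<open>z\<close>.\<close>

lemma holomorphic_potential_iff:
  assumes x: "x \<in> N" and K: "\<And>a b. lie_metric g (\<lambda>x. axis 4 1) x a b = 0"
    and f: "\<And>y. y \<in> N \<Longrightarrow> f y = h (y $ 3)" and h: "\<And>y. y \<in> N \<Longrightarrow> (h has_real_derivative h1 (y $ 3)) (at (y $ 3))"
    and h1: "(h1 has_real_derivative h2) (at (x $ 3))"
  shows "(\<forall>a b. lie_metric g (\<lambda>x. J x *v gradient g f x) x a b = 0) \<longleftrightarrow> h2 = 0"
proof (rule lie_metric_momentum[OF x K _ h1])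
  fix y assume y: "y \<in> N"
  have "pd i f y = (if i = 3 then h1 (y $ 3) else 0)" for i
    using pd_cong[OF open_N y, of f "\<lambda>y. h (y $ 3)"] f pd_coordinate_function[OF h[OF y]] by auto
  then show "J y *v gradient g f y = h1 (y $ 3) *\<^sub>R axis 4 1" by (rule J_gradient[OF y])
qed

end

section \<open>Calabi surfaces\<close>

lemma coords_calabi_manifold:
  "x \<in> coords (calabi_manifold S W) i \<longleftrightarrow> (\<exists>p. p \<in> cdom S i \<and> (p, x $ 3, x $ 4) \<in> W \<and> base x = crd S i p)"
proof
  assume "x \<in> coords (calabi_manifold S W) i"
  then show "\<exists>p. p \<in> cdom S i \<and> (p, x $ 3, x $ 4) \<in> W \<and> base x = crd S i p"
    by (auto simp: coords_def calabi_manifold_def base_def vec_eq_iff forall_2)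
next
  assume "\<exists>p. p \<in> cdom S i \<and> (p, x $ 3, x $ 4) \<in> W \<and> base x = crd S i p"
  then obtain p where p: "p \<in> cdom S i" "(p, x $ 3, x $ 4) \<in> W" "base x = crd S i p" by blast
  have "base x $ 1 = x $ 1" "base x $ 2 = x $ 2" by (simp_all add: base_def)
  then have "x = vector [crd S i p $ 1, crd S i p $ 2, x $ 3, x $ 4]"
    using p(3) by (simp add: vec_eq_iff forall_4)
  then show "x \<in> coords (calabi_manifold S W) i"
    using p(1,2) by (force simp: coords_def calabi_manifold_def)
qed

lemma pull2_sum_outer: "pull2 (outer a a + outer b b) = outer (pull1 a) (pull1 a) + outer (pull1 b) (pull1 b)"
  by (simp add: vec_eq_iff forall_4 pull2_component outer_def pull1_eq)

text \<open>The manifold is covered by coordinates \<open>(y, z, t)\<close> with \<open>y\<close> a coordinate of the surface and \<open>(z, t)\<close>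
  global. All quantities of interest are functions of \<open>z\<close>, which ranges over the image of \<open>W\<close>; this is an
  open interval because \<open>W\<close> is open and connected.\<close>

locale calabi_surface_data =
  fixes S :: "('i, 's::{t2_space, second_countable_topology}, 2) atlas"
    and W :: "('s \<times> real \<times> real) set" and V :: "real \<Rightarrow> real"
    and gS :: "'i \<Rightarrow> real^2 \<Rightarrow> real^2^2" and al :: "'i \<Rightarrow> real^2 \<Rightarrow> real^2"
    and g J I :: "'i \<Rightarrow> real^4 \<Rightarrow> real^4^4" and K :: "'i \<Rightarrow> real^4 \<Rightarrow> real^4"
    and M :: "('i, 's \<times> real \<times> real, 4) atlas"
  assumes calabi: "calabi_surface S gS al V W g J K I" and M: "M = calabi_manifold S W"
begin

definition Z :: "real set" where "Z = fst ` snd ` W"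

lemma idx_M: "idx M = idx S" by (simp add: M calabi_manifold_def)

lemma type: "calabi_type M g J K I (\<lambda>i x. x $ 3)"
  using calabi unfolding calabi_surface_def M by blast

lemma K_eq: "K i x = axis 4 1"
  using calabi unfolding calabi_surface_def by blast

lemma Z_open: "open Z" and Z_connected: "connected Z" and Z_nonempty: "Z \<noteq> {}"
proof -
  have W: "open W" "connected W" "W \<noteq> {}" using calabi by (auto simp: calabi_surface_def)
  show "open Z" unfolding Z_def using W(1) by (intro open_image_fst open_image_snd)
  show "connected Z" unfolding Z_def
    by (intro connected_continuous_image W(2) continuous_intros)
  show "Z \<noteq> {}" using W(3) by (simp add: Z_def)
qed

lemma Z_pos: "z \<in> Z \<Longrightarrow> z > 0" "z \<in> Z \<Longrightarrow> V z > 0" "z \<in> Z \<Longrightarrow> (deriv ^^ n) V differentiable (at z)"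
  using calabi by (auto simp: calabi_surface_def Z_def)

lemma coords_Z: "x \<in> coords M i \<Longrightarrow> x $ 3 \<in> Z"
  unfolding M coords_calabi_manifold Z_def by force

lemma coords_base: "x \<in> coords M i \<Longrightarrow> base x \<in> coords S i"
  unfolding M coords_calabi_manifold by (auto simp: coords_def)

lemma Z_coords:
  assumes "z \<in> Z" obtains i x where "i \<in> idx M" "x \<in> coords M i" "x $ 3 = z"
proof -
  obtain p t where p: "(p, z, t) \<in> W" using assms by (force simp: Z_def)
  then have "p \<in> points S" using calabi by (force simp: calabi_surface_def)
  then obtain i where i: "i \<in> idx S" "p \<in> cdom S i" by (auto simp: points_def)
  define x :: "real^4" where "x = vector [crd S i p $ 1, crd S i p $ 2, z, t]"
  have "base x = crd S i p" by (simp add: base_def x_def vec_eq_iff forall_2)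
  then have "x \<in> coords M i" unfolding M coords_calabi_manifold using i p by (auto simp: x_def)
  then show ?thesis using that[of i x] i by (simp add: idx_M x_def)
qed

lemma base_coords:
  assumes i: "i \<in> idx S" and y: "y \<in> coords S i" obtains x where "x \<in> coords M i" "base x = y"
proof -
  obtain p where p: "p \<in> cdom S i" "y = crd S i p" using y by (auto simp: coords_def)
  then have "p \<in> points S" using i by (auto simp: points_def)
  then obtain z t where W: "(p, z, t) \<in> W" using calabi by (force simp: calabi_surface_def)
  define x :: "real^4" where "x = vector [y $ 1, y $ 2, z, t]"
  have b: "base x = y" by (simp add: base_def x_def vec_eq_iff forall_2)
  then have "x \<in> coords M i" unfolding M coords_calabi_manifold using p W by (auto simp: x_def)
  then show ?thesis using that b by blast
qed

lemma coords_open: "i \<in> idx M \<Longrightarrow> open (coords M i)"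
  using type by (simp add: calabi_type_def kaehler_surface_def oriented_atlas_def smooth_atlas_def)

text \<open>A statement about \<open>z\<close> at all points of the manifold is a statement about all values of \<open>z\<close>; this reduces
  each of the equivalences in the theorem to an identity of functions on an interval.\<close>

lemma everywhere_Z: "everywhere M (\<lambda>i x. P (x $ 3)) \<longleftrightarrow> (\<forall>z\<in>Z. P z)"
  unfolding everywhere_def using coords_Z by (metis Z_coords)

lemma everywhere_cong:
  "(\<And>i x. i \<in> idx M \<Longrightarrow> x \<in> coords M i \<Longrightarrow> P i x \<longleftrightarrow> Q i x) \<Longrightarrow> everywhere M P \<longleftrightarrow> everywhere M Q"
  by (auto simp: everywhere_def)

lemma killing_K: "i \<in> idx M \<Longrightarrow> x \<in> coords M i \<Longrightarrow> lie_metric (g i) (\<lambda>x. axis 4 1) x a b = 0"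
  using type by (simp add: calabi_type_def killing_def everywhere_def K_eq[abs_def])

lemma J_square: "i \<in> idx M \<Longrightarrow> x \<in> coords M i \<Longrightarrow> J i x ** J i x = - mat 1"
  using type by (simp add: calabi_type_def kaehler_surface_def kaehler_def everywhere_def)

lemma opposite:
  assumes "i \<in> idx M" "x \<in> coords M i"
  shows "\<forall>w\<in>span {axis 4 1, J i x *v axis 4 1}. I i x *v w = J i x *v w"
    "\<forall>w. (\<forall>y\<in>span {axis 4 1, J i x *v axis 4 1}. w \<bullet> (g i x *v y) = 0) \<longrightarrow> I i x *v w = - (J i x *v w)"
  using type assms by (auto simp: calabi_type_def calabi_opposite_def everywhere_def K_eq)

text \<open>In each chart the abstract data determine a surface coframe and the explicit shape of metric and Kaehler
  form; the area form of the surface is \<open>u \<and> v\<close> because the square of its coefficient is the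
  determinant of the metric.\<close>

lemma chart:
  assumes i: "i \<in> idx M"
  obtains u v \<phi> where "calabi_base (coords S i) (coords M i) u v \<phi> (al i) (gauss_curvature (gS i))"
    and "smooth_on (coords S i) (gauss_curvature (gS i))"
    and "\<And>x. x \<in> coords M i \<Longrightarrow> g i x = profile_metric u v (al i) V x"
    and "\<And>x. x \<in> coords M i \<Longrightarrow> twist (g i x) (J i x) = profile_form u v (al i) x"
proof -
  have iS: "i \<in> idx S" using i by (simp add: idx_M)
  have D: "open (coords S i)"
    using calabi iS by (simp add: calabi_surface_def oriented_atlas_def smooth_atlas_def)
  have gS: "smooth_on (coords S i) (gS i)" "\<And>x. x \<in> coords S i \<Longrightarrow> transpose (gS i x) = gS i x"
    "\<And>x w. x \<in> coords S i \<Longrightarrow> w \<noteq> 0 \<Longrightarrow> w \<bullet> (gS i x *v w) > 0"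
    using calabi iS by (auto simp: calabi_surface_def riemannian_metric_def everywhere_def)
  have al: "smooth_on (coords S i) (al i)" "\<And>x. x \<in> coords S i \<Longrightarrow> ext_d (al i) x = area_form (gS i x)"
    using calabi iS by (auto simp: calabi_surface_def one_form_def everywhere_def)
  obtain u v \<phi> where uv: "\<And>i'. smooth_on (coords S i) (\<lambda>x. u x $ i')" "\<And>i'. smooth_on (coords S i) (\<lambda>x. v x $ i')"
      "\<And>i'. smooth_on (coords S i) (\<lambda>x. \<phi> x $ i')"
    and k: "smooth_on (coords S i) (gauss_curvature (gS i))"
    and gS_eq: "\<And>x. x \<in> coords S i \<Longrightarrow> gS i x = outer (u x) (u x) + outer (v x) (v x)"
    and area: "\<And>x. x \<in> coords S i \<Longrightarrow> u x $ 1 * v x $ 2 - v x $ 1 * u x $ 2 > 0"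
    and du: "\<And>x. x \<in> coords S i \<Longrightarrow> ext_d u x = wedge (\<phi> x) (v x)"
    and dv: "\<And>x. x \<in> coords S i \<Longrightarrow> ext_d v x = - wedge (\<phi> x) (u x)"
    and d\<phi>: "\<And>x. x \<in> coords S i \<Longrightarrow> ext_d \<phi> x = - gauss_curvature (gS i) x *\<^sub>R wedge (u x) (v x)"
    by (rule surface_coframe[OF D gS]) (assumption | rule that)+
  have area_form: "area_form (gS i y) = wedge (u y) (v y)" if y: "y \<in> coords S i" for y
  proof -
    have "det (gS i y) = (u y $ 1 * v y $ 2 - v y $ 1 * u y $ 2)\<^sup>2"
      unfolding gS_eq[OF y] by (simp add: det_2 outer_def power2_eq_square algebra_simps)
    then have "sqrt (det (gS i y)) = u y $ 1 * v y $ 2 - v y $ 1 * u y $ 2"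
      using area[OF y] by simp
    then show ?thesis
      unfolding area_form_def by (simp add: vec_eq_iff forall_2 wedge_component axis_def)
  qed
  have "calabi_base (coords S i) (coords M i) u v \<phi> (al i) (gauss_curvature (gS i))"
  proof
    show "open (coords S i)" "open (coords M i)" using D coords_open[OF i] by auto
    show "smooth_on (coords S i) (\<lambda>y. al i y $ j)" for j by (rule smooth_component[OF D al(1)])
    show "ext_d (al i) y = wedge (u y) (v y)" if "y \<in> coords S i" for y
      using al(2)[OF that] area_form[OF that] by simp
  qed (use uv area du dv d\<phi> coords_base in auto)
  moreover have "g i x = profile_metric u v (al i) V x"
    if x: "x \<in> coords M i" for x
  proof -
    have "g i x = calabi_metric gS al V i x" using calabi by (simp add: calabi_surface_def)
    then show ?thesis
      by (simp add: calabi_metric_def Let_def connection_form_def gS_eq[OF coords_base[OF x]] pull2_sum_outer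
        profile_metric_def base_metric_def contact_form_def)
  qed
  moreover have "twist (g i x) (J i x) = profile_form u v (al i) x" if x: "x \<in> coords M i" for x
  proof -
    have "twist (g i x) (J i x) = calabi_form gS al i x"
    proof -
      have "everywhere (calabi_manifold S W) (\<lambda>i x. twist (g i x) (J i x) = calabi_form gS al i x)"
        using calabi unfolding calabi_surface_def by blast
      then show ?thesis using i x by (simp add: everywhere_def M)
    qed
    then show ?thesis
      by (simp add: calabi_form_def Let_def connection_form_def area_form[OF coords_base[OF x]] pull2_wedge
        profile_form_def contact_form_def)
  qed
  ultimately show ?thesis using that k by blast
qed

lemma V_derivatives: "z \<in> Z \<Longrightarrow> (V has_real_derivative deriv V z) (at z)"
    "z \<in> Z \<Longrightarrow> (deriv V has_real_derivative deriv (deriv V) z) (at z)"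
    "z \<in> Z \<Longrightarrow> (deriv (deriv V) has_real_derivative deriv (deriv (deriv V)) z) (at z)"
  using Z_pos(3)[of z 0] Z_pos(3)[of z 1] Z_pos(3)[of z 2]
  by (auto simp: DERIV_deriv_iff_real_differentiable numeral_2_eq_2)

lemma general_profile:
  assumes i: "i \<in> idx M"
  obtains u v \<phi> where "kaehler_profile (coords S i) (coords M i) u v \<phi> (al i) (gauss_curvature (gS i)) V (deriv V) (deriv (deriv V)) (g i) (J i)"
    and "smooth_on (coords S i) (gauss_curvature (gS i))"
proof -
  obtain u v \<phi> where c: "calabi_base (coords S i) (coords M i) u v \<phi> (al i) (gauss_curvature (gS i))"
    "smooth_on (coords S i) (gauss_curvature (gS i))"
    "\<And>x. x \<in> coords M i \<Longrightarrow> g i x = profile_metric u v (al i) V x"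
    "\<And>x. x \<in> coords M i \<Longrightarrow> twist (g i x) (J i x) = profile_form u v (al i) x"
    by (rule chart[OF i]) (assumption | rule that)+
  interpret calabi_base "coords S i" "coords M i" u v \<phi> "al i" "gauss_curvature (gS i)" by (rule c)
  have "kaehler_profile (coords S i) (coords M i) u v \<phi> (al i) (gauss_curvature (gS i)) V (deriv V) (deriv (deriv V)) (g i) (J i)"
    by unfold_locales (use c(3,4) coords_Z Z_pos V_derivatives in auto)
  then show ?thesis using that c(2) by blast
qed

lemma scalar_curvature:
  assumes "i \<in> idx M" "x \<in> coords M i"
  shows "scal (g i) x = (2 * gauss_curvature (gS i) (base x) - deriv (deriv V) (x $ 3)) / x $ 3"
proof -
  obtain u v \<phi> where "kaehler_profile (coords S i) (coords M i) u v \<phi> (al i) (gauss_curvature (gS i)) V (deriv V) (deriv (deriv V)) (g i) (J i)"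
    by (rule general_profile[OF assms(1)]) (assumption | rule that)+
  then interpret kaehler_profile "coords S i" "coords M i" u v \<phi> "al i" "gauss_curvature (gS i)" V "deriv V" "deriv (deriv V)" "g i" "J i" .
  show ?thesis by (rule scal_kaehler[OF assms(2)])
qed

text \<open>If the scalar curvature is a momentum map for \<open>t K\<close>, its differential is \<open>t dz\<close>. Differentiating
  \<open>scal_kaehler\<close> along \<open>z\<close> gives an equation in which a function on the surface equals a function of
  the momentum.\<close>

lemma momentum_map_equation:
  assumes mm: "momentum_map M g J (\<lambda>i. scal (g i)) (\<lambda>i x. t *\<^sub>R K i x)" and i: "i \<in> idx M" and x: "x \<in> coords M i"
  defines "V2 \<equiv> deriv (deriv V)" and "V3 \<equiv> deriv (deriv (deriv V))"
  shows "2 * gauss_curvature (gS i) (base x) = V2 (x $ 3) - x $ 3 * V3 (x $ 3) - t * (x $ 3)\<^sup>2"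
proof -
  obtain u v \<phi> where *: "kaehler_profile (coords S i) (coords M i) u v \<phi> (al i) (gauss_curvature (gS i)) V (deriv V) (deriv (deriv V)) (g i) (J i)"
    and sm: "smooth_on (coords S i) (gauss_curvature (gS i))"
    by (rule general_profile[OF i]) (assumption | rule that)+
  from * interpret kaehler_profile "coords S i" "coords M i" u v \<phi> "al i" "gauss_curvature (gS i)" V "deriv V" "deriv (deriv V)" "g i" "J i" .
  have z: "x $ 3 > 0" by (rule z_pos[OF x])
  have "t *\<^sub>R axis 4 1 = J i x *v gradient (g i) (scal (g i)) x"
    using mm i x by (simp add: momentum_map_def everywhere_def K_eq)
  then have "pd 3 (scal (g i)) x = t"
    using J_gradient_converse[OF x J_square[OF i x]] by simp
  moreover have "pd 3 (scal (g i)) x = - V3 (x $ 3) / x $ 3 - (2 * gauss_curvature (gS i) (base x) - V2 (x $ 3)) / (x $ 3)\<^sup>2"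
  proof -
    let ?k = "\<lambda>y. gauss_curvature (gS i) (base y)"
    have dk: "gauss_curvature (gS i) differentiable (at (base x))"
      by (rule smooth_differentiable[OF open_D sm base_N[OF x]])
    have "((\<lambda>z. 1 / z) has_real_derivative - 1 / (x $ 3)\<^sup>2) (at (x $ 3))"
      using z by (auto intro!: derivative_eq_intros simp: power2_eq_square)
    note d1 = this
    note d2 = V_derivatives(3)[OF coords_Z[OF x], folded V2_def V3_def]
    have f1: "(\<lambda>y. 2 * ?k y - V2 (y $ 3)) differentiable (at x)"
      using differentiable_base[OF dk] coordinate_function_differentiable[OF d2] by simp
    have f2: "pd 3 (\<lambda>y. 2 * ?k y - V2 (y $ 3)) x = - V3 (x $ 3)"
      using differentiable_base[OF dk] coordinate_function_differentiable[OF d2]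
      by (simp add: pd_diff pd_mult pd_base[OF dk] pd_coordinate_function[OF d2])
    have "pd 3 (scal (g i)) x = pd 3 (\<lambda>y. (2 * ?k y - V2 (y $ 3)) * (1 / y $ 3)) x"
      by (rule pd_cong[OF open_N x]) (simp add: scalar_curvature[OF i] V2_def)
    also have "\<dots> = - V3 (x $ 3) * (1 / x $ 3) + (2 * ?k x - V2 (x $ 3)) * (- 1 / (x $ 3)\<^sup>2)"
      unfolding pd_mult[OF f1 coordinate_function_differentiable[OF d1]] f2 pd_coordinate_function[OF d1] by simp
    finally show ?thesis by simp
  qed
  ultimately show ?thesis using z by (simp add: field_simps power2_eq_square)
qed

lemma Z_constant:
  assumes "\<And>z. z \<in> Z \<Longrightarrow> (f has_real_derivative 0) (at z)"
  obtains t :: real where "\<And>z. z \<in> Z \<Longrightarrow> f z = t"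
proof -
  have "convex Z" using Z_connected is_interval_connected_1 is_interval_convex_1 by blast
  then show ?thesis
    using has_field_derivative_zero_constant[of Z f] assms has_field_derivative_at_within that by metis
qed

text \<open>Both sides of \<open>momentum_map_equation\<close> are constant: the right-hand side is locally constant along the
  \<open>z\<close>-axis through each point, hence constant on the interval. So the Gauss curvature is a constant \<open>k\<close>,
  and \<open>2 k = V2 z - z * V3 z - t * z\<^sup>2\<close> for the second and third derivatives \<open>V2\<close> and \<open>V3\<close> of \<open>V\<close>.
  Equivalently \<open>(V2 z - 2 * k) / z + t * z\<close> has derivative zero; this and two further integrations
  produce the quartic.\<close>

lemma momentum_map_imp_quartic:
  assumes mm: "momentum_map M g J (\<lambda>i. scal (g i)) (\<lambda>i x. t *\<^sub>R K i x)"
  shows "\<exists>k. constant_gauss_curvature S gS k \<and> (\<exists>A1 A2 A3 A4. calabi_quartic V W k A1 A2 A3 A4)"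
proof -
  define V1 where "V1 = deriv V"
  define V2 where "V2 = deriv V1"
  define V3 where "V3 = deriv V2"
  note d = V_derivatives[folded V1_def, folded V2_def, folded V3_def]
  define E where "E z = V2 z - z * V3 z - t * z\<^sup>2" for z
  have eq: "2 * gauss_curvature (gS i) (base x) = E (x $ 3)" if "i \<in> idx M" "x \<in> coords M i" for i x
    using momentum_map_equation[OF mm that] by (simp add: E_def V1_def V2_def V3_def)
  have "(E has_real_derivative 0) (at z)" if z: "z \<in> Z" for z
  proof -
    obtain i x where x: "i \<in> idx M" "x \<in> coords M i" "x $ 3 = z" using Z_coords[OF z] by blast
    \<comment> \<open>Move from \<open>x\<close> along the momentum axis: the base point, hence the Gauss curvature, stays fixed.\<close>
    define F where "F s = x + (s - z) *\<^sub>R axis 3 (1::real)" for s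
    have F: "F s $ 3 = s" "base (F s) = base x" for s
      by (simp_all add: F_def x(3) axis_def base_def vec_eq_iff forall_2)
    have "continuous_on UNIV F" unfolding F_def by (intro continuous_intros)
    then have o: "open (F -` coords M i)" using coords_open[OF x(1)] by (simp add: open_vimage)
    have "F z = x" by (simp add: F_def)
    then have m: "z \<in> F -` coords M i" using x(2) by simp
    have c: "E z = E s" if "s \<in> F -` coords M i" for s
      using eq[OF x(1), of "F s"] eq[OF x(1,2)] that unfolding F x(3) by simp
    show ?thesis by (rule has_field_derivative_transform_within_open[OF DERIV_const[of "E z"] o m c])
  qed
  then obtain e where e: "\<And>z. z \<in> Z \<Longrightarrow> E z = e" using Z_constant by blast
  define k where "k = e / 2"
  have kc: "constant_gauss_curvature S gS k"
    unfolding constant_gauss_curvature_def everywhere_def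
  proof (intro ballI)
    fix i y assume i: "i \<in> idx S" and y: "y \<in> coords S i"
    obtain x where x: "x \<in> coords M i" "base x = y" using base_coords[OF i y] by blast
    show "gauss_curvature (gS i) y = k"
      using eq[of i x] i x e[OF coords_Z[OF x(1)]] by (simp add: idx_M k_def)
  qed
  \<comment> \<open>Integration of the equation for \<open>V\<close>, one constant at a time.\<close>
  have V3: "z * V3 z = V2 z - t * z\<^sup>2 - 2 * k" if "z \<in> Z" for z
    using e[OF that] by (simp add: E_def k_def)
  have "((\<lambda>z. (V2 z - 2 * k) / z + t * z) has_real_derivative 0) (at z)" if z: "z \<in> Z" for z
  proof -
    have "((\<lambda>z. (V2 z - 2 * k) / z + t * z) has_real_derivative (V3 z * z - (V2 z - 2 * k)) / (z * z) + t) (at z)"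
      using d(3)[OF z] Z_pos(1)[OF z] by (auto intro!: derivative_eq_intros)
    moreover have "(V3 z * z - (V2 z - 2 * k)) / (z * z) + t = 0"
      using V3[OF z] Z_pos(1)[OF z] by (simp add: field_simps power2_eq_square)
    ultimately show ?thesis by simp
  qed
  then obtain a where a: "\<And>z. z \<in> Z \<Longrightarrow> (V2 z - 2 * k) / z + t * z = a" using Z_constant by blast
  define A1 where "A1 = - t / 12"
  define A2 where "A2 = a / 6"
  have V2: "V2 z = 12 * A1 * z\<^sup>2 + 6 * A2 * z + 2 * k" if z: "z \<in> Z" for z
    using a[OF z] Z_pos(1)[OF z] by (simp add: A1_def A2_def field_simps power2_eq_square)
  have "((\<lambda>z. V1 z - (4 * A1 * z ^ 3 + 3 * A2 * z\<^sup>2 + 2 * k * z)) has_real_derivative 0) (at z)" if z: "z \<in> Z" for z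
    using V2[OF z] d(2)[OF z] by (auto intro!: derivative_eq_intros)
  then obtain A3 where A3: "\<And>z. z \<in> Z \<Longrightarrow> V1 z - (4 * A1 * z ^ 3 + 3 * A2 * z\<^sup>2 + 2 * k * z) = A3" using Z_constant by blast
  have "((\<lambda>z. V z - (A1 * z ^ 4 + A2 * z ^ 3 + k * z\<^sup>2 + A3 * z)) has_real_derivative 0) (at z)" if z: "z \<in> Z" for z
    using A3[OF z] d(1)[OF z] by (auto intro!: derivative_eq_intros)
  then obtain A4 where A4: "\<And>z. z \<in> Z \<Longrightarrow> V z - (A1 * z ^ 4 + A2 * z ^ 3 + k * z\<^sup>2 + A3 * z) = A4" using Z_constant by blast
  have "calabi_quartic V W k A1 A2 A3 A4"
    unfolding calabi_quartic_def
  proof clarify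
    fix p z t assume "(p, z, t) \<in> W"
    then have "z \<in> Z" by (force simp: Z_def)
    from A4[OF this] show "V z = A1 * z ^ 4 + A2 * z ^ 3 + k * z\<^sup>2 + A3 * z + A4" by simp
  qed
  then show ?thesis using kc by blast
qed

end

text \<open>An affine function with two zeros vanishes. Each equivalence is decided by the values at two points of
  the interval, after clearing denominators.\<close>

lemma affine_zero:
  fixes a b s t :: real
  assumes "a + b * s = 0" "a + b * t = 0" "s \<noteq> t"
  shows "a = 0" "b = 0"
proof -
  have "b * (s - t) = (a + b * s) - (a + b * t)" by (simp add: algebra_simps)
  then have "b * (s - t) = 0" unfolding assms(1,2) by simp
  then show "b = 0" using assms(3) by simp
  then show "a = 0" using assms(1) by simp
qed

locale calabi_quartic_data = calabi_surface_data S W V gS al g J I K M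
  for S :: "('i, 's::{t2_space, second_countable_topology}, 2) atlas"
    and W :: "('s \<times> real \<times> real) set" and V :: "real \<Rightarrow> real"
    and gS :: "'i \<Rightarrow> real^2 \<Rightarrow> real^2^2" and al :: "'i \<Rightarrow> real^2 \<Rightarrow> real^2"
    and g J I :: "'i \<Rightarrow> real^4 \<Rightarrow> real^4^4" and K :: "'i \<Rightarrow> real^4 \<Rightarrow> real^4"
    and M :: "('i, 's \<times> real \<times> real, 4) atlas" +
  fixes k A1 A2 A3 A4 :: real
  assumes gauss: "constant_gauss_curvature S gS k" and V_quartic: "calabi_quartic V W k A1 A2 A3 A4"
begin

lemma quartic_charts:
  assumes i: "i \<in> idx M"
  obtains u v \<phi> where "quartic_profile (coords S i) (coords M i) u v \<phi> (al i) k A1 A2 A3 A4 (g i)"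
    and "kaehler_profile (coords S i) (coords M i) u v \<phi> (al i) (\<lambda>y. k) (quartic k A1 A2 A3 A4)
      (quartic1 k A1 A2 A3) (quartic2 k A1 A2) (g i) (J i)"
proof -
  obtain u v \<phi> where c: "calabi_base (coords S i) (coords M i) u v \<phi> (al i) (gauss_curvature (gS i))"
    "\<And>x. x \<in> coords M i \<Longrightarrow> g i x = profile_metric u v (al i) V x"
    "\<And>x. x \<in> coords M i \<Longrightarrow> twist (g i x) (J i x) = profile_form u v (al i) x"
    by (rule chart[OF i]) (assumption | rule that)+
  interpret calabi_base "coords S i" "coords M i" u v \<phi> "al i" "gauss_curvature (gS i)" by (rule c)
  have k: "gauss_curvature (gS i) y = k" if "y \<in> coords S i" for y
    using gauss i that by (simp add: constant_gauss_curvature_def everywhere_def idx_M)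
  have V: "V z = quartic k A1 A2 A3 A4 z" if "z \<in> Z" for z
    using V_quartic that unfolding calabi_quartic_def Z_def quartic_def by force
  have *: "momentum_profile (coords S i) (coords M i) u v \<phi> (al i) (\<lambda>y. k) (quartic k A1 A2 A3 A4)
      (quartic1 k A1 A2 A3) (quartic2 k A1 A2) (g i)"
  proof
    show "open (coords S i)" "open (coords M i)" by (rule open_D open_N)+
    show "ext_d \<phi> y = - k *\<^sub>R wedge (u y) (v y)" if "y \<in> coords S i" for y
      using d\<phi>[OF that] k[OF that] by simp
    fix x assume x: "x \<in> coords M i"
    note z = coords_Z[OF x]
    show "0 < x $ 3" by (rule Z_pos(1)[OF z])
    show "0 < quartic k A1 A2 A3 A4 (x $ 3)"
      unfolding V[OF z, symmetric] by (rule Z_pos(2)[OF z])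
    show "(quartic k A1 A2 A3 A4 has_real_derivative quartic1 k A1 A2 A3 (x $ 3)) (at (x $ 3))"
      unfolding quartic_def[abs_def] quartic1_def by (auto intro!: derivative_eq_intros)
    show "(quartic1 k A1 A2 A3 has_real_derivative quartic2 k A1 A2 (x $ 3)) (at (x $ 3))"
      unfolding quartic1_def[abs_def] quartic2_def by (auto intro!: derivative_eq_intros)
    show "g i x = profile_metric u v (al i) (quartic k A1 A2 A3 A4) x"
      unfolding c(2)[OF x] profile_metric_def V[OF z] ..
  qed (rule base_N smooth area du dv d\<alpha>; assumption)+
  show ?thesis
    by (rule that[of u v \<phi>]) (simp_all add: quartic_profile_def kaehler_profile_def kaehler_profile_axioms_def * c(3))
qed

text \<open>The geometry at a point with momentum \<open>z\<close>. For the bi-extremal condition, the pfaffian is \<open>4 p q\<close>, and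
  the last equation states that its second derivative in \<open>z\<close> vanishes.\<close>

lemma pointwise:
  assumes i: "i \<in> idx M" and x: "x \<in> coords M i"
  defines "z \<equiv> x $ 3"
  shows "norm_scal (g i) x = - 2 * A1 * z - A2"
    and "ricci_form g J i x = (- A1 * z + A3 / (2 * z\<^sup>2)) *\<^sub>R twist (g i x) (I i x)
      + (3/2 * norm_scal (g i) x) *\<^sub>R twist (g i x) (J i x)"
    and "conformal_scalar_curvature g (\<lambda>i x. x $ 3) i x = - A3 / z\<^sup>2 - 2 * A4 / z ^ 3"
    and "(\<forall>a b c d. weyl_plus (g i) x a b c d = 0) \<longleftrightarrow> - A1 * z - A2 / 2 = 0"
    and "(\<forall>a b c d. weyl_minus (g i) x a b c d = 0) \<longleftrightarrow> - A3 / (2 * z\<^sup>2) - A4 / z ^ 3 = 0"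
    and "(\<forall>b c d. div_weyl_minus (g i) x b c d = 0) \<longleftrightarrow> A3 = 0"
    and "(\<forall>b c. bach (g i) x b c = 0) \<longleftrightarrow> 4 * A1 * A4 - A2 * A3 = 0"
    and "ricci (g i) x = t *\<^sub>R g i x \<longleftrightarrow> - 2 * A1 * z - 3 * A2 / 2 - A3 / (2 * z\<^sup>2) = t \<and>
      - 4 * A1 * z - 3 * A2 / 2 + A3 / (2 * z\<^sup>2) = t"
    and "\<forall>a b. lie_metric (g i) (\<lambda>x. J i x *v gradient (g i) (norm_scal (g i)) x) x a b = 0"
    and "(\<forall>a b. lie_metric (g i) (\<lambda>x. J i x *v gradient (g i) (pfaffian g J i) x) x a b = 0) \<longleftrightarrow>
      2 * A1 * A3 / z ^ 3 - 5 * A3\<^sup>2 / z ^ 6 = 0"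
proof -
  obtain u v \<phi> where qp: "quartic_profile (coords S i) (coords M i) u v \<phi> (al i) k A1 A2 A3 A4 (g i)"
    and kp: "kaehler_profile (coords S i) (coords M i) u v \<phi> (al i) (\<lambda>y. k) (quartic k A1 A2 A3 A4)
      (quartic1 k A1 A2 A3) (quartic2 k A1 A2) (g i) (J i)"
    by (rule quartic_charts[OF i]) (assumption | rule that)+
  interpret Q: quartic_profile "coords S i" "coords M i" u v \<phi> "al i" k A1 A2 A3 A4 "g i" by (rule qp)
  interpret P: kaehler_profile "coords S i" "coords M i" u v \<phi> "al i" "\<lambda>y. k" "quartic k A1 A2 A3 A4"
      "quartic1 k A1 A2 A3" "quartic2 k A1 A2" "g i" "J i" by (rule kp)
  have z: "z > 0" using Q.z_pos[OF x] by (simp add: z_def)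
  have ns: "norm_scal (g i) y = - 2 * A1 * (y $ 3) - A2" if y: "y \<in> coords M i" for y
    by (simp add: norm_scal_def Q.scal_quartic[OF y] Q.s_def)
  show "norm_scal (g i) x = - 2 * A1 * z - A2" unfolding z_def by (rule ns[OF x])
  have opp: "twist (g i x) (I i x) = - twist (g i x) (J i x) + 2 *\<^sub>R wedge (axis 3 1) (P.\<eta> x)"
    by (rule P.twist_opposite[OF x opposite[OF i x]])
  have "ricci_form g J i x = (2 * (Q.p z + Q.s z)) *\<^sub>R twist (g i x) (J i x) + (2 * Q.\<mu> z) *\<^sub>R wedge (axis 3 1) (P.\<eta> x)"
    unfolding ricci_form_def P.twist_split[OF x Q.ricci_quartic[OF x]] Q.q_minus_p[symmetric] z_def
    by (simp add: algebra_simps)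
  also have "\<dots> = Q.\<mu> z *\<^sub>R twist (g i x) (I i x) + (2 * (Q.p z + Q.s z) + Q.\<mu> z) *\<^sub>R twist (g i x) (J i x)"
    unfolding opp by (simp add: algebra_simps)
  also have "2 * (Q.p z + Q.s z) + Q.\<mu> z = 3/2 * norm_scal (g i) x"
    unfolding ns[OF x] Q.p_def Q.s_def Q.\<mu>_def z_def[symmetric] using z by (simp add: field_simps)
  finally show "ricci_form g J i x = (- A1 * z + A3 / (2 * z\<^sup>2)) *\<^sub>R twist (g i x) (I i x)
      + (3/2 * norm_scal (g i) x) *\<^sub>R twist (g i x) (J i x)" by (simp add: Q.\<mu>_def)
  have "conformal_metric g (\<lambda>i x. x $ 3) i = (\<lambda>x. (1 / (x $ 3)\<^sup>2) *\<^sub>R g i x)"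
    by (simp add: conformal_metric_def fun_eq_iff)
  then have "scal (conformal_metric g (\<lambda>i x. x $ 3) i) x = - 6 * A3 - 12 * A4 / z"
    unfolding z_def by (simp only: Q.conformal_scal_quartic[OF x])
  then show "conformal_scalar_curvature g (\<lambda>i x. x $ 3) i x = - A3 / z\<^sup>2 - 2 * A4 / z ^ 3"
    using z unfolding conformal_scalar_curvature_def norm_scal_def z_def[symmetric]
    by (simp add: field_simps power2_eq_square power3_eq_cube)
  show "(\<forall>a b c d. weyl_plus (g i) x a b c d = 0) \<longleftrightarrow> - A1 * z - A2 / 2 = 0"
    unfolding Q.weyl_plus_zero_iff[OF x] Q.s_def z_def ..
  show "(\<forall>a b c d. weyl_minus (g i) x a b c d = 0) \<longleftrightarrow> - A3 / (2 * z\<^sup>2) - A4 / z ^ 3 = 0"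
    unfolding Q.weyl_minus_zero_iff[OF x] Q.w_def z_def ..
  show "(\<forall>b c d. div_weyl_minus (g i) x b c d = 0) \<longleftrightarrow> A3 = 0" by (rule Q.div_weyl_minus_zero_iff[OF x])
  show "(\<forall>b c. bach (g i) x b c = 0) \<longleftrightarrow> 4 * A1 * A4 - A2 * A3 = 0" by (rule Q.bach_zero_iff[OF x])
  have "2 * (Q.p z + Q.s z) = - 2 * A1 * z - 3 * A2 / 2 - A3 / (2 * z\<^sup>2)"
    "2 * (Q.q z + Q.s z) = - 4 * A1 * z - 3 * A2 / 2 + A3 / (2 * z\<^sup>2)"
    using z by (simp_all add: Q.p_def Q.q_def Q.s_def field_simps)
  then show "ricci (g i) x = t *\<^sub>R g i x \<longleftrightarrow> - 2 * A1 * z - 3 * A2 / 2 - A3 / (2 * z\<^sup>2) = t \<and>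
      - 4 * A1 * z - 3 * A2 / 2 + A3 / (2 * z\<^sup>2) = t"
    unfolding Q.einstein_iff[OF x] z_def[symmetric] by simp
  show "\<forall>a b. lie_metric (g i) (\<lambda>x. J i x *v gradient (g i) (norm_scal (g i)) x) x a b = 0"
  proof -
    have "((\<lambda>z. - 2 * A1 * z - A2) has_real_derivative - 2 * A1) (at (y $ 3))" for y :: "real^4"
      by (auto intro!: derivative_eq_intros)
    from P.holomorphic_potential_iff[OF x killing_K[OF i x] ns this DERIV_const]
    show ?thesis by simp
  qed
  show "(\<forall>a b. lie_metric (g i) (\<lambda>x. J i x *v gradient (g i) (pfaffian g J i) x) x a b = 0) \<longleftrightarrow>
      2 * A1 * A3 / z ^ 3 - 5 * A3\<^sup>2 / z ^ 6 = 0"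
  proof (rule P.holomorphic_potential_iff[OF x killing_K[OF i x]])
    fix y assume y: "y \<in> coords M i"
    have zy: "y $ 3 > 0" by (rule Q.z_pos[OF y])
    have "pfaffian g J i y = 4 * (Q.p (y $ 3) * Q.q (y $ 3))"
      unfolding pfaffian_def Let_def by (rule P.pfaffian_split[OF y Q.norm_ricci_quartic[OF y]])
    also have "\<dots> = A1 * A2 * (y $ 3) + A2\<^sup>2 / 4 + A1 * A3 / (y $ 3) - A3\<^sup>2 / (4 * (y $ 3) ^ 4)"
      using zy by (simp add: Q.p_def Q.q_def field_simps power2_eq_square power4_eq_xxxx)
    finally show "pfaffian g J i y = A1 * A2 * (y $ 3) + A2\<^sup>2 / 4 + A1 * A3 / (y $ 3) - A3\<^sup>2 / (4 * (y $ 3) ^ 4)" .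
    show "((\<lambda>z. A1 * A2 * z + A2\<^sup>2 / 4 + A1 * A3 / z - A3\<^sup>2 / (4 * z ^ 4)) has_real_derivative
        A1 * A2 - A1 * A3 / (y $ 3)\<^sup>2 + A3\<^sup>2 / (y $ 3) ^ 5) (at (y $ 3))"
      by (rule derivative_eq_intros refl | use zy in force)+
         (use zy in \<open>simp add: field_simps eval_nat_numeral\<close>)
  next
    show "((\<lambda>z. A1 * A2 - A1 * A3 / z\<^sup>2 + A3\<^sup>2 / z ^ 5) has_real_derivative
        2 * A1 * A3 / z ^ 3 - 5 * A3\<^sup>2 / z ^ 6) (at (x $ 3))"
      unfolding z_def[symmetric]
      by (rule derivative_eq_intros refl | use z in force)+
         (use z in \<open>simp add: field_simps eval_nat_numeral\<close>)
  qed
qed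

lemma scal: "i \<in> idx M \<Longrightarrow> x \<in> coords M i \<Longrightarrow> scal (g i) x = - 12 * A1 * x $ 3 - 6 * A2"
  using pointwise(1)[of i x] by (simp add: norm_scal_def)

lemma extremal: "extremal M g J"
  using pointwise(9) by (simp add: extremal_def holomorphic_potential_def killing_def everywhere_def)

text \<open>The cubes serve conditions that are affine in \<open>z\<^sup>3\<close> rather than in \<open>z\<close>.\<close>

lemma two_points: obtains z1 z2 where "z1 \<in> Z" "z2 \<in> Z" "z1 \<noteq> z2" "z1 ^ 3 \<noteq> z2 ^ 3"
proof -
  obtain z where z: "z \<in> Z" using Z_nonempty by blast
  then obtain e where e: "e > 0" "ball z e \<subseteq> Z" using Z_open open_contains_ball by blast
  have "z + e / 2 \<in> Z" using e by (auto simp: dist_real_def)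
  moreover have "z ^ 3 < (z + e / 2) ^ 3"
    by (rule power_strict_mono) (use e(1) Z_pos(1)[OF z] in auto)
  ultimately show ?thesis using that[of z "z + e / 2"] z e(1) by auto
qed

lemma constant_scalar_curvature_iff: "constant_scalar_curvature M g \<longleftrightarrow> A1 = 0"
proof -
  obtain z1 z2 where zz: "z1 \<in> Z" "z2 \<in> Z" and ne: "z1 \<noteq> z2" and cubes: "z1 ^ 3 \<noteq> z2 ^ 3" by (rule two_points)
  have "constant_scalar_curvature M g \<longleftrightarrow> (\<exists>c. everywhere M (\<lambda>i x. - 12 * A1 * x $ 3 - 6 * A2 = c))"
    unfolding constant_scalar_curvature_def by (intro ex_cong1 everywhere_cong) (simp add: scal)
  also have "\<dots> \<longleftrightarrow> (\<exists>c. \<forall>z\<in>Z. - 12 * A1 * z - 6 * A2 = c)"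
    by (simp only: everywhere_Z[of "\<lambda>z. - 12 * A1 * z - 6 * A2 = _"])
  also have "\<dots> \<longleftrightarrow> A1 = 0"
  proof
    assume "\<exists>c. \<forall>z\<in>Z. - 12 * A1 * z - 6 * A2 = c"
    then obtain c where c: "\<And>z. z \<in> Z \<Longrightarrow> - 12 * A1 * z - 6 * A2 = c" by blast
    have "(- 6 * A2 - c) + (- 12 * A1) * z = 0" if "z \<in> Z" for z using c[OF that] by linarith
    from affine_zero(2)[OF this[OF zz(1)] this[OF zz(2)] ne] show "A1 = 0" by simp
  qed auto
  finally show ?thesis .
qed

lemma scalar_zero_iff: "(\<forall>z\<in>Z. - A1 * z - A2 / 2 = 0) \<longleftrightarrow> A1 = 0 \<and> A2 = 0"
proof
  obtain z1 z2 where zz: "z1 \<in> Z" "z2 \<in> Z" and ne: "z1 \<noteq> z2" and cubes: "z1 ^ 3 \<noteq> z2 ^ 3" by (rule two_points)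
  assume *: "\<forall>z\<in>Z. - A1 * z - A2 / 2 = 0"
  have "- A2 / 2 + (- A1) * z = 0" if "z \<in> Z" for z using *[rule_format, OF that] by linarith
  from affine_zero[OF this[OF zz(1)] this[OF zz(2)] ne] show "A1 = 0 \<and> A2 = 0" by simp
qed simp

lemma scalar_flat_iff: "scalar_flat M g \<longleftrightarrow> A1 = 0 \<and> A2 = 0"
proof -
  have "scalar_flat M g \<longleftrightarrow> everywhere M (\<lambda>i x. - A1 * x $ 3 - A2 / 2 = 0)"
  proof -
    have "- 12 * A1 * z - 6 * A2 = 12 * (- A1 * z - A2 / 2)" for z by (simp add: algebra_simps)
    then have "scal (g i) x = 0 \<longleftrightarrow> - A1 * x $ 3 - A2 / 2 = 0" if "i \<in> idx M" "x \<in> coords M i" for i x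
      unfolding scal[OF that] by (simp only: mult_eq_0_iff) simp
    then show ?thesis unfolding scalar_flat_def by (rule everywhere_cong)
  qed
  then show ?thesis by (simp only: everywhere_Z[of "\<lambda>z. - A1 * z - A2 / 2 = 0"] scalar_zero_iff)
qed

lemma anti_selfdual_iff: "anti_selfdual M g \<longleftrightarrow> A1 = 0 \<and> A2 = 0"
proof -
  have "anti_selfdual M g \<longleftrightarrow> everywhere M (\<lambda>i x. - A1 * x $ 3 - A2 / 2 = 0)"
    unfolding anti_selfdual_def by (rule everywhere_cong) (rule pointwise(4))
  then show ?thesis by (simp only: everywhere_Z[of "\<lambda>z. - A1 * z - A2 / 2 = 0"] scalar_zero_iff)
qed

lemma selfdual_iff: "selfdual M g \<longleftrightarrow> A3 = 0 \<and> A4 = 0"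
proof -
  obtain z1 z2 where zz: "z1 \<in> Z" "z2 \<in> Z" and ne: "z1 \<noteq> z2" and cubes: "z1 ^ 3 \<noteq> z2 ^ 3" by (rule two_points)
  have "selfdual M g \<longleftrightarrow> everywhere M (\<lambda>i x. - A3 / (2 * (x $ 3)\<^sup>2) - A4 / (x $ 3) ^ 3 = 0)"
    unfolding selfdual_def by (rule everywhere_cong) (rule pointwise(5))
  also have "\<dots> \<longleftrightarrow> (\<forall>z\<in>Z. - A3 / (2 * z\<^sup>2) - A4 / z ^ 3 = 0)"
    by (simp only: everywhere_Z[of "\<lambda>z. - A3 / (2 * z\<^sup>2) - A4 / z ^ 3 = 0"])
  also have "\<dots> \<longleftrightarrow> (\<forall>z\<in>Z. 2 * A4 + A3 * z = 0)"
    by (rule ball_cong[OF refl]) (use Z_pos(1) in \<open>force simp: field_simps power2_eq_square power3_eq_cube\<close>)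
  also have "\<dots> \<longleftrightarrow> A3 = 0 \<and> A4 = 0"
  proof
    assume *: "\<forall>z\<in>Z. 2 * A4 + A3 * z = 0"
    from affine_zero[OF *[rule_format, OF zz(1)] *[rule_format, OF zz(2)] ne] show "A3 = 0 \<and> A4 = 0" by simp
  qed simp
  finally show ?thesis .
qed

lemma weakly_selfdual_iff: "weakly_selfdual M g \<longleftrightarrow> A3 = 0"
proof -
  have "weakly_selfdual M g \<longleftrightarrow> everywhere M (\<lambda>i x. A3 = 0)"
    unfolding weakly_selfdual_def by (rule everywhere_cong) (rule pointwise(6))
  then show ?thesis using everywhere_Z[of "\<lambda>z. A3 = 0"] Z_nonempty by auto
qed

lemma bach_flat_iff: "bach_flat M g \<longleftrightarrow> 4 * A1 * A4 - A2 * A3 = 0"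
proof -
  have "bach_flat M g \<longleftrightarrow> everywhere M (\<lambda>i x. 4 * A1 * A4 - A2 * A3 = 0)"
    unfolding bach_flat_def by (rule everywhere_cong) (rule pointwise(7))
  then show ?thesis using everywhere_Z[of "\<lambda>z. 4 * A1 * A4 - A2 * A3 = 0"] Z_nonempty by auto
qed

lemma kaehler_einstein_iff: "kaehler_einstein M g J \<longleftrightarrow> A1 = 0 \<and> A3 = 0"
proof -
  obtain z1 z2 where zz: "z1 \<in> Z" "z2 \<in> Z" and ne: "z1 \<noteq> z2" and cubes: "z1 ^ 3 \<noteq> z2 ^ 3" by (rule two_points)
  let ?P = "\<lambda>t z. - 2 * A1 * z - 3 * A2 / 2 - A3 / (2 * z\<^sup>2) = t \<and> - 4 * A1 * z - 3 * A2 / 2 + A3 / (2 * z\<^sup>2) = t"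
  have "kaehler_surface M g J" using type by (simp add: calabi_type_def)
  then have "kaehler_einstein M g J \<longleftrightarrow> (\<exists>t. everywhere M (\<lambda>i x. ricci (g i) x = t *\<^sub>R g i x))"
    by (simp add: kaehler_einstein_def)
  also have "\<dots> \<longleftrightarrow> (\<exists>t. everywhere M (\<lambda>i x. ?P t (x $ 3)))"
    by (intro ex_cong1 everywhere_cong) (rule pointwise(8))
  also have "\<dots> \<longleftrightarrow> (\<exists>t. \<forall>z\<in>Z. ?P t z)"
    by (intro ex_cong1 everywhere_Z)
  also have "\<dots> \<longleftrightarrow> A1 = 0 \<and> A3 = 0"
  proof
    assume "\<exists>t. \<forall>z\<in>Z. ?P t z"
    then obtain t where t: "\<And>z. z \<in> Z \<Longrightarrow> ?P t z" by blast
    have "- A3 + 2 * A1 * z ^ 3 = 0" if "z \<in> Z" for z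
    proof -
      have "- 2 * A1 * z - A3 / (2 * z\<^sup>2) = - 4 * A1 * z + A3 / (2 * z\<^sup>2)" using t[OF that] by linarith
      then show ?thesis using Z_pos(1)[OF that] by (simp add: field_simps power2_eq_square power3_eq_cube)
    qed
    from affine_zero[OF this[OF zz(1)] this[OF zz(2)] cubes] show "A1 = 0 \<and> A3 = 0" by simp
  qed auto
  finally show ?thesis .
qed

text \<open>Multiplied by \<open>z\<^sup>6\<close>, the condition on the second derivative of the pfaffian is affine in \<open>z\<^sup>3\<close>
  with constant term \<open>- 5 A3\<^sup>2\<close>.\<close>

lemma bi_extremal_iff: "bi_extremal M g J \<longleftrightarrow> A3 = 0"
proof -
  obtain z1 z2 where zz: "z1 \<in> Z" "z2 \<in> Z" and ne: "z1 \<noteq> z2" and cubes: "z1 ^ 3 \<noteq> z2 ^ 3" by (rule two_points)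
  have "bi_extremal M g J \<longleftrightarrow> everywhere M (\<lambda>i x. \<forall>a b. lie_metric (g i) (\<lambda>x. J i x *v gradient (g i) (pfaffian g J i) x) x a b = 0)"
    using extremal by (simp add: bi_extremal_def holomorphic_potential_def killing_def)
  also have "\<dots> \<longleftrightarrow> everywhere M (\<lambda>i x. 2 * A1 * A3 / (x $ 3) ^ 3 - 5 * A3\<^sup>2 / (x $ 3) ^ 6 = 0)"
    by (rule everywhere_cong) (rule pointwise(10))
  also have "\<dots> \<longleftrightarrow> (\<forall>z\<in>Z. 2 * A1 * A3 / z ^ 3 - 5 * A3\<^sup>2 / z ^ 6 = 0)"
    by (rule everywhere_Z)
  also have "\<dots> \<longleftrightarrow> A3 = 0"
  proof
    assume *: "\<forall>z\<in>Z. 2 * A1 * A3 / z ^ 3 - 5 * A3\<^sup>2 / z ^ 6 = 0"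
    have "- 5 * A3\<^sup>2 + 2 * A1 * A3 * z ^ 3 = 0" if "z \<in> Z" for z
      using *[rule_format, OF that] Z_pos(1)[OF that]
      by (simp add: field_simps power2_eq_square eval_nat_numeral)
    from affine_zero(1)[OF this[OF zz(1)] this[OF zz(2)] cubes] show "A3 = 0" by simp
  qed simp
  finally show ?thesis .
qed

lemma momentum_map_scal: "momentum_map M g J (\<lambda>i. scal (g i)) (\<lambda>i x. (- 12 * A1) *\<^sub>R K i x)"
  unfolding momentum_map_def everywhere_def
proof (intro ballI)
  fix i x assume i: "i \<in> idx M" and x: "x \<in> coords M i"
  have d: "((\<lambda>z. - 12 * A1 * z - 6 * A2) has_real_derivative - 12 * A1) (at (x $ 3))"
    by (auto intro!: derivative_eq_intros)
  have "pd j (scal (g i)) x = pd j (\<lambda>y. - 12 * A1 * y $ 3 - 6 * A2) x" for j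
  proof (rule pd_cong[OF coords_open[OF i] x])
    show "scal (g i) y = - 12 * A1 * y $ 3 - 6 * A2" if "y \<in> coords M i" for y
      by (rule scal[OF i that])
  qed
  then have pd: "pd j (scal (g i)) x = (if j = 3 then - 12 * A1 else 0)" for j
    using pd_coordinate_function[OF d] by simp
  obtain u v \<phi> where "kaehler_profile (coords S i) (coords M i) u v \<phi> (al i) (gauss_curvature (gS i)) V (deriv V) (deriv (deriv V)) (g i) (J i)"
    by (rule general_profile[OF i]) (assumption | rule that)+
  from kaehler_profile.J_gradient[OF this x pd] show "(- 12 * A1) *\<^sub>R K i x = J i x *v gradient (g i) (scal (g i)) x" by (simp add: K_eq)
qed

end

theorem proposition14:
  fixes S :: "('i, 's::{t2_space, second_countable_topology}, 2) atlas"
    and W :: "('s \<times> real \<times> real) set"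
    and V :: "real \<Rightarrow> real"
    and gS :: "'i \<Rightarrow> real^2 \<Rightarrow> real^2^2" and al :: "'i \<Rightarrow> real^2 \<Rightarrow> real^2"
    and g J I :: "'i \<Rightarrow> real^4 \<Rightarrow> real^4^4" and K :: "'i \<Rightarrow> real^4 \<Rightarrow> real^4"
  assumes "calabi_surface S gS al V W g J K I"
    and "M = calabi_manifold S W"
  shows "((\<exists>c. momentum_map M g J (\<lambda>i. scal (g i)) (\<lambda>i x. c *\<^sub>R K i x)) \<longleftrightarrow>
          (\<exists>k. constant_gauss_curvature S gS k \<and> (\<exists>A1 A2 A3 A4. calabi_quartic V W k A1 A2 A3 A4))) \<and>
    (\<forall>k A1 A2 A3 A4. constant_gauss_curvature S gS k \<and> calabi_quartic V W k A1 A2 A3 A4 \<longrightarrow>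
       extremal M g J \<and>
       everywhere M (\<lambda>i x. ricci_form g J i x =
         (- A1 * x$3 + A3 / (2 * (x$3)^2)) *\<^sub>R twist (g i x) (I i x)
         + (3/2 * norm_scal (g i) x) *\<^sub>R twist (g i x) (J i x)) \<and>
       everywhere M (\<lambda>i x. norm_scal (g i) x = - 2 * A1 * x$3 - A2) \<and>
       everywhere M (\<lambda>i x. conformal_scalar_curvature g (\<lambda>i x. x$3) i x
         = - A3 / (x$3)^2 - 2 * A4 / (x$3)^3) \<and>
       (constant_scalar_curvature M g \<longleftrightarrow> A1 = 0) \<and>
       (scalar_flat M g \<longleftrightarrow> A1 = 0 \<and> A2 = 0) \<and>
       (anti_selfdual M g \<longleftrightarrow> A1 = 0 \<and> A2 = 0) \<and>
       (kaehler_einstein M g J \<longleftrightarrow> A1 = 0 \<and> A3 = 0) \<and>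
       (weakly_selfdual M g \<longleftrightarrow> A3 = 0) \<and>
       (selfdual M g \<longleftrightarrow> A3 = 0 \<and> A4 = 0) \<and>
       (bi_extremal M g J \<longleftrightarrow> weakly_selfdual M g) \<and>
       (bach_flat M g \<longleftrightarrow> 4 * A1 * A4 - A2 * A3 = 0))"
proof -
  interpret calabi_surface_data S W V gS al g J I K M
    using assms by unfold_locales
  have quartic: "calabi_quartic_data S W V gS al g J I K M k A1 A2 A3 A4"
    if "constant_gauss_curvature S gS k" "calabi_quartic V W k A1 A2 A3 A4" for k A1 A2 A3 A4
    using that by unfold_locales
  have main: "extremal M g J \<and>
       everywhere M (\<lambda>i x. ricci_form g J i x =
         (- A1 * x$3 + A3 / (2 * (x$3)^2)) *\<^sub>R twist (g i x) (I i x)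
         + (3/2 * norm_scal (g i) x) *\<^sub>R twist (g i x) (J i x)) \<and>
       everywhere M (\<lambda>i x. norm_scal (g i) x = - 2 * A1 * x$3 - A2) \<and>
       everywhere M (\<lambda>i x. conformal_scalar_curvature g (\<lambda>i x. x$3) i x
         = - A3 / (x$3)^2 - 2 * A4 / (x$3)^3) \<and>
       (constant_scalar_curvature M g \<longleftrightarrow> A1 = 0) \<and>
       (scalar_flat M g \<longleftrightarrow> A1 = 0 \<and> A2 = 0) \<and>
       (anti_selfdual M g \<longleftrightarrow> A1 = 0 \<and> A2 = 0) \<and>
       (kaehler_einstein M g J \<longleftrightarrow> A1 = 0 \<and> A3 = 0) \<and>
       (weakly_selfdual M g \<longleftrightarrow> A3 = 0) \<and>
       (selfdual M g \<longleftrightarrow> A3 = 0 \<and> A4 = 0) \<and>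
       (bi_extremal M g J \<longleftrightarrow> weakly_selfdual M g) \<and>
       (bach_flat M g \<longleftrightarrow> 4 * A1 * A4 - A2 * A3 = 0)"
    if "constant_gauss_curvature S gS k" "calabi_quartic V W k A1 A2 A3 A4" for k A1 A2 A3 A4
  proof -
    interpret calabi_quartic_data S W V gS al g J I K M k A1 A2 A3 A4 by (rule quartic[OF that])
    show ?thesis
      unfolding constant_scalar_curvature_iff scalar_flat_iff anti_selfdual_iff kaehler_einstein_iff
        weakly_selfdual_iff selfdual_iff bi_extremal_iff bach_flat_iff
      using extremal pointwise(1,2,3) by (simp add: everywhere_def)
  qed
  show ?thesis
  proof (intro conjI[OF iffI] allI impI; (elim exE conjE)?)
    show "\<exists>k. constant_gauss_curvature S gS k \<and> (\<exists>A1 A2 A3 A4. calabi_quartic V W k A1 A2 A3 A4)"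
      if "momentum_map M g J (\<lambda>i. scal (g i)) (\<lambda>i x. c *\<^sub>R K i x)" for c
      using that by (rule momentum_map_imp_quartic)
    show "\<exists>c. momentum_map M g J (\<lambda>i. scal (g i)) (\<lambda>i x. c *\<^sub>R K i x)"
      if "constant_gauss_curvature S gS k" "calabi_quartic V W k A1 A2 A3 A4" for k A1 A2 A3 A4
      using calabi_quartic_data.momentum_map_scal[OF quartic[OF that]] by blast
  qed (rule main)
qed

end
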